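(* Let $(a_n)_{n\ge0}$ be a sequence of positive numbers for which there are constants $0<c_1\le C_1<\infty$ with $c_1\le a_n\le C_1$ for all $n\ge 0$, and let $F(z)=\sum_{n\ge0}\zeta_n a_n z^n$. For $0<r<1$ let $\mathrm{Hole}(r)=\{F\ne0\text{ on }\{|z|\le r\}\}$. Then there exist constants $0<c_2\le C_2<\infty$, not depending on $r$, such that $$\frac{c_2}{1-r}\le -\log\mathbb P[\mathrm{Hole}(r)]\le \frac{C_2}{1-r}\qquad\text{for all }\tfrac12\le r<1.$$
   Context: $(\zeta_n)_{n\ge0}$ is a sequence of independent standard complex Gaussian random variables: each has density $\frac1\pi e^{-|z|^2}$ with respect to planar Lebesgue measure on $\mathbb C$. The series almost surely has radius of convergence $1$. *)

theory Defs
  imports "HOL-Probability.Probability"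
begin

text \<open>On \<^typ>\<open>complex\<close>, \<^const>\<open>lborel\<close> is planar Lebesgue measure with respect to the orthonormal
  basis \<open>1, \<i>\<close>, so the density below integrates to \<open>1\<close>.\<close>

definition std_complex_gaussian :: "'a measure \<Rightarrow> ('a \<Rightarrow> complex) \<Rightarrow> bool" where
  "std_complex_gaussian M X \<longleftrightarrow>
     distributed M lborel X (\<lambda>z. ennreal (exp (- (cmod z)\<^sup>2) / pi))"

definition gaussian_series ::
  "(nat \<Rightarrow> real) \<Rightarrow> (nat \<Rightarrow> 'a \<Rightarrow> complex) \<Rightarrow> 'a \<Rightarrow> complex \<Rightarrow> complex" where
  "gaussian_series a \<zeta> \<omega> z = (\<Sum>n. \<zeta> n \<omega> * complex_of_real (a n) * z ^ n)"

definition Hole ::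
  "'a measure \<Rightarrow> (nat \<Rightarrow> real) \<Rightarrow> (nat \<Rightarrow> 'a \<Rightarrow> complex) \<Rightarrow> real \<Rightarrow> 'a set" where
  "Hole M a \<zeta> r = {\<omega> \<in> space M. \<forall>z. cmod z \<le> r \<longrightarrow> gaussian_series a \<zeta> \<omega> z \<noteq> 0}"

text \<open>The series has radius of convergence \<open>1\<close> only almost surely; on the exceptional null set
  the value of \<^const>\<open>suminf\<close> is unspecified, and there \<^const>\<open>Hole\<close> need not belong to
  \<open>sets M\<close> if \<open>M\<close> is not complete. Its probability is therefore taken in the completion
  of \<open>M\<close>, which makes the choice of values on null sets irrelevant.\<close>

definition hole_prob ::
  "'a measure \<Rightarrow> (nat \<Rightarrow> real) \<Rightarrow> (nat \<Rightarrow> 'a \<Rightarrow> complex) \<Rightarrow> real \<Rightarrow> real" where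
  "hole_prob M a \<zeta> r = measure (completion M) (Hole M a \<zeta> r)"

text \<open>Since \<open>ln 0 = 0\<close>, and \<^const>\<open>measure\<close> is \<open>0\<close> on non-measurable sets, a strictly positive
  lower bound on \<open>- ln (hole_prob M a \<zeta> r)\<close> entails that the event is measurable
  in the completion and has positive probability.\<close>

end

theory Submission
  imports Defs "HOL-Complex_Analysis.Complex_Analysis"
begin

text \<open>Upper bound for the probability. On the hole event \<open>F = G\<^sup>2\<close> with \<open>G\<close> analytic in \<open>|z| < r\<close>, and by
  Parseval and Cauchy--Schwarz the Taylor coefficients \<open>g k\<close> of \<open>G\<close> satisfy
  \<open>\<Sum>k. |g k|\<^sup>2 \<rho> ^ (2 k) \<le> mean |F| \<le> (mean |F|\<^sup>2) ^ (1/2)\<close> on the circle \<open>|z| = \<rho>\<close> with \<open>\<rho> = r\<^sup>2\<close>.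
  The coefficients of \<open>F\<close> depend on those of \<open>G\<close> in a triangular way, with diagonal entries
  \<open>2 g 0\<close>, so that with \<open>N \<approx> 1 / (1 - r)\<close>, \<open>|F 0| \<le> \<eta> \<surd>N\<close> and \<open>mean |F|\<^sup>2 = O(N)\<close> such a configuration
  has probability at most \<open>(const * \<eta>) ^ N\<close>. The complementary conditions fail with
  probability \<open>exp (- const * N)\<close>.

  Lower bound. It suffices that \<open>|\<zeta> 0|\<close> exceeds a multiple of \<open>\<surd>N\<close> while \<open>F - F 0\<close> is smaller than that
  on \<open>|z| \<le> r\<close>. The latter is a small ball estimate for finitely many linear functionals of a Gaussian
  vector \<open>X\<close>: by the pigeonhole principle two independent copies of \<open>X\<close> have nearly equal functionals
  with probability \<open>exp (- const * N)\<close>, and \<open>(X - X') / \<surd>2\<close> has the same law as \<open>X\<close>.\<close>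

section \<open>The standard complex Gaussian measure\<close>

text \<open>Both directions must avoid a logarithm. The typical maximum of \<open>|F|\<close> on the
  disc is of order sqrt(N log N), and making \<open>\<zeta> 0\<close> exceed it costs exp(- const *
  N log N). So the rest of the series is forced down to order sqrt(N), below its typical size, which
  costs only exp(- const * N). The sampled values are correlated and outnumber the variables, so
  their probabilities cannot be multiplied; the collision of two rounded copies needs nothing but
  second moments.

  In the other direction the powers of N cancel. If |\<open>\<zeta> 0\<close>| is at most \<eta>
  sqrt(N), the squared slope of each coefficient of G is at least const / (\<eta> sqrt(N)), while
  the N squares together are O(sqrt(N)), hence O(1 / sqrt(N)) on average. Each variable thus
  contributes a factor const * \<eta> free of N, and a small \<eta> makes it less than 1/e. The
  union bound leaves a prefactor 4, which makes the estimate void near r = 1/2; there a separate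
  qualitative argument takes over.\<close>

lemma nn_integral_complex_affine:
  fixes f :: "complex \<Rightarrow> ennreal"
  assumes [measurable]: "f \<in> borel_measurable borel" and "0 < t"
  shows "(\<integral>\<^sup>+z. f z \<partial>lborel) = ennreal (t\<^sup>2) * (\<integral>\<^sup>+z. f (c + t *\<^sub>R z) \<partial>lborel)"
proof -
  have "(\<integral>\<^sup>+z. f z \<partial>lborel) =
      (\<integral>\<^sup>+z. f z \<partial>density (distr lborel borel (\<lambda>z. c + t *\<^sub>R z)) (\<lambda>_. ennreal (\<bar>t\<bar> ^ DIM(complex))))"
    using lborel_affine[of t c] assms(2) by simp
  also have "\<dots> = (\<integral>\<^sup>+z. ennreal (t\<^sup>2) * f (c + t *\<^sub>R z) \<partial>lborel)"
    by (subst nn_integral_density, simp, simp, subst nn_integral_distr) auto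
  finally show ?thesis
    by (simp add: nn_integral_cmult)
qed

lemma nn_integral_real_gaussian: "(\<integral>\<^sup>+x. ennreal (exp (- x\<^sup>2)) \<partial>lborel) = ennreal (sqrt pi)"
proof -
  have "has_bochner_integral lborel (\<lambda>x::real. exp (- x\<^sup>2)) (sqrt pi)"
    using has_bochner_integral_even_function[OF gaussian_moment_0] by simp
  then show ?thesis
    by (simp add: has_bochner_integral_iff nn_integral_eq_integral)
qed

lemma nn_integral_complex_gaussian_std: "(\<integral>\<^sup>+z. ennreal (exp (- (cmod z)\<^sup>2)) \<partial>lborel) = ennreal pi"
proof -
  have "(\<integral>\<^sup>+z. ennreal (exp (- (cmod z)\<^sup>2)) \<partial>lborel)
      = (\<integral>\<^sup>+z. (\<Prod>b\<in>Basis. ennreal (exp (- (z \<bullet> b)\<^sup>2))) \<partial>(lborel :: complex measure))"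
    by (intro nn_integral_cong)
       (simp add: Basis_complex_def cmod_power2 ennreal_mult'[symmetric] exp_add[symmetric])
  also have "\<dots> = (\<Prod>b\<in>(Basis :: complex set). ennreal (sqrt pi))"
    by (subst nn_integral_lborel_prod) (auto simp: nn_integral_real_gaussian)
  also have "\<dots> = ennreal pi"
    by (simp add: ennreal_mult'[symmetric] prod_ennreal power2_eq_square)
  finally show ?thesis .
qed

lemma nn_integral_complex_gaussian:
  assumes "0 < \<alpha>"
  shows "(\<integral>\<^sup>+z. ennreal (exp (- \<alpha> * (cmod (z - c))\<^sup>2)) \<partial>lborel) = ennreal (pi / \<alpha>)"
proof -
  have s: "(1 / sqrt \<alpha>)\<^sup>2 = 1 / \<alpha>" using assms by (simp add: power_divide)
  have "(\<integral>\<^sup>+z. ennreal (exp (- \<alpha> * (cmod (z - c))\<^sup>2)) \<partial>lborel)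
     = ennreal (1 / \<alpha>) * (\<integral>\<^sup>+z. ennreal (exp (- (cmod z)\<^sup>2)) \<partial>lborel)"
    using assms by (subst nn_integral_complex_affine[where t = "1 / sqrt \<alpha>" and c = c])
       (auto simp: s power_divide norm_divide)
  then show ?thesis
    using assms by (simp add: nn_integral_complex_gaussian_std ennreal_mult'[symmetric])
qed

definition gauss :: "complex measure" where
  "gauss = density lborel (\<lambda>z. ennreal (exp (- (cmod z)\<^sup>2) / pi))"

lemma sets_gauss [simp, measurable_cong]: "sets gauss = sets borel"
  and space_gauss [simp]: "space gauss = UNIV"
  by (auto simp: gauss_def)

lemma nn_integral_gauss:
  assumes [measurable]: "f \<in> borel_measurable borel"
  shows "(\<integral>\<^sup>+z. f z \<partial>gauss) = ennreal (1 / pi) * (\<integral>\<^sup>+z. ennreal (exp (- (cmod z)\<^sup>2)) * f z \<partial>lborel)"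
  unfolding gauss_def
  by (subst nn_integral_density, simp, simp, subst nn_integral_cmult[symmetric], simp)
     (auto intro!: nn_integral_cong simp: ennreal_mult'[symmetric] mult.assoc[symmetric])

lemma nn_integral_gauss_exp:
  assumes "\<theta> < 1"
  shows "(\<integral>\<^sup>+z. ennreal (exp (\<theta> * (cmod z)\<^sup>2)) \<partial>gauss) = ennreal (1 / (1 - \<theta>))"
proof -
  have "(\<integral>\<^sup>+z. ennreal (exp (- (cmod z)\<^sup>2)) * ennreal (exp (\<theta> * (cmod z)\<^sup>2)) \<partial>lborel)
     = (\<integral>\<^sup>+z. ennreal (exp (- (1 - \<theta>) * (cmod (z - 0))\<^sup>2)) \<partial>lborel)"
    by (intro nn_integral_cong)
       (simp add: ennreal_mult'[symmetric] exp_add[symmetric] algebra_simps del: ennreal_mult)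
  also have "\<dots> = ennreal (pi / (1 - \<theta>))"
    using assms by (intro nn_integral_complex_gaussian) auto
  finally show ?thesis
    using assms by (simp add: nn_integral_gauss ennreal_mult'[symmetric])
qed

lemma prob_space_gauss: "prob_space gauss"
  using nn_integral_gauss_exp[of 0] by (intro prob_spaceI) simp

lemma nn_integral_gauss_le_lborel:
  assumes [measurable]: "f \<in> borel_measurable borel"
  shows "(\<integral>\<^sup>+z. f z \<partial>gauss) \<le> ennreal (1 / pi) * (\<integral>\<^sup>+z. f z \<partial>lborel)"
proof -
  have "ennreal (exp (- (cmod z)\<^sup>2)) * f z \<le> 1 * f z" for z
    by (intro mult_right_mono) (auto simp: ennreal_le_1)
  then show ?thesis
    by (subst nn_integral_gauss) (auto intro!: mult_left_mono nn_integral_mono)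
qed

text \<open>The Gaussian density is at most 1/pi, and Lebesgue measure is translation invariant.
  What matters is uniformity in \<open>c\<close>, which later is an arbitrary function of the
  variables not yet integrated.\<close>

lemma nn_integral_gauss_translate_le:
  assumes "0 < \<alpha>" "b \<noteq> 0"
  shows "(\<integral>\<^sup>+z. ennreal (exp (- \<alpha> * (cmod (b * z - c))\<^sup>2)) \<partial>gauss) \<le> ennreal (1 / (\<alpha> * (cmod b)\<^sup>2))"
proof -
  have eq: "\<alpha> * (cmod (b * z - c))\<^sup>2 = (\<alpha> * (cmod b)\<^sup>2) * (cmod (z - c / b))\<^sup>2" for z
  proof -
    have "b * z - c = b * (z - c / b)" using assms by (simp add: algebra_simps)
    then show ?thesis by (simp add: norm_mult power_mult_distrib)
  qed
  have "(\<integral>\<^sup>+z. ennreal (exp (- \<alpha> * (cmod (b * z - c))\<^sup>2)) \<partial>gauss)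
     \<le> ennreal (1 / pi) * (\<integral>\<^sup>+z. ennreal (exp (- \<alpha> * (cmod (b * z - c))\<^sup>2)) \<partial>lborel)"
    by (rule nn_integral_gauss_le_lborel) simp
  also have "\<dots> = ennreal (1 / pi) * ennreal (pi / (\<alpha> * (cmod b)\<^sup>2))"
    using nn_integral_complex_gaussian[of "\<alpha> * (cmod b)\<^sup>2" "c / b"] assms by (simp add: eq)
  also have "\<dots> = ennreal (1 / (\<alpha> * (cmod b)\<^sup>2))"
    using assms by (simp add: ennreal_mult'[symmetric])
  finally show ?thesis .
qed

text \<open>Orthogonal invariance: substitute \<open>x = y + \<surd>2 u\<close> and complete the square in \<open>y\<close>.\<close>

lemma nn_integral_gauss_difference:
  assumes [measurable]: "f \<in> borel_measurable borel"
  shows "(\<integral>\<^sup>+y. \<integral>\<^sup>+x. f ((x - y) /\<^sub>R sqrt 2) \<partial>gauss \<partial>gauss) = (\<integral>\<^sup>+u. f u \<partial>gauss)"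
proof -
  let ?E = "\<lambda>z. ennreal (exp (- (cmod z)\<^sup>2))"
  have sq: "(cmod y)\<^sup>2 + (cmod (y + sqrt 2 *\<^sub>R u))\<^sup>2 = (cmod u)\<^sup>2 + 2 * (cmod (y - (- (u /\<^sub>R sqrt 2))))\<^sup>2"
    for u y :: complex
  proof -
    have "x * inverse (sqrt 2) * 2 = sqrt 2 * x" for x :: real by (simp add: field_simps)
    then show ?thesis
      unfolding cmod_power2 by (simp add: field_simps power2_eq_square)
  qed
  have 1: "(\<integral>\<^sup>+x. f ((x - y) /\<^sub>R sqrt 2) \<partial>gauss)
      = ennreal (2 / pi) * (\<integral>\<^sup>+u. ?E (y + sqrt 2 *\<^sub>R u) * f u \<partial>lborel)" for y
    by (subst nn_integral_gauss, simp, subst nn_integral_complex_affine[where t = "sqrt 2" and c = y])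
       (auto simp: mult.assoc[symmetric] ennreal_mult'[symmetric] simp del: ennreal_numeral)
  have "(\<integral>\<^sup>+y. \<integral>\<^sup>+x. f ((x - y) /\<^sub>R sqrt 2) \<partial>gauss \<partial>gauss)
      = ennreal (1 / pi) * (ennreal (2 / pi) * (\<integral>\<^sup>+y. ?E y * (\<integral>\<^sup>+u. ?E (y + sqrt 2 *\<^sub>R u) * f u \<partial>lborel) \<partial>lborel))"
    unfolding 1
    by (subst nn_integral_gauss, simp, subst nn_integral_cmult[symmetric], simp)
       (auto intro!: nn_integral_cong arg_cong2[where f = "(*)"] simp: ac_simps)
  also have "(\<integral>\<^sup>+y. ?E y * (\<integral>\<^sup>+u. ?E (y + sqrt 2 *\<^sub>R u) * f u \<partial>lborel) \<partial>lborel)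
      = (\<integral>\<^sup>+y. \<integral>\<^sup>+u. ?E y * (?E (y + sqrt 2 *\<^sub>R u) * f u) \<partial>lborel \<partial>lborel)"
    by (intro nn_integral_cong) (simp add: nn_integral_cmult)
  also have "\<dots> = (\<integral>\<^sup>+u. \<integral>\<^sup>+y. ?E y * (?E (y + sqrt 2 *\<^sub>R u) * f u) \<partial>lborel \<partial>lborel)"
    by (rule lborel_pair.Fubini') simp
  also have "\<dots> = (\<integral>\<^sup>+u. (?E u * f u) * (\<integral>\<^sup>+y. ennreal (exp (- 2 * (cmod (y - (- (u /\<^sub>R sqrt 2))))\<^sup>2)) \<partial>lborel) \<partial>lborel)"
  proof (intro nn_integral_cong)
    fix u :: complex
    have e: "?E y * (?E (y + sqrt 2 *\<^sub>R u) * f u) =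
        (?E u * f u) * ennreal (exp (- 2 * (cmod (y - (- (u /\<^sub>R sqrt 2))))\<^sup>2))" for y
    proof -
      have "?E y * ?E (y + sqrt 2 *\<^sub>R u) = ?E u * ennreal (exp (- 2 * (cmod (y - (- (u /\<^sub>R sqrt 2))))\<^sup>2))"
        using sq[of y u] by (simp add: ennreal_mult'[symmetric] exp_add[symmetric])
      then have "(?E y * ?E (y + sqrt 2 *\<^sub>R u)) * f u
          = (?E u * ennreal (exp (- 2 * (cmod (y - (- (u /\<^sub>R sqrt 2))))\<^sup>2))) * f u"
        by (rule arg_cong)
      then show ?thesis by (simp only: mult.assoc mult.commute mult.left_commute)
    qed
    show "(\<integral>\<^sup>+y. ?E y * (?E (y + sqrt 2 *\<^sub>R u) * f u) \<partial>lborel) =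
        (?E u * f u) * (\<integral>\<^sup>+y. ennreal (exp (- 2 * (cmod (y - (- (u /\<^sub>R sqrt 2))))\<^sup>2)) \<partial>lborel)"
      by (subst nn_integral_cmult[symmetric], measurable) (intro nn_integral_cong e)
  qed
  also have "\<dots> = (\<integral>\<^sup>+u. ?E u * f u * ennreal (pi / 2) \<partial>lborel)"
    by (subst nn_integral_complex_gaussian) auto
  also have "\<dots> = ennreal (pi / 2) * (\<integral>\<^sup>+u. ?E u * f u \<partial>lborel)"
    by (subst nn_integral_multc) (auto simp: mult.commute)
  also have "ennreal (2 / pi) * \<dots> = (\<integral>\<^sup>+u. ?E u * f u \<partial>lborel)"
    by (simp add: mult.assoc[symmetric] ennreal_mult'[symmetric] del: ennreal_numeral)
  finally show ?thesis by (simp add: nn_integral_gauss)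
qed

text \<open>The exact value is 1. The inequality t \<le> 2 exp(t/2) reduces the moment to the
  exponential one at \<theta> = 1/2; the constant 4 is carried through all later second
  moments.\<close>

lemma nn_integral_gauss_second_moment:
  "(\<integral>\<^sup>+z. ennreal ((cmod z)\<^sup>2) \<partial>gauss) \<le> 4"
proof -
  have "(\<integral>\<^sup>+z. ennreal ((cmod z)\<^sup>2) \<partial>gauss) \<le> (\<integral>\<^sup>+z. 2 * ennreal (exp (1/2 * (cmod z)\<^sup>2)) \<partial>gauss)"
  proof (intro nn_integral_mono)
    fix z :: complex
    have "(cmod z)\<^sup>2 \<le> 2 * exp (1/2 * (cmod z)\<^sup>2)"
      using exp_ge_add_one_self[of "1/2 * (cmod z)\<^sup>2"] by linarith
    then have "ennreal ((cmod z)\<^sup>2) \<le> ennreal (2 * exp (1/2 * (cmod z)\<^sup>2))"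
      by (rule ennreal_leI)
    then show "ennreal ((cmod z)\<^sup>2) \<le> 2 * ennreal (exp (1/2 * (cmod z)\<^sup>2))"
      by (simp add: ennreal_mult)
  qed
  also have "\<dots> = 2 * ennreal (1 / (1 - 1/2))"
    by (subst nn_integral_cmult, simp, subst nn_integral_gauss_exp) auto
  also have "\<dots> = 4"
    by simp
  finally show ?thesis .
qed

text \<open>The cross term vanishes because z and -z have the same law. Averaging over
  \<open>c\<close> and \<open>- c\<close> with the parallelogram law expresses this with nonnegative
  integrands only.\<close>

lemma nn_integral_gauss_square_affine:
  "(\<integral>\<^sup>+z. ennreal ((cmod (A + c * z))\<^sup>2) \<partial>gauss) \<le> ennreal ((cmod A)\<^sup>2 + 4 * (cmod c)\<^sup>2)"
proof -
  interpret prob_space gauss by (rule prob_space_gauss)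
  let ?I = "\<lambda>c. (\<integral>\<^sup>+z. ennreal ((cmod (A + c * z))\<^sup>2) \<partial>gauss)"
  have sym: "?I c = ?I (- c)"
  proof -
    have d: "distr lborel borel uminus = (lborel :: complex measure)"
    proof -
      have "distr lborel borel uminus = distr lborel borel (\<lambda>x. 0 + (-1) *\<^sub>R (x :: complex))"
        by (rule distr_cong) auto
      also have "\<dots> = density (distr lborel borel (\<lambda>x. 0 + (-1) *\<^sub>R (x :: complex))) (\<lambda>_. ennreal (\<bar>-1\<bar> ^ DIM(complex)))"
        by (simp add: density_1)
      also have "\<dots> = lborel"
        by (rule lborel_affine[symmetric]) simp
      finally show ?thesis .
    qed
    have "(\<integral>\<^sup>+z. ennreal (exp (- (cmod z)\<^sup>2)) * ennreal ((cmod (A + c * z))\<^sup>2) \<partial>lborel)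
       = (\<integral>\<^sup>+z. ennreal (exp (- (cmod z)\<^sup>2)) * ennreal ((cmod (A + c * z))\<^sup>2) \<partial>distr lborel borel uminus)"
      by (simp add: d)
    also have "\<dots> = (\<integral>\<^sup>+z. ennreal (exp (- (cmod z)\<^sup>2)) * ennreal ((cmod (A + (- c) * z))\<^sup>2) \<partial>lborel)"
      by (subst nn_integral_distr) auto
    finally show ?thesis by (simp add: nn_integral_gauss)
  qed
  have par: "(cmod (A + c * z))\<^sup>2 + (cmod (A + (- c) * z))\<^sup>2 = 2 * (cmod A)\<^sup>2 + 2 * (cmod c)\<^sup>2 * (cmod z)\<^sup>2" for z
  proof -
    have "(cmod (x + y))\<^sup>2 + (cmod (x - y))\<^sup>2 = 2 * (cmod x)\<^sup>2 + 2 * (cmod y)\<^sup>2" for x y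
      unfolding cmod_power2 by (simp add: power2_eq_square algebra_simps)
    from this[of A "c * z"] show ?thesis by (simp add: norm_mult power_mult_distrib)
  qed
  have "2 * ?I c = ?I c + ?I (- c)" unfolding sym[symmetric] by (rule mult_2)
  also have "\<dots> = (\<integral>\<^sup>+z. ennreal ((cmod (A + c * z))\<^sup>2) + ennreal ((cmod (A + (- c) * z))\<^sup>2) \<partial>gauss)"
    by (subst nn_integral_add) auto
  also have "\<dots> = (\<integral>\<^sup>+z. ennreal (2 * (cmod A)\<^sup>2) + ennreal (2 * (cmod c)\<^sup>2) * ennreal ((cmod z)\<^sup>2) \<partial>gauss)"
  proof (intro nn_integral_cong)
    fix z :: complex
    have "ennreal ((cmod (A + c * z))\<^sup>2) + ennreal ((cmod (A + (- c) * z))\<^sup>2)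
        = ennreal ((cmod (A + c * z))\<^sup>2 + (cmod (A + (- c) * z))\<^sup>2)"
      by (rule ennreal_plus[symmetric]) auto
    also have "\<dots> = ennreal (2 * (cmod A)\<^sup>2) + ennreal (2 * (cmod c)\<^sup>2 * (cmod z)\<^sup>2)"
      unfolding par by (rule ennreal_plus) auto
    also have "ennreal (2 * (cmod c)\<^sup>2 * (cmod z)\<^sup>2) = ennreal (2 * (cmod c)\<^sup>2) * ennreal ((cmod z)\<^sup>2)"
      by (rule ennreal_mult) auto
    finally show "ennreal ((cmod (A + c * z))\<^sup>2) + ennreal ((cmod (A + (- c) * z))\<^sup>2)
        = ennreal (2 * (cmod A)\<^sup>2) + ennreal (2 * (cmod c)\<^sup>2) * ennreal ((cmod z)\<^sup>2)" .
  qed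
  also have "\<dots> = ennreal (2 * (cmod A)\<^sup>2) + ennreal (2 * (cmod c)\<^sup>2) * (\<integral>\<^sup>+z. ennreal ((cmod z)\<^sup>2) \<partial>gauss)"
    using emeasure_space_1 by (subst nn_integral_add) (simp_all add: nn_integral_cmult)
  also have "\<dots> \<le> ennreal (2 * (cmod A)\<^sup>2) + ennreal (2 * (cmod c)\<^sup>2) * 4"
    by (intro add_left_mono mult_left_mono nn_integral_gauss_second_moment) auto
  also have "\<dots> = ennreal (2 * (cmod A)\<^sup>2) + ennreal (2 * (cmod c)\<^sup>2) * ennreal 4"
    by simp
  also have "\<dots> = ennreal (2 * (cmod A)\<^sup>2 + 2 * (cmod c)\<^sup>2 * 4)"
    unfolding ennreal_mult[OF mult_nonneg_nonneg[OF zero_le_numeral zero_le_power2] zero_le_numeral, symmetric]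
    by (rule ennreal_plus[symmetric]) auto
  also have "\<dots> = ennreal (2 * ((cmod A)\<^sup>2 + 4 * (cmod c)\<^sup>2))"
    by (simp add: algebra_simps)
  also have "\<dots> = ennreal 2 * ennreal ((cmod A)\<^sup>2 + 4 * (cmod c)\<^sup>2)"
    by (rule ennreal_mult) auto
  finally show ?thesis
    by (simp only: ennreal_numeral, subst (asm) ennreal_mult_le_mult_iff) auto
qed

section \<open>Small balls for Gaussian vectors\<close>

abbreviation gauss_PiM :: "'i set \<Rightarrow> ('i \<Rightarrow> complex) measure" where
  "gauss_PiM I \<equiv> PiM I (\<lambda>_. gauss)"

interpretation gauss: prob_space gauss
  by (rule prob_space_gauss)

interpretation gauss_PiM: product_prob_space "\<lambda>_. gauss" I for I
  by unfold_locales

text \<open>Rotation invariance holds coordinate by coordinate, so the one-dimensional identity is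
  applied to one new coordinate at a time.\<close>

lemma nn_integral_gauss_PiM_difference:
  fixes f :: "('i \<Rightarrow> complex) \<Rightarrow> ennreal"
  assumes "finite I" "f \<in> borel_measurable (gauss_PiM I)"
  shows "(\<integral>\<^sup>+y. \<integral>\<^sup>+x. f (\<lambda>i\<in>I. (x i - y i) /\<^sub>R sqrt 2) \<partial>gauss_PiM I \<partial>gauss_PiM I) = (\<integral>\<^sup>+u. f u \<partial>gauss_PiM I)"
  using assms
proof (induction I arbitrary: f rule: finite_induct)
  case empty
  then show ?case by (simp add: PiM_empty nn_integral_count_space_finite)
next
  case (insert j I)
  note [measurable] = insert.prems
  let ?P = "gauss_PiM I" and ?P' = "gauss_PiM (insert j I)"
  let ?D = "\<lambda>x y. \<lambda>i\<in>I. (x i - y i) /\<^sub>R sqrt 2"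
  let ?D' = "\<lambda>x y. \<lambda>i\<in>insert j I. (x i - y i) /\<^sub>R sqrt 2"
  define h where "h z = (\<integral>\<^sup>+u. f (z(j := u)) \<partial>gauss)" for z
  have D': "?D' (x(j := a)) (y(j := b)) = (?D x y)(j := (a - b) /\<^sub>R sqrt 2)" for x y a b
    using insert.hyps by (auto simp: fun_eq_iff)
  have mD [measurable]: "(\<lambda>p. ?D (fst p) (snd p)) \<in> ?P \<Otimes>\<^sub>M ?P \<rightarrow>\<^sub>M ?P"
    by (rule measurable_restrict) measurable
  have mD2: "(\<lambda>x. ?D' x y) \<in> ?P' \<rightarrow>\<^sub>M ?P'" for y
    by (rule measurable_restrict) measurable
  have mD1: "(\<lambda>x. ?D x y) \<in> ?P \<rightarrow>\<^sub>M ?P" for y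
    by (rule measurable_restrict) measurable
  have upd [measurable]: "(\<lambda>(z, u). z(j := u)) \<in> ?P \<Otimes>\<^sub>M gauss \<rightarrow>\<^sub>M ?P'"
    by (rule measurable_add_dim)
  have [measurable]: "h \<in> borel_measurable ?P"
    unfolding h_def by measurable
  have fupd: "(\<lambda>u. f (z(j := u))) \<in> borel_measurable borel" if "z \<in> space ?P" for z
  proof -
    have "(\<lambda>u. (z, u)) \<in> gauss \<rightarrow>\<^sub>M ?P \<Otimes>\<^sub>M gauss" using that by simp
    from measurable_compose[OF measurable_compose[OF this upd] insert.prems]
    show ?thesis by (simp add: fun_upd_def cong: measurable_cong_sets)
  qed
  have mf3: "(\<lambda>((b, x), a). f ((?D x y)(j := (a - b) /\<^sub>R sqrt 2))) \<in> borel_measurable ((gauss \<Otimes>\<^sub>M ?P) \<Otimes>\<^sub>M gauss)" for y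
  proof -
    have "(\<lambda>p. (?D (snd (fst p)) y, (snd p - fst (fst p)) /\<^sub>R sqrt 2)) \<in> (gauss \<Otimes>\<^sub>M ?P) \<Otimes>\<^sub>M gauss \<rightarrow>\<^sub>M ?P \<Otimes>\<^sub>M gauss"
      by (intro measurable_Pair measurable_compose[OF _ mD1]) measurable
    from measurable_compose[OF measurable_compose[OF this upd] insert.prems]
    show ?thesis by (simp add: case_prod_unfold)
  qed
  have spD: "?D x y \<in> space ?P" for x y
    by (simp add: space_PiM)
  interpret P: prob_space ?P by (rule gauss_PiM.prob_space_axioms prob_space_PiM prob_space_gauss)+
  interpret pair_sigma_finite gauss ?P ..
  have "(\<integral>\<^sup>+y. \<integral>\<^sup>+x. f (?D' x y) \<partial>?P' \<partial>?P')
      = (\<integral>\<^sup>+y. \<integral>\<^sup>+b. \<integral>\<^sup>+x. f (?D' x (y(j := b))) \<partial>?P' \<partial>gauss \<partial>?P)"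
    using insert.hyps by (subst gauss_PiM.product_nn_integral_insert) auto
  also have "\<dots> = (\<integral>\<^sup>+y. \<integral>\<^sup>+b. \<integral>\<^sup>+x. \<integral>\<^sup>+a. f ((?D x y)(j := (a - b) /\<^sub>R sqrt 2)) \<partial>gauss \<partial>?P \<partial>gauss \<partial>?P)"
  proof (intro nn_integral_cong)
    fix y b
    have "(\<lambda>x. f (?D' x (y(j := b)))) \<in> borel_measurable ?P'"
      by (rule measurable_compose[OF mD2]) simp
    then show "(\<integral>\<^sup>+x. f (?D' x (y(j := b))) \<partial>?P')
        = (\<integral>\<^sup>+x. \<integral>\<^sup>+a. f ((?D x y)(j := (a - b) /\<^sub>R sqrt 2)) \<partial>gauss \<partial>?P)"
      using insert.hyps by (subst gauss_PiM.product_nn_integral_insert) (simp_all only: D' if_True not_False_eq_True)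
  qed
  \<comment> \<open>Exchanging \<open>b\<close> and \<open>x\<close> brings the two copies
    \<open>a\<close>, \<open>b\<close> of the new coordinate together, so that the inner double
    integral is the one-dimensional case.\<close>
  also have "\<dots> = (\<integral>\<^sup>+y. \<integral>\<^sup>+x. \<integral>\<^sup>+b. \<integral>\<^sup>+a. f ((?D x y)(j := (a - b) /\<^sub>R sqrt 2)) \<partial>gauss \<partial>gauss \<partial>?P \<partial>?P)"
  proof (intro nn_integral_cong Fubini'[symmetric])
    fix y
    show "(\<lambda>(b, x). \<integral>\<^sup>+a. f ((?D x y)(j := (a - b) /\<^sub>R sqrt 2)) \<partial>gauss) \<in> borel_measurable (gauss \<Otimes>\<^sub>M ?P)"
      using gauss.borel_measurable_nn_integral[OF mf3[of y]] by (simp add: case_prod_unfold)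
  qed
  also have "\<dots> = (\<integral>\<^sup>+y. \<integral>\<^sup>+x. h (?D x y) \<partial>?P \<partial>?P)"
    unfolding h_def by (intro nn_integral_cong nn_integral_gauss_difference fupd spD)
  also have "\<dots> = (\<integral>\<^sup>+u. h u \<partial>?P)"
    by (rule insert.IH) simp
  also have "\<dots> = (\<integral>\<^sup>+u. f u \<partial>?P')"
    unfolding h_def using insert.hyps by (subst gauss_PiM.product_nn_integral_insert) auto
  finally show ?case .
qed

section \<open>Counting integer points in a weighted ball\<close>

lemma sum_exp_neg_int_square_le:
  fixes \<beta> :: real
  assumes "1 \<le> \<beta>"
  shows "(\<Sum>y=- int n..int n. exp (- \<beta> * (real_of_int y)\<^sup>2)) \<le> 1 + 4 * exp (- \<beta>)"
proof -
  let ?q = "exp (- \<beta>)"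
  have q: "?q \<le> 1/2"
  proof -
    have "2 \<le> exp (1::real)" using exp_ge_add_one_self[of 1] by simp
    also have "\<dots> \<le> exp \<beta>" using assms by simp
    finally show ?thesis by (simp add: exp_minus field_simps)
  qed
  \<comment> \<open>The subtracted term makes the induction close: the two new summands add at most
    2 q^(n+1), and for q \<le> 1/2 the right side grows by 4 q^(n+1) - 4 q^(n+2), which is at least
    that.\<close>
  have "(\<Sum>y=- int n..int n. exp (- \<beta> * (real_of_int y)\<^sup>2)) \<le> 1 + 4 * ?q - 4 * ?q ^ Suc n"
  proof (induction n)
    case 0
    then show ?case by simp
  next
    case (Suc n)
    have s: "{- int (Suc n)..int (Suc n)} = insert (int (Suc n)) (insert (- int (Suc n)) {- int n..int n})"
      by auto
    have "exp (- \<beta> * (real (Suc n))\<^sup>2) \<le> exp (- \<beta> * real (Suc n))"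
    proof -
      have "real (Suc n) \<le> (real (Suc n))\<^sup>2" by (simp add: power2_eq_square)
      then show ?thesis using assms by (simp add: mult_left_mono)
    qed
    also have "\<dots> = ?q ^ Suc n"
      by (metis exp_of_nat2_mult)
    finally have e: "exp (- \<beta> * (real (Suc n))\<^sup>2) \<le> ?q ^ Suc n" .
    have "?q * ?q ^ Suc n \<le> 1/2 * ?q ^ Suc n"
      using q by (intro mult_right_mono) auto
    moreover have "(\<Sum>y=- int (Suc n)..int (Suc n). exp (- \<beta> * (real_of_int y)\<^sup>2))
       = 2 * exp (- \<beta> * (real (Suc n))\<^sup>2) + (\<Sum>y=- int n..int n. exp (- \<beta> * (real_of_int y)\<^sup>2))"
      unfolding s by (simp add: power2_eq_square algebra_simps)
    ultimately show ?case using Suc.IH e unfolding power_Suc[of _ "Suc n"] by linarith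
  qed
  then show ?thesis by (smt (verit) exp_ge_zero zero_le_power)
qed

text \<open>Exponential counting: every point of \<open>D\<close> has weight exp(R - quadratic form)
  at least 1, and the sum of these weights over a box factors into one-dimensional sums. Coordinates
  with large \<open>\<beta> j\<close> hardly contribute.\<close>

lemma card_weighted_ball_le:
  fixes \<beta> :: "'j \<Rightarrow> real" and R :: real
  assumes J: "finite J" and \<beta>: "\<And>j. j \<in> J \<Longrightarrow> 1 \<le> \<beta> j"
  defines "D \<equiv> {y \<in> J \<rightarrow>\<^sub>E (UNIV :: int set). (\<Sum>j\<in>J. \<beta> j * (real_of_int (y j))\<^sup>2) \<le> R}"
  shows "finite D" and "real (card D) \<le> exp (R + (\<Sum>j\<in>J. 4 * exp (- \<beta> j)))"
proof -
  \<comment> \<open>For an integer, |y j| \<le> (y j)^2 \<le> \<open>\<beta> j\<close> (y j)^2 \<le>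
    R, so the box of this half-width contains \<open>D\<close>.\<close>
  define n where "n = nat \<lfloor>R\<rfloor>"
  let ?B = "J \<rightarrow>\<^sub>E {- int n..int n}"
  have sub: "D \<subseteq> ?B"
  proof
    fix y assume y: "y \<in> D"
    have "y j \<in> {- int n..int n}" if j: "j \<in> J" for j
    proof -
      have nn: "0 \<le> \<beta> i * (real_of_int (y i))\<^sup>2" if "i \<in> J" for i
        using \<beta>[OF that] by simp
      have "\<bar>real_of_int (y j)\<bar> \<le> (real_of_int (y j))\<^sup>2"
      proof (cases "y j = 0")
        case False
        then have "1 \<le> \<bar>y j\<bar>" by linarith
        then have "\<bar>y j\<bar> * 1 \<le> \<bar>y j\<bar> * \<bar>y j\<bar>" by (intro mult_left_mono) auto
        then have "\<bar>y j\<bar> \<le> (y j)\<^sup>2" by (simp add: power2_eq_square)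
        then show ?thesis by (metis of_int_abs of_int_le_iff of_int_power)
      qed simp
      also have "\<dots> \<le> \<beta> j * (real_of_int (y j))\<^sup>2"
        using \<beta>[OF j] by (simp add: mult_right_mono[of 1 "\<beta> j", simplified])
      also have "\<dots> \<le> (\<Sum>j\<in>J. \<beta> j * (real_of_int (y j))\<^sup>2)"
        using J j nn by (intro member_le_sum) auto
      also have "\<dots> \<le> R" using y by (simp add: D_def)
      finally have "real_of_int \<bar>y j\<bar> \<le> R" by simp
      then have "\<bar>y j\<bar> \<le> \<lfloor>R\<rfloor>" by (simp add: le_floor_iff)
      moreover from this have "int n = \<lfloor>R\<rfloor>" unfolding n_def by linarith
      ultimately show ?thesis by auto
    qed
    then show "y \<in> ?B" using y by (auto simp: D_def PiE_iff)
  qed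
  have finB: "finite ?B" using J by (intro finite_PiE) auto
  then show "finite D" using sub finite_subset by blast
  have "real (card D) = (\<Sum>y\<in>D. 1)" by simp
  also have "\<dots> \<le> (\<Sum>y\<in>D. exp (R - (\<Sum>j\<in>J. \<beta> j * (real_of_int (y j))\<^sup>2)))"
    by (intro sum_mono) (auto simp: D_def)
  also have "\<dots> \<le> (\<Sum>y\<in>?B. exp (R - (\<Sum>j\<in>J. \<beta> j * (real_of_int (y j))\<^sup>2)))"
    using sub finB by (intro sum_mono2) auto
  also have "\<dots> = exp R * (\<Sum>y\<in>?B. \<Prod>j\<in>J. exp (- \<beta> j * (real_of_int (y j))\<^sup>2))"
  proof -
    have "(\<Prod>j\<in>J. exp (- \<beta> j * (real_of_int (y j))\<^sup>2)) = exp (- (\<Sum>j\<in>J. \<beta> j * (real_of_int (y j))\<^sup>2))" for y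
      unfolding exp_sum[OF J, symmetric] by (simp add: sum_negf)
    then show ?thesis by (simp add: sum_distrib_left exp_add[symmetric])
  qed
  also have "(\<Sum>y\<in>?B. \<Prod>j\<in>J. exp (- \<beta> j * (real_of_int (y j))\<^sup>2))
      = (\<Prod>j\<in>J. \<Sum>y=- int n..int n. exp (- \<beta> j * (real_of_int y)\<^sup>2))"
    using J by (subst prod_sum_PiE) auto
  also have "\<dots> \<le> (\<Prod>j\<in>J. exp (4 * exp (- \<beta> j)))"
  proof (intro prod_mono conjI)
    fix j assume "j \<in> J"
    from sum_exp_neg_int_square_le[OF \<beta>[OF this], of n] exp_ge_add_one_self[of "4 * exp (- \<beta> j)"]
    show "(\<Sum>y=- int n..int n. exp (- \<beta> j * (real_of_int y)\<^sup>2)) \<le> exp (4 * exp (- \<beta> j))"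
      by linarith
  qed (auto intro: sum_nonneg)
  also have "exp R * \<dots> = exp (R + (\<Sum>j\<in>J. 4 * exp (- \<beta> j)))"
    using J by (simp add: exp_add exp_sum)
  finally show "real (card D) \<le> exp (R + (\<Sum>j\<in>J. 4 * exp (- \<beta> j)))" by simp
qed


text \<open>There is no additive error because small numbers are rounded to 0. Hence a coordinate of
  small variance has a rounded value of small second moment, and many such coordinates stay
  cheap.\<close>

lemma round_abs_le:
  fixes t :: real
  shows "\<bar>real_of_int (round t)\<bar> \<le> 2 * \<bar>t\<bar>"
proof (cases "\<bar>t\<bar> < 1/2")
  case True
  then have "round t = 0" by (intro round_unique) auto
  then show ?thesis by simp
next
  case False
  then show ?thesis using of_int_round_abs_le[of t] by linarith
qed

text \<open>A pigeonhole argument: two independent copies of the vector \<open>(V j)\<close>, rounded to integers,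
  coincide with probability at least \<open>1 / (4 card D)\<close>, where the rounded vector lies in \<open>D\<close> with
  probability \<open>1/2\<close>, and the difference of the copies divided by \<open>\<surd>2\<close> is again Gaussian.\<close>

lemma gauss_small_ball:
  fixes V :: "'j \<Rightarrow> ('i \<Rightarrow> complex) \<Rightarrow> real" and \<beta> v :: "'j \<Rightarrow> real"
  assumes I: "finite I" and J: "finite J"
    and meas: "\<And>j. j \<in> J \<Longrightarrow> V j \<in> borel_measurable (gauss_PiM I)"
    and lin: "\<And>j x y. j \<in> J \<Longrightarrow> V j (\<lambda>i\<in>I. (x i - y i) /\<^sub>R sqrt 2) = (V j x - V j y) / sqrt 2"
    and mom: "\<And>j. j \<in> J \<Longrightarrow> (\<integral>\<^sup>+x. ennreal ((V j x)\<^sup>2) \<partial>gauss_PiM I) \<le> ennreal (v j)"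
    and v: "\<And>j. j \<in> J \<Longrightarrow> 0 \<le> v j" and \<beta>: "\<And>j. j \<in> J \<Longrightarrow> 1 \<le> \<beta> j"
  shows "exp (- 3 - (\<Sum>j\<in>J. 8 * \<beta> j * v j + 4 * exp (- \<beta> j)))
      \<le> measure (gauss_PiM I) {x \<in> space (gauss_PiM I). \<forall>j\<in>J. \<bar>V j x\<bar> \<le> 1}"
proof -
  note [measurable] = meas
  let ?P = "gauss_PiM I"
  define S where "S = (\<Sum>j\<in>J. 4 * \<beta> j * v j)"
  \<comment> \<open>By Markov's inequality the rounded vector leaves \<open>D\<close> with
    probability at most S / R \<le> 1/2; the summand 1 keeps R positive when S = 0.\<close>
  define R where "R = 2 * S + 1"
  have S0: "0 \<le> S" unfolding S_def using v \<beta> by (intro sum_nonneg) (simp add: order_trans[OF zero_le_one])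
  define D where "D = {y \<in> J \<rightarrow>\<^sub>E (UNIV :: int set). (\<Sum>j\<in>J. \<beta> j * (real_of_int (y j))\<^sup>2) \<le> R}"
  have Dfin: "finite D" and Dcard: "real (card D) \<le> exp (R + (\<Sum>j\<in>J. 4 * exp (- \<beta> j)))"
    unfolding D_def using card_weighted_ball_le[of J \<beta> R] J \<beta> by auto
  define Y where "Y x = (\<lambda>j\<in>J. round (V j x))" for x
  define Z where "Z x = (\<Sum>j\<in>J. \<beta> j * (real_of_int (round (V j x)))\<^sup>2)" for x
  have YD: "Y x \<in> D \<longleftrightarrow> Z x \<le> R" for x
    by (simp add: D_def Y_def Z_def)
  define A where "A y = {x \<in> space ?P. \<forall>j\<in>J. round (V j x) = y j}" for y
  have Am [measurable]: "A y \<in> sets ?P" for y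
    unfolding A_def round_def using J by measurable
  have Zm [measurable]: "Z \<in> borel_measurable ?P"
    unfolding Z_def round_def by measurable
  define u where "u x = (\<Sum>j\<in>J. 4 * \<beta> j * (V j x)\<^sup>2)" for x
  have um [measurable]: "u \<in> borel_measurable ?P" unfolding u_def by measurable
  have Zu: "Z x \<le> u x" for x
    unfolding Z_def u_def
  proof (intro sum_mono)
    fix j assume "j \<in> J"
    have "(real_of_int (round (V j x)))\<^sup>2 \<le> (2 * \<bar>V j x\<bar>)\<^sup>2"
      using power_mono[OF round_abs_le[of "V j x"], of 2] by simp
    then have "\<beta> j * (real_of_int (round (V j x)))\<^sup>2 \<le> \<beta> j * (4 * (V j x)\<^sup>2)"
      using \<beta>[OF \<open>j \<in> J\<close>] by (intro mult_left_mono) (auto simp: power_mult_distrib)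
    then show "\<beta> j * (real_of_int (round (V j x)))\<^sup>2 \<le> 4 * \<beta> j * (V j x)\<^sup>2"
      by (simp add: algebra_simps)
  qed
  have \<beta>0: "0 \<le> \<beta> j" if "j \<in> J" for j using \<beta>[OF that] by simp
  have u0: "0 \<le> u x" for x unfolding u_def using \<beta>0 by (intro sum_nonneg) auto
  have "(\<integral>\<^sup>+x. ennreal (u x) \<partial>?P) = (\<Sum>j\<in>J. ennreal (4 * \<beta> j) * (\<integral>\<^sup>+x. ennreal ((V j x)\<^sup>2) \<partial>?P))"
  proof -
    have "ennreal (u x) = (\<Sum>j\<in>J. ennreal (4 * \<beta> j) * ennreal ((V j x)\<^sup>2))" for x
      unfolding u_def using \<beta>0 by (subst sum_ennreal[symmetric]) (auto simp: ennreal_mult'')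
    then show ?thesis by (simp add: nn_integral_sum nn_integral_cmult)
  qed
  also have "\<dots> \<le> (\<Sum>j\<in>J. ennreal (4 * \<beta> j) * ennreal (v j))"
    by (intro sum_mono mult_left_mono mom) auto
  also have "\<dots> = ennreal S"
    unfolding S_def using \<beta>0 v by (subst sum_ennreal[symmetric]) (auto simp: ennreal_mult'')
  finally have intu: "(\<integral>\<^sup>+x. ennreal (u x) \<partial>?P) \<le> ennreal S" .
  have R0: "0 < R" using S0 by (simp add: R_def)
  have "emeasure ?P {x \<in> space ?P. R < Z x}
      \<le> emeasure ?P ({x \<in> space ?P. 1 \<le> ennreal (1 / R) * ennreal (u x)} \<inter> space ?P)"
  proof (intro emeasure_mono subsetI)
    fix x assume "x \<in> {x \<in> space ?P. R < Z x}"
    then have "x \<in> space ?P" "1 \<le> u x / R" using Zu[of x] R0 by (auto simp: le_divide_eq_1)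
    then show "x \<in> {x \<in> space ?P. 1 \<le> ennreal (1 / R) * ennreal (u x)} \<inter> space ?P"
      using R0 u0 by (simp add: ennreal_mult'[symmetric])
  qed measurable
  also have "\<dots> \<le> ennreal (1 / R) * (\<integral>\<^sup>+x. ennreal (u x) * indicator (space ?P) x \<partial>?P)"
    using nn_integral_Markov_inequality[where A = "space ?P" and M = ?P and u = "\<lambda>x. ennreal (u x)" and c = "ennreal (1 / R)"]
    by (simp add: Int_def conj_commute)
  also have "\<dots> = ennreal (1 / R) * (\<integral>\<^sup>+x. ennreal (u x) \<partial>?P)"
    by (intro arg_cong2[where f = "(*)"] nn_integral_cong) auto
  also have "\<dots> \<le> ennreal (1 / R) * ennreal S"
    by (intro mult_left_mono intu) auto
  also have "\<dots> = ennreal (S / R)" using R0 S0 by (simp add: ennreal_mult'[symmetric])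
  also have "\<dots> \<le> ennreal (1/2)"
    using R0 by (intro ennreal_leI) (simp add: R_def field_simps)
  finally have "measure ?P {x \<in> space ?P. R < Z x} \<le> 1/2"
    unfolding gauss_PiM.emeasure_eq_measure by (subst (asm) ennreal_le_iff) auto
  moreover have "measure ?P {x \<in> space ?P. Z x \<le> R} = 1 - measure ?P {x \<in> space ?P. R < Z x}"
  proof -
    have "{x \<in> space ?P. Z x \<le> R} = space ?P - {x \<in> space ?P. R < Z x}" by auto
    then show ?thesis by (simp add: gauss_PiM.prob_compl)
  qed
  ultimately have half: "1/2 \<le> measure ?P {x \<in> space ?P. Z x \<le> R}" by simp
  have "{x \<in> space ?P. Z x \<le> R} = (\<Union>y\<in>D. A y)"
  proof -
    have "x \<in> (\<Union>y\<in>D. A y) \<longleftrightarrow> x \<in> space ?P \<and> Y x \<in> D" for x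
    proof
      assume "x \<in> (\<Union>y\<in>D. A y)"
      then obtain y where y: "y \<in> D" "x \<in> A y" by auto
      then have "Y x = y" by (auto simp: Y_def A_def D_def fun_eq_iff PiE_def extensional_def)
      then show "x \<in> space ?P \<and> Y x \<in> D" using y by (auto simp: A_def)
    next
      assume "x \<in> space ?P \<and> Y x \<in> D"
      then show "x \<in> (\<Union>y\<in>D. A y)" by (auto simp: A_def Y_def intro!: bexI[of _ "Y x"])
    qed
    then show ?thesis by (auto simp: YD)
  qed
  moreover have disj: "disjoint_family_on A D"
  proof -
    have "y = y'" if "x \<in> A y" "x \<in> A y'" "y \<in> D" "y' \<in> D" for x y y'
    proof (rule PiE_ext)
      show "y \<in> J \<rightarrow>\<^sub>E UNIV" "y' \<in> J \<rightarrow>\<^sub>E UNIV" using that by (auto simp: D_def)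
      show "y j = y' j" if "j \<in> J" for j using \<open>x \<in> A y\<close> \<open>x \<in> A y'\<close> that by (auto simp: A_def)
    qed
    then show ?thesis unfolding disjoint_family_on_def by blast
  qed
  ultimately have half': "1/2 \<le> (\<Sum>y\<in>D. measure ?P (A y))"
    using half Dfin gauss_PiM.finite_measure_finite_Union[of D A I] Am by (auto simp: image_subset_iff)
  have Dpos: "0 < real (card D)"
  proof -
    have "D \<noteq> {}" using half' by auto
    then show ?thesis using Dfin by (simp add: card_gt_0_iff)
  qed
  \<comment> \<open>Cauchy-Schwarz over the cells: the sum of the squared cell probabilities is the
    probability that two independent copies fall into the same cell.\<close>
  have "(1/2)\<^sup>2 \<le> (\<Sum>y\<in>D. measure ?P (A y))\<^sup>2"
    using half' by (intro power_mono) auto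
  also have "\<dots> \<le> (\<Sum>y\<in>D. (measure ?P (A y))\<^sup>2) * card D"
    by (rule sum_squared_le_sum_of_squares)
  finally have coll: "1 / (4 * card D) \<le> (\<Sum>y\<in>D. (measure ?P (A y))\<^sup>2)"
    using Dpos by (simp add: field_simps power2_eq_square)
  let ?E = "{x \<in> space ?P. \<forall>j\<in>J. \<bar>V j x\<bar> \<le> 1}"
  have Em [measurable]: "?E \<in> sets ?P" using J by measurable
  have "ennreal (\<Sum>y\<in>D. (measure ?P (A y))\<^sup>2) = (\<Sum>y\<in>D. emeasure ?P (A y) * emeasure ?P (A y))"
    by (subst sum_ennreal[symmetric]) (auto simp: gauss_PiM.emeasure_eq_measure ennreal_mult' power2_eq_square)
  also have "\<dots> = (\<Sum>y\<in>D. \<integral>\<^sup>+x'. \<integral>\<^sup>+x. indicator (A y) x * indicator (A y) x' \<partial>?P \<partial>?P)"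
    by (simp add: nn_integral_multc nn_integral_cmult)
  also have "\<dots> = (\<integral>\<^sup>+x'. \<integral>\<^sup>+x. (\<Sum>y\<in>D. indicator (A y) x * indicator (A y) x') \<partial>?P \<partial>?P)"
    by (subst nn_integral_sum[symmetric]) (auto simp: nn_integral_sum intro!: nn_integral_cong borel_measurable_times gauss_PiM.borel_measurable_nn_integral)
  also have "\<dots> \<le> (\<integral>\<^sup>+x'. \<integral>\<^sup>+x. indicator ?E (\<lambda>i\<in>I. (x i - x' i) /\<^sub>R sqrt 2) \<partial>?P \<partial>?P)"
  proof (intro nn_integral_mono)
    fix x x' :: "'i \<Rightarrow> complex"
    let ?d = "\<lambda>i\<in>I. (x i - x' i) /\<^sub>R sqrt 2"
    show "(\<Sum>y\<in>D. indicator (A y) x * indicator (A y) x') \<le> (indicator ?E ?d :: ennreal)"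
    proof (cases "\<exists>y\<in>D. x \<in> A y \<and> x' \<in> A y")
      case True
      then obtain y where y: "y \<in> D" "x \<in> A y" "x' \<in> A y" by auto
      have "\<bar>V j ?d\<bar> \<le> 1" if j: "j \<in> J" for j
      proof -
        have "round (V j x) = round (V j x')" using y j by (auto simp: A_def)
        then have "\<bar>V j x - V j x'\<bar> \<le> 1"
          using of_int_round_abs_le[of "V j x"] of_int_round_abs_le[of "V j x'"] by linarith
        \<comment> \<open>Equal roundings bound the difference of the copies by 1; dividing by
          sqrt(2) only makes it smaller.\<close>
        moreover have "1 \<le> sqrt 2" by simp
        ultimately have "\<bar>V j x - V j x'\<bar> \<le> sqrt 2" by linarith
        then show ?thesis unfolding lin[OF j] by (simp add: abs_divide)
      qed
      then have "?d \<in> ?E" by (auto simp: space_PiM)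
      moreover have "(\<Sum>y'\<in>D. indicator (A y') x * indicator (A y') x') = (\<Sum>y'\<in>{y}. 1 :: ennreal)"
      proof (rule sum.mono_neutral_cong_right)
        show "\<forall>i\<in>D - {y}. indicator (A i) x * indicator (A i) x' = (0 :: ennreal)"
          using disj y unfolding disjoint_family_on_def by (auto simp: indicator_def)
      qed (use y Dfin in auto)
      ultimately show ?thesis by simp
    next
      case False
      then have "(\<Sum>y\<in>D. indicator (A y) x * indicator (A y) x') = (0 :: ennreal)"
        by (intro sum.neutral) (auto simp: indicator_def)
      then show ?thesis by simp
    qed
  qed
  also have "\<dots> = (\<integral>\<^sup>+x. indicator ?E x \<partial>?P)"
    by (rule nn_integral_gauss_PiM_difference[OF I]) measurable
  also have "\<dots> = ennreal (measure ?P ?E)"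
    by (simp add: gauss_PiM.emeasure_eq_measure)
  finally have "(\<Sum>y\<in>D. (measure ?P (A y))\<^sup>2) \<le> measure ?P ?E" by simp
  then have "1 / (4 * card D) \<le> measure ?P ?E" using coll by linarith
  \<comment> \<open>The exponent collects 4 \<le> exp 2, the 1 in R = 2 S + 1, and 2 S, which is the
    sum of the terms \<open>8 * \<beta> j * v j\<close>.\<close>
  moreover have "exp (- 3 - (\<Sum>j\<in>J. 8 * \<beta> j * v j + 4 * exp (- \<beta> j))) \<le> 1 / (4 * card D)"
  proof -
    have "(4::real) \<le> exp 2"
    proof -
      have "(2::real)\<^sup>2 \<le> (exp 1)\<^sup>2" using exp_ge_add_one_self[of 1] by (intro power_mono) auto
      then show ?thesis by (simp flip: exp_double)
    qed
    then have "4 * real (card D) \<le> exp 2 * exp (R + (\<Sum>j\<in>J. 4 * exp (- \<beta> j)))"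
      using Dcard by (intro mult_mono) auto
    also have "\<dots> = exp (3 + (\<Sum>j\<in>J. 8 * \<beta> j * v j + 4 * exp (- \<beta> j)))"
      unfolding exp_add[symmetric] R_def S_def by (simp add: sum.distrib sum_distrib_left algebra_simps)
    finally have "1 / exp (3 + (\<Sum>j\<in>J. 8 * \<beta> j * v j + 4 * exp (- \<beta> j))) \<le> 1 / (4 * card D)"
      using Dpos by (intro divide_left_mono) auto
    moreover have "exp (- 3 - (\<Sum>j\<in>J. 8 * \<beta> j * v j + 4 * exp (- \<beta> j))) = 1 / exp (3 + (\<Sum>j\<in>J. 8 * \<beta> j * v j + 4 * exp (- \<beta> j)))"
      by (simp add: exp_minus[symmetric] field_simps flip: exp_add exp_diff)
    ultimately show ?thesis by simp
  qed
  ultimately show ?thesis by linarith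
qed

section \<open>Small sup norm of Gaussian polynomials\<close>

text \<open>Adding one variable at a time, the previous partial sum serves as the constant in the
  affine second moment bound.\<close>

lemma nn_integral_gauss_PiM_linear:
  fixes c :: "'i \<Rightarrow> complex"
  assumes "finite I"
  shows "(\<integral>\<^sup>+x. ennreal ((cmod (\<Sum>i\<in>I. c i * x i))\<^sup>2) \<partial>gauss_PiM I) \<le> ennreal (4 * (\<Sum>i\<in>I. (cmod (c i))\<^sup>2))"
  using assms
proof (induction I rule: finite_induct)
  case empty
  then show ?case by (simp add: PiM_empty)
next
  case (insert j I)
  let ?P = "gauss_PiM I"
  have eq: "(\<Sum>i\<in>insert j I. c i * (x(j := z)) i) = (\<Sum>i\<in>I. c i * x i) + c j * z" for x z
  proof -
    have "(\<Sum>i\<in>I. c i * (x(j := z)) i) = (\<Sum>i\<in>I. c i * x i)"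
      using insert.hyps by (intro sum.cong) auto
    then show ?thesis using insert.hyps by simp
  qed
  have "(\<integral>\<^sup>+x. ennreal ((cmod (\<Sum>i\<in>insert j I. c i * x i))\<^sup>2) \<partial>gauss_PiM (insert j I))
      = (\<integral>\<^sup>+x. \<integral>\<^sup>+z. ennreal ((cmod ((\<Sum>i\<in>I. c i * x i) + c j * z))\<^sup>2) \<partial>gauss \<partial>?P)"
    using insert.hyps by (subst gauss_PiM.product_nn_integral_insert) (auto simp only: eq, measurable)
  also have "\<dots> \<le> (\<integral>\<^sup>+x. ennreal ((cmod (\<Sum>i\<in>I. c i * x i))\<^sup>2) + ennreal (4 * (cmod (c j))\<^sup>2) \<partial>?P)"
    using nn_integral_gauss_square_affine by (intro nn_integral_mono) (simp flip: ennreal_plus)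
  also have "\<dots> = (\<integral>\<^sup>+x. ennreal ((cmod (\<Sum>i\<in>I. c i * x i))\<^sup>2) \<partial>?P) + ennreal (4 * (cmod (c j))\<^sup>2)"
    using gauss_PiM.emeasure_space_1[of I] by (subst nn_integral_add) auto
  also have "\<dots> \<le> ennreal (4 * (\<Sum>i\<in>I. (cmod (c i))\<^sup>2)) + ennreal (4 * (cmod (c j))\<^sup>2)"
    by (intro add_right_mono insert.IH)
  also have "\<dots> = ennreal (4 * (\<Sum>i\<in>insert j I. (cmod (c i))\<^sup>2))"
    using insert.hyps by (subst ennreal_plus[symmetric]) (auto intro!: sum_nonneg simp: algebra_simps)
  finally show ?case .
qed

section \<open>Controlling a polynomial by its values at roots of unity\<close>

lemma cmod_cis_diff_le: "cmod (cis s - cis t) \<le> \<bar>s - t\<bar>"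
proof -
  have "(cmod (cis s - cis t))\<^sup>2 = 2 - 2 * cos (s - t)"
    unfolding cmod_power2 cos_diff
    using sin_cos_squared_add[of s] sin_cos_squared_add[of t] by (simp add: power2_eq_square algebra_simps)
  also have "\<dots> = (2 * sin ((s - t) / 2))\<^sup>2"
  proof -
    have "2 * ((s - t) / 2) = s - t" by simp
    then show ?thesis using cos_double_sin[of "(s - t) / 2"] by (simp only: power_mult_distrib) simp
  qed
  also have "\<dots> \<le> (s - t)\<^sup>2"
    using abs_sin_x_le_abs_x[of "(s - t) / 2"] by (intro abs_le_square_iff[THEN iffD1]) auto
  finally have "(cmod (cis s - cis t))\<^sup>2 \<le> \<bar>s - t\<bar>\<^sup>2" by simp
  then show ?thesis by (rule power2_le_imp_le) simp
qed

lemma unit_circle_near_root_of_unity: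
  assumes "cmod z = 1" "0 < M"
  obtains j where "j < M" "cmod (z - cis (2 * pi * real j / real M)) \<le> 2 * pi / real M"
proof -
  define t where "t = Arg2pi z"
  have t: "0 \<le> t" "t < 2 * pi" "z = cis t"
    using Arg2pi[of z] assms(1) by (auto simp: t_def cis_conv_exp is_Arg_def)
  define j where "j = nat \<lfloor>t * real M / (2 * pi)\<rfloor>"
  have b: "real j \<le> t * real M / (2 * pi)" "t * real M / (2 * pi) < real j + 1"
    using t assms(2) unfolding j_def by (auto simp: le_floor_iff)
  show thesis
  proof (rule that[of j])
    have "t * real M / (2 * pi) < real M" using t assms(2) by (simp add: field_simps)
    then show "j < M" using b by linarith
    have "\<bar>t - 2 * pi * real j / real M\<bar> \<le> 2 * pi / real M"
    proof -
      have "2 * pi * real j \<le> t * real M" "t * real M \<le> 2 * pi * real j + 2 * pi"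
        using b by (auto simp: field_simps)
      then have "\<bar>t * real M - 2 * pi * real j\<bar> \<le> 2 * pi" by linarith
      then have "\<bar>t * real M - 2 * pi * real j\<bar> / real M \<le> 2 * pi / real M" by (intro divide_right_mono) auto
      moreover have "t - 2 * pi * real j / real M = (t * real M - 2 * pi * real j) / real M"
        using assms(2) by (simp add: diff_divide_distrib)
      ultimately show ?thesis by (simp add: abs_divide)
    qed
    then show "cmod (z - cis (2 * pi * real j / real M)) \<le> 2 * pi / real M"
      unfolding t(3) using cmod_cis_diff_le[of t] order_trans by blast
  qed
qed

lemma one_plus_inverse_power_le: "(1 + 1 / real m) ^ m \<le> 3" if "0 < m"
proof -
  have "(1 + 1 / real m) ^ m \<le> exp (1 / real m) ^ m"
    by (intro power_mono) (auto intro: exp_ge_add_one_self)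
  also have "\<dots> = exp 1" using that by (simp flip: exp_of_nat_mult)
  also have "\<dots> \<le> 3" by (rule exp_le)
  finally show ?thesis .
qed

text \<open>A polynomial of degree less than \<open>m\<close> grows at most by a factor \<open>3\<close> between \<open>|z| = 1\<close> and
  \<open>|z| = 1 + 1/m\<close> (maximum principle for the reversed polynomial), so Cauchy's estimate bounds its
  derivative on the unit disc, and \<open>48 m\<close> sample points suffice.\<close>

lemma polynomial_bound_from_samples:
  fixes c :: "nat \<Rightarrow> complex"
  assumes m: "0 < m"
    and B: "\<And>j. j < 48 * m \<Longrightarrow> cmod (\<Sum>l<m. c l * cis (2 * pi * real j / real (48 * m)) ^ l) \<le> B"
    and z: "cmod z \<le> 1"
  shows "cmod (\<Sum>l<m. c l * z ^ l) \<le> 2 * B"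
proof -
  define Q where "Q z = (\<Sum>l<m. c l * z ^ l)" for z
  \<comment> \<open>The reversed polynomial turns growth outside the unit disc into a bound inside
    it, through Q(z) = z^(m-1) R(1/z).\<close>
  define R where "R w = (\<Sum>l<m. c l * w ^ (m - 1 - l))" for w
  have holQ: "Q holomorphic_on A" for A unfolding Q_def by (intro holomorphic_intros)
  have holR: "R holomorphic_on A" for A unfolding R_def by (intro holomorphic_intros)
  have contQ: "continuous_on A Q" and contR: "continuous_on A R" for A
    using holQ holR by (auto intro: holomorphic_on_imp_continuous_on)
  obtain z0 where z0: "z0 \<in> cball 0 1" "\<And>z. z \<in> cball 0 1 \<Longrightarrow> cmod (Q z) \<le> cmod (Q z0)"
    using continuous_attains_sup[of "cball (0::complex) 1", OF _ _ continuous_on_norm[OF contQ]] by auto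
  define S where "S = cmod (Q z0)"
  have S: "cmod (Q z) \<le> S" if "cmod z \<le> 1" for z using z0(2)[of z] that by (simp add: S_def)
  have QR: "Q z = z ^ (m - 1) * R (1 / z)" if "z \<noteq> 0" for z
  proof -
    have "z ^ l = z ^ (m - 1) * (1 / z) ^ (m - 1 - l)" if "l < m" for l
    proof -
      have "z ^ (m - 1) = z ^ l * z ^ (m - 1 - l)" using that by (simp flip: power_add)
      then show ?thesis using \<open>z \<noteq> 0\<close> by (simp add: power_divide)
    qed
    then have "c l * z ^ l = z ^ (m - 1) * (c l * (1 / z) ^ (m - 1 - l))" if "l < m" for l
      using that by (metis mult.left_commute)
    then show ?thesis unfolding Q_def R_def sum_distrib_left by (intro sum.cong) (auto simp only: lessThan_iff)
  qed
  have R: "cmod (R w) \<le> S" if "cmod w \<le> 1" for w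
  proof (rule maximum_modulus_frontier[of R "cball 0 1"])
    fix w :: complex assume "w \<in> frontier (cball 0 1)"
    then have w: "cmod w = 1" by (simp add: frontier_cball)
    then have "w \<noteq> 0" by auto
    then have "cmod (Q (1 / w)) = cmod (R w)"
      using QR[of "1 / w"] w by (simp add: norm_mult norm_power norm_divide)
    moreover have "cmod (Q (1 / w)) \<le> S" using w by (intro S) (simp add: norm_divide)
    ultimately show "cmod (R w) \<le> S" by simp
  qed (use that holR contR in auto)
  have S0: "0 \<le> S" by (simp add: S_def)
  have big: "cmod (Q z) \<le> 3 * S" if "cmod z \<le> 1 + 1 / real m" for z
  proof (cases "cmod z \<le> 1")
    case True
    then show ?thesis using S[of z] S0 by linarith
  next
    case False
    then have "z \<noteq> 0" by auto
    have "cmod (Q z) = cmod z ^ (m - 1) * cmod (R (1 / z))"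
      using QR[OF \<open>z \<noteq> 0\<close>] by (simp add: norm_mult norm_power)
    also have "\<dots> \<le> (1 + 1 / real m) ^ m * S"
    proof (intro mult_mono R)
      have "cmod z ^ (m - 1) \<le> (1 + 1 / real m) ^ (m - 1)" using that by (intro power_mono) auto
      also have "\<dots> \<le> (1 + 1 / real m) ^ m" by (intro power_increasing) auto
      finally show "cmod z ^ (m - 1) \<le> (1 + 1 / real m) ^ m" .
      show "cmod (1 / z) \<le> 1" using False by (simp add: norm_divide divide_le_eq_1)
    qed auto
    also have "\<dots> \<le> 3 * S" using one_plus_inverse_power_le[OF m] S0 by (intro mult_right_mono) auto
    finally show ?thesis .
  qed
  have der: "cmod (deriv Q z) \<le> 3 * S * real m" if "cmod z \<le> 1" for z
  proof -
    have "cmod ((deriv ^^ 1) Q z) \<le> fact 1 * (3 * S) / (1 / real m) ^ 1"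
    proof (rule Cauchy_inequality[OF holQ contQ])
      show "cmod (Q x) \<le> 3 * S" if "cmod (z - x) = 1 / real m" for x
        using norm_triangle_ineq4[of z "z - x"] \<open>cmod z \<le> 1\<close> that by (intro big) auto
    qed (use m in auto)
    then show ?thesis by simp
  qed
  have lip: "cmod (Q x - Q y) \<le> 3 * S * real m * cmod (x - y)" if "cmod x \<le> 1" "cmod y \<le> 1" for x y
  proof (rule field_differentiable_bound[of "cball 0 1" Q "deriv Q"])
    show "(Q has_field_derivative deriv Q z) (at z within cball 0 1)" for z
      using holomorphic_derivI[OF holQ, of UNIV] by (auto intro: has_field_derivative_at_within)
  qed (use der that in auto)
  \<comment> \<open>The number 48 is 2 * 3 * 8: the derivative is at most 3 S m, the nearest sample
    is within 2 pi / (48 m) \<le> 8 / (48 m), and the product S/2 can be absorbed into the maximum S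
    itself.\<close>
  have edge: "cmod (Q z) \<le> B + S / 2" if z1: "cmod z = 1" for z
  proof -
    obtain j where j: "j < 48 * m" "cmod (z - cis (2 * pi * real j / real (48 * m))) \<le> 2 * pi / real (48 * m)"
      using unit_circle_near_root_of_unity[OF z1, of "48 * m"] m by auto
    let ?w = "cis (2 * pi * real j / real (48 * m))"
    have "cmod (Q z - Q ?w) \<le> 3 * S * real m * cmod (z - ?w)"
      using z1 by (intro lip) auto
    also have "\<dots> \<le> 3 * S * real m * (8 / real (48 * m))"
    proof (intro mult_left_mono)
      have "2 * pi / real (48 * m) \<le> 8 / real (48 * m)"
        using pi_less_4 by (intro divide_right_mono) auto
      then show "cmod (z - ?w) \<le> 8 / real (48 * m)" using j by linarith
    qed (use S0 in auto)
    also have "\<dots> = S / 2" using m by simp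
    finally have "cmod (Q z - Q ?w) \<le> S / 2" .
    moreover have "cmod (Q ?w) \<le> B" using B[OF j(1)] by (simp add: Q_def)
    moreover have "cmod (Q z) \<le> cmod (Q z - Q ?w) + cmod (Q ?w)"
      using norm_triangle_ineq[of "Q z - Q ?w" "Q ?w"] by simp
    ultimately show ?thesis by linarith
  qed
  have "cmod (Q z0) \<le> B + S / 2"
  proof (rule maximum_modulus_frontier[of Q "cball 0 1", OF holQ contQ _ _ z0(1)])
    show "cmod (Q z) \<le> B + S / 2" if "z \<in> frontier (cball 0 1)" for z
      using that by (intro edge) (simp add: frontier_cball)
  qed simp
  then have "S \<le> 2 * B" by (simp add: S_def)
  then show ?thesis using S[OF z] by (simp add: Q_def)
qed

lemma sum_blocks_shift:
  fixes f :: "nat \<Rightarrow> 'a :: comm_monoid_add"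
  shows "(\<Sum>n=1..K * m. f n) = (\<Sum>k<K. \<Sum>l<m. f (1 + k * m + l))"
proof -
  have "(\<Sum>n=1..K * m. f n) = (\<Sum>n<K * m. f (Suc n))"
    by (simp add: sum.atLeast1_atMost_eq)
  also have "\<dots> = (\<Sum>k<K. \<Sum>l=k * m..<k * m + m. f (Suc l))"
    by (rule sum.nat_group[symmetric])
  also have "\<dots> = (\<Sum>k<K. \<Sum>l<m. f (1 + k * m + l))"
  proof (rule sum.cong[OF refl])
    fix k
    have "(\<Sum>l=k * m..<k * m + m. f (Suc l)) = (\<Sum>l=0 + k * m..<m + k * m. f (Suc l))" by (simp add: add.commute)
    also have "\<dots> = (\<Sum>l<m. f (1 + k * m + l))"
      unfolding sum.shift_bounds_nat_ivl by (simp add: lessThan_atLeast0 add.commute add.left_commute)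
    finally show "(\<Sum>l=k * m..<k * m + m. f (Suc l)) = (\<Sum>l<m. f (1 + k * m + l))" .
  qed
  finally show ?thesis .
qed

lemma sum_half_powers_le: "(\<Sum>k<K. (1/2 :: real) ^ k) \<le> 2"
  using sum_le_suminf[of "\<lambda>k. (1/2 :: real) ^ k" "{..<K}"] suminf_geometric[of "1/2 :: real"]
  by (simp add: summable_geometric)

text \<open>The coefficients \<open>1, \<dots>, K m\<close> are cut into \<open>K\<close> blocks of length \<open>m\<close>. The \<open>k\<close>-th block is only
  asked to be bounded by a multiple of \<open>2 ^ k \<surd>m\<close>, which \<open>\<rho> ^ (k m) \<le> 4 ^ (- k)\<close> compensates; hence
  the costs of the blocks are summable and the total cost does not depend on \<open>K\<close>.\<close>

lemma gauss_polynomial_small_ball: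
  fixes a :: "nat \<Rightarrow> real" and C \<rho> :: real
  assumes m: "0 < m" and C: "0 < C" and a: "\<And>n. \<bar>a n\<bar> \<le> C"
    and \<rho>: "0 \<le> \<rho>" "\<rho> \<le> 1" "\<rho> ^ m \<le> 1 / 4"
  obtains E where "E \<in> sets (gauss_PiM {1..K * m})"
    and "exp (- 3 - 6912 * real m) \<le> measure (gauss_PiM {1..K * m}) E"
    and "\<And>x z. x \<in> E \<Longrightarrow> cmod z \<le> \<rho> \<Longrightarrow> cmod (\<Sum>n=1..K * m. x n * complex_of_real (a n) * z ^ n) \<le> 6 * C * sqrt (real m)"
proof -
  let ?I = "{1..K * m}"
  let ?P = "gauss_PiM ?I"
  \<comment> \<open>Three labels for each real functional: the block, the sample point, and whether
    the real or the imaginary part is taken.\<close>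
  define J where "J = {..<K} \<times> {..<48 * m} \<times> (UNIV :: bool set)"
  define w where "w j = cis (2 * pi * real j / real (48 * m))" for j
  define L where "L k j x = (\<Sum>l<m. complex_of_real (a (1 + k * m + l)) * w j ^ l * x (1 + k * m + l))"
    for k j and x :: "nat \<Rightarrow> complex"
  \<comment> \<open>A block has m terms with coefficients at most C, so its standard deviation is of
    order C sqrt(m). Allowing an extra 2^k gives the normalised functionals variance
    O(4^(-k)).\<close>
  define \<sigma> where "\<sigma> k = C * 2 ^ k * sqrt (real m)" for k :: nat
  define part where "part b z = (if b then Re z else Im z)" for b z
  define V where "V t x = (case t of (k, j, b) \<Rightarrow> part b (L k j x) / \<sigma> k)" for t :: "nat \<times> nat \<times> bool" and x
  define v :: "nat \<times> nat \<times> bool \<Rightarrow> real" where "v t = (case t of (k, j, b) \<Rightarrow> 4 * (1 / 4) ^ k)" for t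
  \<comment> \<open>The weight must grow for exp(- \<beta>) to be summable over the blocks, but more
    slowly than 4^k for \<beta> v to be summable as well.\<close>
  define \<beta> :: "nat \<times> nat \<times> bool \<Rightarrow> real" where "\<beta> t = (case t of (k, j, b) \<Rightarrow> real k + 1)" for t
  define E where "E = {x \<in> space ?P. \<forall>t\<in>J. \<bar>V t x\<bar> \<le> 1}"
  have \<sigma>: "0 < \<sigma> k" for k using C m by (simp add: \<sigma>_def)
  have finJ: "finite J" by (simp add: J_def)
  have idx: "1 + k * m + l \<in> ?I" if "k < K" "l < m" for k l
  proof -
    have "1 + k * m + l \<le> Suc k * m" using that by simp
    also have "\<dots> \<le> K * m" using that by (intro mult_right_mono) auto
    finally show ?thesis by simp
  qed
  have part_m [measurable]: "(\<lambda>z. part b z) \<in> borel_measurable borel" for b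
    by (cases b) (simp_all add: part_def)
  have Lm: "L k j \<in> borel_measurable ?P" if "k < K" for k j
  proof -
    have [measurable]: "(\<lambda>x. x (1 + k * m + l)) \<in> borel_measurable ?P" if "l < m" for l
      using measurable_component_singleton[OF idx[OF \<open>k < K\<close> that], of "\<lambda>_. gauss"]
      by (simp cong: measurable_cong_sets)
    show ?thesis unfolding L_def by measurable
  qed
  have Vm: "V t \<in> borel_measurable ?P" if tJ: "t \<in> J" for t
  proof -
    obtain k j b where t: "t = (k, j, b)" "k < K" using tJ by (auto simp: J_def)
    show ?thesis unfolding t V_def prod.case
      by (intro borel_measurable_divide measurable_compose[OF Lm[OF t(2)] part_m]) simp
  qed
  have Vlin: "V t (\<lambda>i\<in>?I. (x i - y i) /\<^sub>R sqrt 2) = (V t x - V t y) / sqrt 2" if tJ: "t \<in> J" for t x y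
  proof -
    obtain k j b where t: "t = (k, j, b)" "k < K" using tJ by (auto simp: J_def)
    have eq: "L k j (\<lambda>i\<in>?I. (x i - y i) /\<^sub>R sqrt 2) = (L k j x - L k j y) /\<^sub>R sqrt 2"
      unfolding L_def sum_subtractf[symmetric] scaleR_sum_right
      using idx[OF t(2)] by (intro sum.cong) (auto simp: algebra_simps)
    show ?thesis unfolding t V_def prod.case eq
      by (cases b) (simp_all add: part_def divide_inverse algebra_simps)
  qed
  have Vmom: "(\<integral>\<^sup>+x. ennreal ((V t x)\<^sup>2) \<partial>?P) \<le> ennreal (v t)" if tJ: "t \<in> J" for t
  proof -
    obtain k j b where t: "t = (k, j, b)" "k < K" using tJ by (auto simp: J_def)
    note [measurable] = Lm[OF t(2), of j]
    define c where "c n = (if n \<in> (\<lambda>l. 1 + k * m + l) ` {..<m} then complex_of_real (a n) * w j ^ (n - (1 + k * m)) else 0)" for n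
    have inj: "inj_on (\<lambda>l. 1 + k * m + l) {..<m}" by (auto simp: inj_on_def)
    have sub: "(\<lambda>l. 1 + k * m + l) ` {..<m} \<subseteq> ?I" using idx[OF t(2)] by auto
    have Lc: "L k j x = (\<Sum>n\<in>?I. c n * x n)" for x
    proof -
      have "(\<Sum>n\<in>?I. c n * x n) = (\<Sum>n\<in>(\<lambda>l. 1 + k * m + l) ` {..<m}. c n * x n)"
        using sub by (intro sum.mono_neutral_right) (auto simp: c_def)
      also have "\<dots> = L k j x"
        unfolding L_def by (subst sum.reindex[OF inj]) (auto simp: c_def intro!: sum.cong)
      finally show ?thesis by simp
    qed
    have w1: "cmod (w j) = 1" by (simp add: w_def)
    have "(\<Sum>n\<in>?I. (cmod (c n))\<^sup>2) = (\<Sum>n\<in>(\<lambda>l. 1 + k * m + l) ` {..<m}. (cmod (c n))\<^sup>2)"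
      using sub by (intro sum.mono_neutral_right) (auto simp: c_def)
    also have "\<dots> = (\<Sum>l<m. (a (1 + k * m + l))\<^sup>2)"
      by (subst sum.reindex[OF inj]) (auto simp: c_def norm_mult norm_power w1 intro!: sum.cong)
    also have "\<dots> \<le> (\<Sum>l<m. C\<^sup>2)"
      using a C by (intro sum_mono abs_le_square_iff[THEN iffD1]) auto
    finally have sc: "(\<Sum>n\<in>?I. (cmod (c n))\<^sup>2) \<le> real m * C\<^sup>2" by simp
    have "(\<integral>\<^sup>+x. ennreal ((V t x)\<^sup>2) \<partial>?P) \<le> (\<integral>\<^sup>+x. ennreal (1 / (\<sigma> k)\<^sup>2) * ennreal ((cmod (L k j x))\<^sup>2) \<partial>?P)"
    proof (intro nn_integral_mono)
      fix x
      have "\<bar>part b (L k j x)\<bar> \<le> cmod (L k j x)"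
        by (simp add: part_def abs_Re_le_cmod abs_Im_le_cmod)
      then have "(part b (L k j x))\<^sup>2 \<le> (cmod (L k j x))\<^sup>2"
        by (intro abs_le_square_iff[THEN iffD1]) simp
      then have "(V t x)\<^sup>2 \<le> 1 / (\<sigma> k)\<^sup>2 * (cmod (L k j x))\<^sup>2"
        using \<sigma>[of k] unfolding t V_def by (simp add: power_divide divide_right_mono)
      then show "ennreal ((V t x)\<^sup>2) \<le> ennreal (1 / (\<sigma> k)\<^sup>2) * ennreal ((cmod (L k j x))\<^sup>2)"
        by (simp flip: ennreal_mult')
    qed
    also have "\<dots> = ennreal (1 / (\<sigma> k)\<^sup>2) * (\<integral>\<^sup>+x. ennreal ((cmod (L k j x))\<^sup>2) \<partial>?P)"
      by (rule nn_integral_cmult) measurable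
    also have "\<dots> \<le> ennreal (1 / (\<sigma> k)\<^sup>2) * ennreal (4 * (real m * C\<^sup>2))"
      unfolding Lc using sc
      by (intro mult_left_mono order_trans[OF nn_integral_gauss_PiM_linear]) (auto intro!: ennreal_leI)
    also have "\<dots> = ennreal (v t)"
    proof -
      have "((2 :: real) ^ k)\<^sup>2 = 4 ^ k"
        by (simp add: power2_eq_square flip: power_mult_distrib)
      then have "(\<sigma> k)\<^sup>2 = C\<^sup>2 * 4 ^ k * real m"
        by (simp add: \<sigma>_def power_mult_distrib)
      then have "1 / (\<sigma> k)\<^sup>2 * (4 * (real m * C\<^sup>2)) = v t"
        using C m by (simp add: v_def t power_one_over field_simps)
      then show ?thesis by (simp flip: ennreal_mult')
    qed
    finally show ?thesis .
  qed
  \<comment> \<open>The constant is 36 * 96 * 2: each functional costs at most (32 + 4) 2^(-k), a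
    block has 48 m sample points with two parts each, and the geometric series is at most 2.\<close>
  have cost: "(\<Sum>t\<in>J. 8 * \<beta> t * v t + 4 * exp (- \<beta> t)) \<le> 6912 * real m"
  proof -
    have "8 * \<beta> t * v t + 4 * exp (- \<beta> t) \<le> 36 * (1/2 :: real) ^ fst t" for t
    proof -
      obtain k j b where t: "t = (k, j, b)" by (cases t)
      have k2: "real k + 1 \<le> 2 ^ k" using of_nat_less_two_power[of k, where 'a = real] 
        by (metis Suc_leI less_exp of_nat_Suc of_nat_le_iff of_nat_numeral of_nat_power add.commute)
      have "(real k + 1) * (1/4) ^ k \<le> 2 ^ k * (1/4) ^ k" using k2 by (intro mult_right_mono) auto
      also have "\<dots> = (1/2) ^ k" by (simp flip: power_mult_distrib)
      finally have 1: "(real k + 1) * (1/4) ^ k \<le> (1/2) ^ k" .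
      have "exp (- (real k + 1)) = exp (- 1) ^ (k + 1)"
        by (metis exp_of_nat_mult mult_minus1_right of_nat_Suc Suc_eq_plus1 add.commute)
      also have "\<dots> \<le> (1/2) ^ (k + 1)"
        using exp_ge_add_one_self[of 1] by (intro power_mono) (auto simp: exp_minus field_simps)
      also have "\<dots> \<le> (1/2) ^ k" by simp
      finally have 2: "exp (- (real k + 1)) \<le> (1/2) ^ k" .
      have "8 * (real k + 1) * (4 * (1/4) ^ k) = 32 * ((real k + 1) * (1/4) ^ k)" by (simp add: algebra_simps)
      also have "\<dots> \<le> 32 * (1/2) ^ k" using 1 by (intro mult_left_mono) auto
      finally show ?thesis unfolding t \<beta>_def v_def prod.case fst_conv using 2 by linarith
    qed
    then have "(\<Sum>t\<in>J. 8 * \<beta> t * v t + 4 * exp (- \<beta> t)) \<le> (\<Sum>t\<in>J. 36 * (1/2 :: real) ^ fst t)"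
      by (rule sum_mono)
    also have "\<dots> = 36 * (96 * real m) * (\<Sum>k<K. (1/2) ^ k)"
      unfolding J_def by (subst sum.cartesian_product[symmetric, where g = "\<lambda>k _. 36 * (1/2) ^ k", unfolded case_prod_unfold])
        (simp add: sum_distrib_left sum_distrib_right card_UNIV_bool algebra_simps)
    also have "\<dots> \<le> 36 * (96 * real m) * 2" by (intro mult_left_mono sum_half_powers_le) auto
    finally show ?thesis by simp
  qed
  have "exp (- 3 - 6912 * real m) \<le> exp (- 3 - (\<Sum>t\<in>J. 8 * \<beta> t * v t + 4 * exp (- \<beta> t)))"
    using cost by simp
  also have "\<dots> \<le> measure ?P E"
    unfolding E_def
    by (rule gauss_small_ball) (use finJ Vm Vlin Vmom in \<open>auto simp: v_def \<beta>_def split: prod.split\<close>)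
  finally have PE: "exp (- 3 - 6912 * real m) \<le> measure ?P E" .
  have Em: "E \<in> sets ?P" unfolding E_def using finJ Vm by measurable
  have bound: "cmod (\<Sum>n=1..K * m. x n * complex_of_real (a n) * z ^ n) \<le> 6 * C * sqrt (real m)"
    if x: "x \<in> E" and z: "cmod z \<le> \<rho>" for x z
  proof -
    define Q where "Q k z = (\<Sum>l<m. (x (1 + k * m + l) * complex_of_real (a (1 + k * m + l))) * z ^ l)" for k z
    \<comment> \<open>Both parts are at most \<sigma>, so the modulus at a sample is at most sqrt(2)
      \<sigma> \<le> 3/2 \<sigma>; the passage from samples to the whole disc doubles this.\<close>
    have Qb: "cmod (Q k z) \<le> 2 * (3 / 2 * \<sigma> k)" if k: "k < K" for k
      unfolding Q_def
    proof (rule polynomial_bound_from_samples[OF m])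
      fix j assume j: "j < 48 * m"
      have "\<bar>V (k, j, b) x\<bar> \<le> 1" for b using x j k by (auto simp: E_def J_def)
      then have "\<bar>part b (L k j x)\<bar> \<le> \<sigma> k" for b
        using \<sigma>[of k] by (force simp: V_def abs_divide)
      from this[of True] this[of False] have "\<bar>Re (L k j x)\<bar> \<le> \<sigma> k" "\<bar>Im (L k j x)\<bar> \<le> \<sigma> k"
        by (auto simp: part_def)
      then have "(Re (L k j x))\<^sup>2 \<le> (\<sigma> k)\<^sup>2" "(Im (L k j x))\<^sup>2 \<le> (\<sigma> k)\<^sup>2"
        using \<sigma>[of k] by (auto intro!: abs_le_square_iff[THEN iffD1])
      then have "(cmod (L k j x))\<^sup>2 \<le> 2 * (\<sigma> k)\<^sup>2" by (simp add: cmod_power2)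
      also have "\<dots> \<le> (3 / 2 * \<sigma> k)\<^sup>2"
        unfolding power_mult_distrib by (intro mult_right_mono) (auto simp: power2_eq_square)
      finally have "cmod (L k j x) \<le> 3 / 2 * \<sigma> k"
        by (rule power2_le_imp_le) (use \<sigma>[of k] in simp)
      moreover have "(\<Sum>l<m. (x (1 + k * m + l) * complex_of_real (a (1 + k * m + l))) * cis (2 * pi * real j / real (48 * m)) ^ l) = L k j x"
        unfolding L_def w_def by (intro sum.cong) (auto simp: ac_simps)
      ultimately show "cmod (\<Sum>l<m. (x (1 + k * m + l) * complex_of_real (a (1 + k * m + l))) * cis (2 * pi * real j / real (48 * m)) ^ l) \<le> 3 / 2 * \<sigma> k"
        by simp
    qed (use z \<rho> in auto)
    have "(\<Sum>n=1..K * m. x n * complex_of_real (a n) * z ^ n) = (\<Sum>k<K. z ^ (1 + k * m) * Q k z)"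
      unfolding sum_blocks_shift Q_def sum_distrib_left
      by (intro sum.cong refl) (simp add: power_add ac_simps)
    also have "cmod \<dots> \<le> (\<Sum>k<K. (1/2) ^ k * (3 * C * sqrt (real m)))"
    proof (intro sum_norm_le)
      fix k assume "k \<in> {..<K}"
      then have k: "k < K" by simp
      have "cmod (z ^ (1 + k * m)) = cmod z * (cmod z ^ m) ^ k"
        by (simp add: norm_power norm_mult power_mult[symmetric] mult.commute)
      also have "\<dots> \<le> 1 * (\<rho> ^ m) ^ k"
        using z \<rho> by (intro mult_mono power_mono) auto
      also have "\<dots> \<le> (1/4) ^ k" using \<rho> by (auto intro!: power_mono)
      finally have "cmod (z ^ (1 + k * m)) \<le> (1/4) ^ k" .
      then have "cmod (z ^ (1 + k * m) * Q k z) \<le> (1/4) ^ k * (2 * (3 / 2 * \<sigma> k))"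
        unfolding norm_mult[of "z ^ (1 + k * m)"] using Qb[OF k] by (intro mult_mono) auto
      also have "\<dots> = ((1/4) ^ k * 2 ^ k) * (3 * C * sqrt (real m))" by (simp add: \<sigma>_def)
      also have "(1/4 :: real) ^ k * 2 ^ k = (1/2) ^ k" by (simp flip: power_mult_distrib)
      finally show "cmod (z ^ (1 + k * m) * Q k z) \<le> (1/2) ^ k * (3 * C * sqrt (real m))" .
    qed
    also have "\<dots> \<le> 2 * (3 * C * sqrt (real m))"
      unfolding sum_distrib_right[symmetric] using sum_half_powers_le[of K] C by (intro mult_right_mono) auto
    finally show ?thesis by simp
  qed
  from that[OF Em PE bound] show thesis by blast
qed

section \<open>Square roots of power series\<close>

definition unity_root :: "nat \<Rightarrow> complex" where
  "unity_root M = cis (2 * pi / real M)"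

lemma norm_unity_root [simp]: "cmod (unity_root M) = 1"
  by (simp add: unity_root_def)

lemma unity_root_power: "unity_root M ^ k = exp (2 * of_real pi * \<i> * of_nat k / of_nat M)"
  unfolding unity_root_def cis_conv_exp by (subst exp_of_nat_mult[symmetric]) (simp add: mult_ac)

lemma unity_root_power_self: "0 < M \<Longrightarrow> unity_root M ^ M = 1"
  by (simp add: unity_root_power)

lemma unity_root_orthogonal:
  assumes "k < M" "l < M"
  shows "(\<Sum>j<M. (unity_root M ^ j) ^ k * cnj ((unity_root M ^ j) ^ l)) = (if k = l then of_nat M else 0)"
proof -
  let ?u = "unity_root M"
  define q where "q = ?u ^ k * cnj (?u ^ l)"
  have uu: "?u ^ l * cnj (?u ^ l) = 1" for l
    unfolding complex_norm_square[symmetric] by (simp add: norm_power)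
  have pow: "(?u ^ j) ^ k * cnj ((?u ^ j) ^ l) = q ^ j" for j
    unfolding q_def by (simp add: power_mult_distrib mult.commute flip: power_mult)
  show ?thesis
  proof (cases "k = l")
    case True
    then have "q = 1" using uu by (simp add: q_def)
    then show ?thesis using True unfolding pow by simp
  next
    case False
    have "q \<noteq> 1"
    proof
      assume "q = 1"
      then have "?u ^ l * q = ?u ^ l" by simp
      then have "?u ^ k * (?u ^ l * cnj (?u ^ l)) = ?u ^ l" by (simp add: q_def mult_ac)
      then have "?u ^ k = ?u ^ l" by (simp only: uu mult_1_right)
      then have "k mod M = l mod M"
        using complex_root_unity_eq[of M k l] assms by (simp add: unity_root_power)
      then show False using assms False by simp
    qed
    moreover have "q ^ M = 1"
    proof -
      have "q ^ M = (?u ^ M) ^ k * cnj ((?u ^ M) ^ l)"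
        unfolding q_def by (simp add: power_mult_distrib mult.commute flip: power_mult)
      then show ?thesis using assms unity_root_power_self[of M] by simp
    qed
    ultimately show ?thesis using False unfolding pow by (simp add: geometric_sum)
  qed
qed

lemma parseval_discrete:
  "(\<Sum>j<M. (cmod (\<Sum>k<M. c k * (unity_root M ^ j) ^ k))\<^sup>2) = real M * (\<Sum>k<M. (cmod (c k))\<^sup>2)"
proof -
  let ?w = "\<lambda>j. unity_root M ^ j"
  have "complex_of_real (\<Sum>j<M. (cmod (\<Sum>k<M. c k * ?w j ^ k))\<^sup>2)
      = (\<Sum>j<M. \<Sum>k<M. \<Sum>l<M. c k * cnj (c l) * (?w j ^ k * cnj (?w j ^ l)))"
    unfolding of_real_sum complex_norm_square cnj_sum sum_product
    by (intro sum.cong refl) (simp add: mult_ac)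
  also have "\<dots> = (\<Sum>k<M. \<Sum>l<M. \<Sum>j<M. c k * cnj (c l) * (?w j ^ k * cnj (?w j ^ l)))"
    by (subst sum.swap) (intro sum.cong refl sum.swap)
  also have "\<dots> = (\<Sum>k<M. \<Sum>l<M. c k * cnj (c l) * (if k = l then of_nat M else 0))"
    unfolding sum_distrib_left[symmetric] by (intro sum.cong refl arg_cong2[where f = "(*)"] unity_root_orthogonal) auto
  also have "\<dots> = (\<Sum>k<M. of_nat M * (c k * cnj (c k)))"
    by (intro sum.cong refl) (simp add: sum.delta' if_distrib[of "\<lambda>x. _ * x"] mult_ac cong: if_cong)
  also have "\<dots> = complex_of_real (real M * (\<Sum>k<M. (cmod (c k))\<^sup>2))"
    by (simp add: sum_distrib_left complex_norm_square[symmetric])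
  finally show ?thesis by (simp only: of_real_eq_iff)
qed

lemma summable_square:
  fixes u :: "nat \<Rightarrow> real"
  assumes "summable u" "\<And>k. 0 \<le> u k"
  shows "summable (\<lambda>k. (u k)\<^sup>2)"
proof -
  have "eventually (\<lambda>k. u k < 1) sequentially"
    using summable_LIMSEQ_zero[OF assms(1)] by (rule order_tendstoD) simp
  then have "eventually (\<lambda>k. norm ((u k)\<^sup>2) \<le> u k) sequentially"
    by eventually_elim (use assms(2) in \<open>simp add: power2_eq_square mult_left_le\<close>)
  then show ?thesis by (rule summable_comparison_test_ev[OF _ assms(1)])
qed

text \<open>A Riemann sum for the mean of |f|^2 on the unit circle. With finite averages,
  orthogonality is a geometric sum and Cauchy-Schwarz concerns finite sums.\<close>

definition circle_mean_square :: "(complex \<Rightarrow> complex) \<Rightarrow> nat \<Rightarrow> real" where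
  "circle_mean_square f M = (\<Sum>j<M. (cmod (f (unity_root M ^ j)))\<^sup>2) / real M"

text \<open>For the series cut at degree M, the average over M points satisfies Parseval exactly.
  Absolute summability makes the removed tail small uniformly on the circle, and the moduli are
  bounded by \<open>T\<close>, so the squares differ by at most 2 T times the tail.\<close>

lemma circle_mean_square_tendsto:
  fixes c :: "nat \<Rightarrow> complex"
  assumes c: "summable (\<lambda>k. cmod (c k))"
  shows "circle_mean_square (\<lambda>w. \<Sum>k. c k * w ^ k) \<longlonglongrightarrow> (\<Sum>k. (cmod (c k))\<^sup>2)"
proof -
  define T where "T = (\<Sum>k. cmod (c k))"
  define tl where "tl M = (\<Sum>k. cmod (c (k + M)))" for M
  have sq: "summable (\<lambda>k. (cmod (c k))\<^sup>2)" using c by (rule summable_square) simp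
  have tl0: "tl \<longlonglongrightarrow> 0" unfolding tl_def using suminf_exist_split2[OF c] .
  have tlnn: "0 \<le> tl M" for M unfolding tl_def by (intro suminf_nonneg summable_ignore_initial_segment c) auto
  have T0: "0 \<le> T" unfolding T_def by (intro suminf_nonneg c) auto
  have diff: "\<bar>circle_mean_square (\<lambda>w. \<Sum>k. c k * w ^ k) M - (\<Sum>k<M. (cmod (c k))\<^sup>2)\<bar> \<le> 2 * T * tl M" if M: "0 < M" for M
  proof -
    have close: "\<bar>(cmod (\<Sum>k. c k * w ^ k))\<^sup>2 - (cmod (\<Sum>k<M. c k * w ^ k))\<^sup>2\<bar> \<le> 2 * T * tl M" if w: "cmod w = 1" for w
    proof -
      have nw: "cmod (c k * w ^ k) = cmod (c k)" for k using w by (simp add: norm_mult norm_power)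
      have s: "summable (\<lambda>k. c k * w ^ k)" by (rule summable_norm_cancel) (simp add: nw c)
      let ?a = "\<Sum>k. c k * w ^ k" and ?b = "\<Sum>k<M. c k * w ^ k"
      have "?a - ?b = (\<Sum>k. c (k + M) * w ^ (k + M))"
        using suminf_split_initial_segment[OF s, of M] by simp
      then have "cmod (?a - ?b) \<le> tl M"
        unfolding tl_def using summable_norm[of "\<lambda>k. c (k + M) * w ^ (k + M)"] summable_ignore_initial_segment[OF c, of M]
        by (simp add: nw)
      moreover have "cmod ?a \<le> T" unfolding T_def using summable_norm[of "\<lambda>k. c k * w ^ k"] c by (simp add: nw)
      moreover have "cmod ?b \<le> T"
      proof -
        have "cmod ?b \<le> (\<Sum>k<M. cmod (c k))" by (rule sum_norm_le) (simp add: nw)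
        also have "\<dots> \<le> T" unfolding T_def by (rule sum_le_suminf[OF c]) auto
        finally show ?thesis .
      qed
      moreover have "\<bar>(cmod ?a)\<^sup>2 - (cmod ?b)\<^sup>2\<bar> = (cmod ?a + cmod ?b) * \<bar>cmod ?a - cmod ?b\<bar>"
        by (simp add: power2_eq_square square_diff_square_factored abs_mult)
      moreover have "\<bar>cmod ?a - cmod ?b\<bar> \<le> cmod (?a - ?b)" by (rule norm_triangle_ineq3)
      ultimately show ?thesis using tlnn[of M] T0
        by (auto intro!: mult_mono)
    qed
    have "circle_mean_square (\<lambda>w. \<Sum>k. c k * w ^ k) M - (\<Sum>k<M. (cmod (c k))\<^sup>2)
      = (\<Sum>j<M. (cmod (\<Sum>k. c k * (unity_root M ^ j) ^ k))\<^sup>2 - (cmod (\<Sum>k<M. c k * (unity_root M ^ j) ^ k))\<^sup>2) / real M"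
      unfolding circle_mean_square_def sum_subtractf parseval_discrete using M by (simp add: field_simps)
    also have "\<bar>\<dots>\<bar> \<le> (\<Sum>j<M. 2 * T * tl M) / real M"
      unfolding abs_divide using M
      by (intro divide_mono order_trans[OF sum_abs] sum_mono close) (auto simp: norm_power sum_nonneg tlnn T0)
    finally show ?thesis using M by simp
  qed
  have "(\<lambda>M. circle_mean_square (\<lambda>w. \<Sum>k. c k * w ^ k) M - (\<Sum>k<M. (cmod (c k))\<^sup>2)) \<longlonglongrightarrow> 0"
  proof (rule Lim_null_comparison)
    show "eventually (\<lambda>M. norm (circle_mean_square (\<lambda>w. \<Sum>k. c k * w ^ k) M - (\<Sum>k<M. (cmod (c k))\<^sup>2)) \<le> 2 * T * tl M) sequentially"
      using eventually_gt_at_top[of 0] by eventually_elim (simp add: diff)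
    show "(\<lambda>M. 2 * T * tl M) \<longlonglongrightarrow> 0" using tendsto_mult_right_zero[OF tl0] by simp
  qed
  from tendsto_add[OF this summable_LIMSEQ[OF sq]] show ?thesis by simp
qed

text \<open>Cauchy-Schwarz against the constant 1 bounds the squared mean of |g|^2 by the mean of
  |g|^4, which is the mean square of g^2. This relates a square root to the original
  function.\<close>

lemma circle_mean_square_sq:
  "(circle_mean_square g M)\<^sup>2 \<le> circle_mean_square (\<lambda>w. (g w)\<^sup>2) M"
proof (cases "M = 0")
  case False
  have "(\<Sum>j<M. (cmod (g (unity_root M ^ j)))\<^sup>2)\<^sup>2 \<le> (\<Sum>j<M. ((cmod (g (unity_root M ^ j)))\<^sup>2)\<^sup>2) * real (card {..<M})"
    by (rule sum_squared_le_sum_of_squares)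
  then show ?thesis using False
    unfolding circle_mean_square_def power_divide norm_power by (simp add: power2_eq_square[of "real M"] field_simps)
qed (simp add: circle_mean_square_def)

section \<open>Taylor coefficients of an analytic square root\<close>

lemma unit_disc_series_sums:
  fixes x :: "nat \<Rightarrow> complex"
  assumes x: "\<And>\<rho>. 0 < \<rho> \<Longrightarrow> \<rho> < 1 \<Longrightarrow> summable (\<lambda>n. cmod (x n) * \<rho> ^ n)" and z: "cmod z < 1"
  shows "(\<lambda>n. x n * z ^ n) sums (\<Sum>n. x n * z ^ n)"
proof (rule summable_sums[OF summable_norm_cancel])
  obtain \<rho> where \<rho>: "cmod z < \<rho>" "\<rho> < 1" using z dense[of "cmod z" 1] by auto
  then have "0 < \<rho>" using norm_ge_zero[of z] by linarith
  show "summable (\<lambda>n. cmod (x n * z ^ n))"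
    using x[OF \<open>0 < \<rho>\<close> \<rho>(2)] by (rule summable_comparison_test'[where N = 0])
      (use \<rho> in \<open>auto simp: norm_mult norm_power intro!: mult_left_mono power_mono\<close>)
qed

lemma unit_disc_series_holomorphic:
  fixes x :: "nat \<Rightarrow> complex"
  assumes x: "\<And>\<rho>. 0 < \<rho> \<Longrightarrow> \<rho> < 1 \<Longrightarrow> summable (\<lambda>n. cmod (x n) * \<rho> ^ n)"
  shows "(\<lambda>z. \<Sum>n. x n * z ^ n) holomorphic_on ball 0 1"
  by (rule power_series_holomorphic[of _ _ x]) (use unit_disc_series_sums[OF x] in simp)

text \<open>The recursion results from comparing the coefficients of \<open>z ^ Suc n\<close> in \<open>G\<^sup>2 = \<Sum>n. x n z ^ n\<close>.\<close>

fun sqrt_coeff :: "(nat \<Rightarrow> complex) \<Rightarrow> nat \<Rightarrow> complex" where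
  "sqrt_coeff x 0 = csqrt (x 0)"
| "sqrt_coeff x (Suc n) =
     (x (Suc n) - (\<Sum>i=1..n. sqrt_coeff x i * sqrt_coeff x (Suc n - i))) / (2 * csqrt (x 0))"

declare sqrt_coeff.simps [simp del]

text \<open>An analytic root is only known to exist for each hole configuration. This identifies its
  coefficients with an explicit function of \<open>x\<close>, whose measurability and dependence on
  each variable can be studied.\<close>

lemma sqrt_coeff_unique:
  assumes "g 0 = csqrt (x 0)" "x 0 \<noteq> 0" and conv: "\<And>n. x n = (\<Sum>i=0..n. g i * g (n - i))"
  shows "g n = sqrt_coeff x n"
proof (induction n rule: less_induct)
  case (less n)
  show ?case
  proof (cases n)
    case 0
    then show ?thesis using assms(1) by (simp add: sqrt_coeff.simps)
  next
    case (Suc m)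
    have "x (Suc m) = g 0 * g (Suc m) + (\<Sum>i=1..m. g i * g (Suc m - i)) + g (Suc m) * g 0"
      unfolding conv[of "Suc m"] by (simp add: sum.atLeast_Suc_atMost)
    also have "(\<Sum>i=1..m. g i * g (Suc m - i)) = (\<Sum>i=1..m. sqrt_coeff x i * sqrt_coeff x (Suc m - i))"
      by (intro sum.cong refl arg_cong2[where f = "(*)"] less.IH) (auto simp: Suc)
    finally show ?thesis
      using assms(1,2) unfolding Suc sqrt_coeff.simps by (simp add: field_simps)
  qed
qed

lemma sum_sqrt_coeff_le:
  fixes x :: "nat \<Rightarrow> complex"
  assumes r: "0 < r" "r < 1"
    and x: "\<And>\<rho>. 0 < \<rho> \<Longrightarrow> \<rho> < 1 \<Longrightarrow> summable (\<lambda>n. cmod (x n) * \<rho> ^ n)"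
    and nz: "\<And>z. cmod z \<le> r \<Longrightarrow> (\<Sum>n. x n * z ^ n) \<noteq> 0"
  shows "(\<Sum>k\<le>N. (cmod (sqrt_coeff x k))\<^sup>2 * r ^ (4 * k)) \<le> sqrt (\<Sum>n. (cmod (x n))\<^sup>2 * r ^ (2 * n))"
proof -
  define F where "F z = (\<Sum>n. x n * z ^ n)" for z
  note Fs = unit_disc_series_sums[OF x, folded F_def]
  have "F holomorphic_on ball 0 1"
    unfolding F_def[abs_def] by (rule unit_disc_series_holomorphic[OF x])
  then have h1: "F holomorphic_on ball 0 r" by (rule holomorphic_on_subset) (use r in auto)
  have h2: "contractible (ball (0::complex) r)" by (intro convex_imp_contractible) simp
  have h3: "F z \<noteq> 0" if "z \<in> ball 0 r" for z using nz[of z] that by (simp add: F_def)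
  obtain G0 where G0: "G0 holomorphic_on ball 0 r" "\<And>z. z \<in> ball 0 r \<Longrightarrow> F z = G0 z ^ 2"
    by (rule contractible_imp_holomorphic_sqrt[OF h1 h2]) (use h3 in blast)+
  have F0: "F 0 = x 0" unfolding F_def by (simp add: powser_zero)
  have x0: "x 0 \<noteq> 0" using nz[of 0] r F0 by (simp add: F_def)
  \<comment> \<open>An analytic root is determined up to sign; the factor \<open>s\<close> selects
    the one whose value at 0 is the principal root used in the recursion.\<close>
  have "(G0 0)\<^sup>2 = (csqrt (x 0))\<^sup>2" using G0(2)[of 0] F0 r by simp
  then have "G0 0 = csqrt (x 0) \<or> G0 0 = - csqrt (x 0)" by (simp only: power2_eq_iff)
  then obtain s :: complex where s: "s\<^sup>2 = 1" "s * G0 0 = csqrt (x 0)"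
    by (auto intro: that[of 1] that[of "-1"])
  define G where "G z = s * G0 z" for z
  have holG: "G holomorphic_on ball 0 r" unfolding G_def by (intro holomorphic_intros G0)
  have G2: "F z = (G z)\<^sup>2" if "z \<in> ball 0 r" for z using G0(2)[OF that] s by (simp add: G_def power_mult_distrib)
  define g where "g n = (deriv ^^ n) G 0 / fact n" for n
  have Gs: "(\<lambda>n. g n * z ^ n) sums G z" if "z \<in> ball 0 r" for z
    using holomorphic_power_series[OF holG that] by (simp add: g_def)
  have near: "eventually (\<lambda>z. z \<in> ball 0 r) (nhds (0::complex))"
    using r by (intro eventually_nhds_in_open) auto
  have "F has_fps_expansion Abs_fps x"
    by (rule has_fps_expansionI, rule eventually_mono[OF near]) (use Fs r in auto)
  moreover have "F has_fps_expansion Abs_fps g * Abs_fps g"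
  proof -
    have Gf: "G has_fps_expansion Abs_fps g"
      by (rule has_fps_expansionI, rule eventually_mono[OF near]) (use Gs in auto)
    have "(\<lambda>z. G z * G z) has_fps_expansion Abs_fps g * Abs_fps g"
      by (rule has_fps_expansion_mult[OF Gf Gf])
    moreover have "eventually (\<lambda>z. G z * G z = F z) (nhds 0)"
      by (rule eventually_mono[OF near]) (simp add: G2 power2_eq_square)
    ultimately show ?thesis using has_fps_expansion_cong[of "\<lambda>z. G z * G z" F] by blast
  qed
  ultimately have "Abs_fps x = Abs_fps g * Abs_fps g" by (rule fps_expansion_unique_complex)
  then have "fps_nth (Abs_fps x) n = fps_nth (Abs_fps g * Abs_fps g) n" for n by simp
  then have conv: "x n = (\<Sum>i=0..n. g i * g (n - i))" for n
    by (simp only: fps_mult_nth fps_nth_Abs_fps)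
  have "g 0 = csqrt (x 0)" using s by (simp add: g_def G_def)
  then have gsq: "g n = sqrt_coeff x n" for n
    by (rule sqrt_coeff_unique[OF _ x0 conv])
  \<comment> \<open>A radius strictly below r is required for absolute convergence of the series of
    G. The choice r^2 gives the weights r^(4k).\<close>
  define \<rho> where "\<rho> = r\<^sup>2"
  have \<rho>: "0 < \<rho>" "\<rho> < r" using r by (auto simp: \<rho>_def power2_eq_square mult_less_cancel_left1)
  define c where "c n = g n * of_real \<rho> ^ n" for n
  define f where "f n = x n * of_real \<rho> ^ n" for n
  have sc: "summable (\<lambda>k. cmod (c k))"
  proof -
    obtain t where t: "\<rho> < t" "t < r" using \<rho> dense by blast
    have "summable (\<lambda>n. g n * complex_of_real t ^ n)"
      using Gs[of "of_real t"] t \<rho> by (auto simp: sums_iff)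
    from powser_insidea[OF this, of "of_real \<rho>"] t \<rho> show ?thesis by (simp add: c_def)
  qed
  have sf: "summable (\<lambda>k. cmod (f k))"
    using x[of \<rho>] \<rho> r by (simp add: f_def norm_mult norm_power)
  have gm: "circle_mean_square (\<lambda>w. \<Sum>k. f k * w ^ k) M = circle_mean_square (\<lambda>w. (\<Sum>k. c k * w ^ k)\<^sup>2) M" for M
  proof -
    have "(\<Sum>k. f k * w ^ k) = (\<Sum>k. c k * w ^ k)\<^sup>2" if "cmod w = 1" for w
    proof -
      have b: "of_real \<rho> * w \<in> ball 0 r" using that \<rho> by (simp add: norm_mult)
      have "(\<Sum>k. f k * w ^ k) = F (of_real \<rho> * w)"
        unfolding F_def f_def by (simp add: power_mult_distrib mult_ac)
      also have "\<dots> = (G (of_real \<rho> * w))\<^sup>2" by (rule G2[OF b])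
      also have "G (of_real \<rho> * w) = (\<Sum>k. c k * w ^ k)"
        using sums_unique[OF Gs[OF b]] unfolding c_def by (simp add: power_mult_distrib mult_ac)
      finally show ?thesis .
    qed
    then show ?thesis unfolding circle_mean_square_def by (simp add: norm_power)
  qed
  have "(\<Sum>k. (cmod (c k))\<^sup>2)\<^sup>2 \<le> (\<Sum>k. (cmod (f k))\<^sup>2)"
  proof (rule LIMSEQ_le)
    show "(\<lambda>M. (circle_mean_square (\<lambda>w. \<Sum>k. c k * w ^ k) M)\<^sup>2) \<longlonglongrightarrow> (\<Sum>k. (cmod (c k))\<^sup>2)\<^sup>2"
      by (intro tendsto_power circle_mean_square_tendsto sc)
    show "circle_mean_square (\<lambda>w. \<Sum>k. f k * w ^ k) \<longlonglongrightarrow> (\<Sum>k. (cmod (f k))\<^sup>2)"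
      by (intro circle_mean_square_tendsto sf)
    show "\<exists>N. \<forall>n\<ge>N. (circle_mean_square (\<lambda>w. \<Sum>k. c k * w ^ k) n)\<^sup>2 \<le> circle_mean_square (\<lambda>w. \<Sum>k. f k * w ^ k) n"
      unfolding gm using circle_mean_square_sq by blast
  qed
  have cr: "(cmod (c k))\<^sup>2 = (cmod (sqrt_coeff x k))\<^sup>2 * r ^ (4 * k)" for k
  proof -
    have "(cmod (c k))\<^sup>2 = (cmod (sqrt_coeff x k))\<^sup>2 * (\<rho> ^ k)\<^sup>2"
      using \<rho> by (simp add: c_def gsq norm_mult norm_power power_mult_distrib)
    also have "(\<rho> ^ k)\<^sup>2 = r ^ (4 * k)" by (simp add: \<rho>_def mult_ac flip: power_mult)
    finally show ?thesis .
  qed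
  have "(\<Sum>k\<le>N. (cmod (sqrt_coeff x k))\<^sup>2 * r ^ (4 * k)) \<le> (\<Sum>k. (cmod (c k))\<^sup>2)"
    unfolding cr[symmetric] by (intro sum_le_suminf summable_square sc) auto
  also have "\<dots> \<le> sqrt (\<Sum>k. (cmod (f k))\<^sup>2)"
    using \<open>(\<Sum>k. (cmod (c k))\<^sup>2)\<^sup>2 \<le> _\<close> by (rule real_le_rsqrt)
  \<comment> \<open>On the circle of radius \<open>\<rho>\<close> the weights of F are r^(4n); they
    are enlarged to r^(2n).\<close>
  also have "\<dots> \<le> sqrt (\<Sum>n. (cmod (x n))\<^sup>2 * r ^ (2 * n))"
  proof (intro real_sqrt_le_mono suminf_le)
    have e: "(cmod (x n))\<^sup>2 * r ^ (2 * n) = (cmod (x n) * r ^ n)\<^sup>2" for n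
      by (simp add: power_mult_distrib mult.commute flip: power_mult)
    show "summable (\<lambda>n. (cmod (x n))\<^sup>2 * r ^ (2 * n))"
      unfolding e using x[OF r] r by (intro summable_square) auto
    show "summable (\<lambda>k. (cmod (f k))\<^sup>2)" by (intro summable_square sf) auto
    show "(cmod (f n))\<^sup>2 \<le> (cmod (x n))\<^sup>2 * r ^ (2 * n)" for n
      unfolding e f_def norm_mult norm_power using \<rho> r
      by (intro power_mono mult_left_mono) auto
  qed
  finally show ?thesis .
qed

section \<open>Integration in the coefficients of the square root\<close>

lemma borel_measurable_csqrt [measurable]: "csqrt \<in> borel_measurable borel"
proof -
  have "csqrt = (\<lambda>z. Complex (sqrt ((cmod z + Re z) / 2))
      ((if Im z = 0 then 1 else sgn (Im z)) * sqrt ((cmod z - Re z) / 2)))"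
    by (auto simp: fun_eq_iff complex_eq_iff)
  then show ?thesis
    by (simp add: borel_measurable_complex_iff)
qed

text \<open>This is the triangular structure: a later variable does not affect earlier coefficients,
  and the infinite sequence may be restricted to finitely many indices.\<close>

lemma sqrt_coeff_cong:
  "(\<And>i. i \<le> n \<Longrightarrow> x i = y i) \<Longrightarrow> sqrt_coeff x n = sqrt_coeff y n"
proof (induction n rule: less_induct)
  case (less n)
  show ?case
  proof (cases n)
    case 0
    then show ?thesis using less.prems by (simp add: sqrt_coeff.simps)
  next
    case (Suc m)
    have "(\<Sum>i=1..m. sqrt_coeff x i * sqrt_coeff x (Suc m - i)) = (\<Sum>i=1..m. sqrt_coeff y i * sqrt_coeff y (Suc m - i))"
      using less.prems by (intro sum.cong refl arg_cong2[where f = "(*)"] less.IH) (auto simp: Suc)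
    then show ?thesis using less.prems by (simp add: Suc sqrt_coeff.simps)
  qed
qed

lemma borel_measurable_sqrt_coeff:
  assumes "\<And>i. i \<le> n \<Longrightarrow> (\<lambda>\<omega>. x \<omega> i) \<in> borel_measurable M"
  shows "(\<lambda>\<omega>. sqrt_coeff (x \<omega>) n) \<in> borel_measurable M"
  using assms
proof (induction n rule: less_induct)
  case (less n)
  have [measurable]: "(\<lambda>\<omega>. csqrt (x \<omega> 0)) \<in> borel_measurable M"
    using less.prems[of 0] by measurable
  show ?case
  proof (cases n)
    case 0
    then show ?thesis by (simp add: sqrt_coeff.simps)
  next
    case (Suc m)
    have sm: "(\<lambda>\<omega>. sqrt_coeff (x \<omega>) i) \<in> borel_measurable M" if "i \<le> m" for i
      using that less.prems by (intro less.IH) (auto simp: Suc)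
    have [measurable]: "(\<lambda>\<omega>. x \<omega> (Suc m)) \<in> borel_measurable M"
      using less.prems Suc by simp
    have [measurable]: "(\<lambda>\<omega>. \<Sum>i=1..m. sqrt_coeff (x \<omega>) i * sqrt_coeff (x \<omega>) (Suc m - i)) \<in> borel_measurable M"
      by (intro borel_measurable_sum borel_measurable_times sm) auto
    show ?thesis unfolding Suc sqrt_coeff.simps by measurable
  qed
qed

lemma borel_measurable_gauss_sqrt_coeff:
  fixes a :: "nat \<Rightarrow> real"
  assumes "k \<le> n"
  shows "(\<lambda>x. sqrt_coeff (\<lambda>i. x i * complex_of_real (a i)) k) \<in> borel_measurable (gauss_PiM {..n})"
proof (rule borel_measurable_sqrt_coeff)
  fix i assume "i \<le> k"
  then have [measurable]: "(\<lambda>x. x i) \<in> borel_measurable (gauss_PiM {..n})"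
    using measurable_component_singleton[of i "{..n}" "\<lambda>_. gauss"] assms by (simp cong: measurable_cong_sets)
  show "(\<lambda>x. x i * complex_of_real (a i)) \<in> borel_measurable (gauss_PiM {..n})"
    by measurable
qed

text \<open>The \<open>n\<close>-th coefficient of the square root is an affine function of the \<open>n\<close>-th variable, with
  slope of modulus \<open>a n / (2 \<surd>(a 0 |x 0|))\<close> and with an offset depending on the previous variables only.
  The variables can therefore be integrated out one after the other.\<close>

lemma nn_integral_gauss_sqrt_coeff:
  fixes a :: "nat \<Rightarrow> real"
  assumes c: "0 < c" and a: "\<And>n. c \<le> a n" "\<And>n. a n \<le> C" and \<alpha>: "0 < \<alpha>" and \<tau>: "0 < \<tau>"
  defines "A \<equiv> {z :: complex. z \<noteq> 0 \<and> cmod z \<le> \<tau>}"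
  defines "s \<equiv> \<lambda>x. sqrt_coeff (\<lambda>n. x n * complex_of_real (a n))"
  shows "(\<integral>\<^sup>+x. indicator A (x 0) * ennreal (exp (- \<alpha> * (\<Sum>k=1..N. (cmod (s x k))\<^sup>2))) \<partial>gauss_PiM {..N})
    \<le> ennreal ((4 * C * \<tau> / (\<alpha> * c\<^sup>2)) ^ N)"
proof (induction N)
  case 0
  have "(\<integral>\<^sup>+x. indicator A (x 0) \<partial>gauss_PiM {..0 :: nat}) \<le> (\<integral>\<^sup>+x. 1 \<partial>gauss_PiM {..0 :: nat})"
    by (intro nn_integral_mono) (auto simp: indicator_def)
  also have "\<dots> = 1" using gauss_PiM.emeasure_space_1[of "{..0 :: nat}"] by simp
  finally show ?case by simp
next
  case (Suc N)
  have C: "0 < C" using c a[of 0] by linarith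
  let ?P = "gauss_PiM {..N}" and ?K = "4 * C * \<tau> / (\<alpha> * c\<^sup>2)"
  let ?f = "\<lambda>N x. indicator A (x 0) * ennreal (exp (- \<alpha> * (\<Sum>k=1..N. (cmod (s x k))\<^sup>2)))"
  have mg: "(\<lambda>z. ennreal (exp (- \<alpha> * (cmod (b * z - d))\<^sup>2))) \<in> borel_measurable gauss" for b d
    by measurable
  have [measurable]: "A \<in> sets borel" unfolding A_def by measurable
  have sm [measurable]: "(\<lambda>x. s x k) \<in> borel_measurable (gauss_PiM {..n})" if "k \<le> n" for k n
    unfolding s_def using that by (rule borel_measurable_gauss_sqrt_coeff)
  have x0m [measurable]: "(\<lambda>x. x 0) \<in> borel_measurable (gauss_PiM {..n :: nat})" for n
    using measurable_component_singleton[of 0 "{..n}" "\<lambda>_. gauss"] by (simp cong: measurable_cong_sets)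
  have fm: "?f n \<in> borel_measurable (gauss_PiM {..n})" for n
    by measurable
  have K0: "0 \<le> ?K" using c C \<alpha> \<tau> by simp
  have upd: "s (x(Suc N := z)) k = s x k" if "k \<le> N" for x z k
    unfolding s_def using that by (intro sqrt_coeff_cong) auto
  have "{..Suc N} = insert (Suc N) {..N}" by auto
  then have "(\<integral>\<^sup>+x. ?f (Suc N) x \<partial>gauss_PiM {..Suc N}) = (\<integral>\<^sup>+x. \<integral>\<^sup>+z. ?f (Suc N) (x(Suc N := z)) \<partial>gauss \<partial>?P)"
    using gauss_PiM.product_nn_integral_insert[of "{..N}" "Suc N" "?f (Suc N)"] fm[of "Suc N"] by simp
  also have "\<dots> \<le> (\<integral>\<^sup>+x. ?f N x * ennreal ?K \<partial>?P)"
  proof (intro nn_integral_mono)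
    fix x
    define S where "S = (\<Sum>i=1..N. s x i * s x (Suc N - i))"
    define g where "g = csqrt (x 0 * complex_of_real (a 0))"
    have sS: "s (x(Suc N := z)) (Suc N) = complex_of_real (a (Suc N)) / (2 * g) * z - S / (2 * g)" for z
    proof -
      have "(\<Sum>i=1..N. s (x(Suc N := z)) i * s (x(Suc N := z)) (Suc N - i)) = S"
        unfolding S_def by (intro sum.cong refl arg_cong2[where f = "(*)"] upd) auto
      then show ?thesis unfolding s_def
        by (subst sqrt_coeff.simps) (simp add: g_def diff_divide_distrib mult.commute)
    qed
    show "(\<integral>\<^sup>+z. ?f (Suc N) (x(Suc N := z)) \<partial>gauss) \<le> ?f N x * ennreal ?K"
    proof (cases "x 0 \<in> A")
      case False
      then show ?thesis by simp
    next
      case True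
      \<comment> \<open>Excluding 0 from \<open>A\<close> matters here: at \<open>x 0 = 0\<close>
        the recursion divides by zero, and the slope \<open>b\<close> would be 0.\<close>
      define b where "b = complex_of_real (a (Suc N)) / (2 * g)"
      have a0: "0 < a n" for n using a(1)[of n] c by linarith
      have x0: "x 0 \<noteq> 0" "cmod (x 0) \<le> \<tau>" using True by (auto simp: A_def)
      have "(cmod g)\<^sup>2 = cmod (g\<^sup>2)" by (simp add: norm_power)
      also have "\<dots> = cmod (x 0) * a 0" using a0[of 0] by (simp add: g_def norm_mult)
      finally have g2: "(cmod g)\<^sup>2 = cmod (x 0) * a 0" .
      have g0: "g \<noteq> 0" using x0 a0[of 0] by (simp add: g_def)
      have b0: "b \<noteq> 0" using g0 a0[of "Suc N"] by (simp add: b_def)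
      have b2: "(cmod b)\<^sup>2 = (a (Suc N))\<^sup>2 / (4 * (cmod (x 0) * a 0))"
        by (simp add: b_def norm_divide norm_mult power_divide power_mult_distrib g2)
      \<comment> \<open>A small first variable makes the slope large, hence the next coefficient of
        the root spread out. Only |\<open>x 0\<close>| \<le> \<tau> enters, so the bound is the same
        for every \<open>x\<close> in question.\<close>
      have "c\<^sup>2 / (4 * (\<tau> * C)) \<le> (cmod b)\<^sup>2"
        unfolding b2 using c C \<tau> x0 a0[of 0] a[of 0] a[of "Suc N"]
        by (intro frac_le mult_mono mult_left_mono power_mono mult_pos_pos) auto
      then have "1 / (\<alpha> * (cmod b)\<^sup>2) \<le> 1 / (\<alpha> * (c\<^sup>2 / (4 * (\<tau> * C))))"
        using \<alpha> c C \<tau> b0 by (intro divide_left_mono mult_left_mono mult_pos_pos) auto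
      also have "\<dots> = ?K" by simp
      finally have bK: "1 / (\<alpha> * (cmod b)\<^sup>2) \<le> ?K" .
      have "(\<integral>\<^sup>+z. ?f (Suc N) (x(Suc N := z)) \<partial>gauss)
          = (\<integral>\<^sup>+z. ?f N x * ennreal (exp (- \<alpha> * (cmod (b * z - S / (2 * g)))\<^sup>2)) \<partial>gauss)"
      proof (intro nn_integral_cong)
        fix z
        have e: "exp (- \<alpha> * (X + Y)) = exp (- \<alpha> * X) * exp (- \<alpha> * Y)" for X Y
          by (simp add: algebra_simps flip: exp_add)
        have "(\<Sum>k=1..Suc N. (cmod (s (x(Suc N := z)) k))\<^sup>2) = (\<Sum>k=1..N. (cmod (s x k))\<^sup>2) + (cmod (b * z - S / (2 * g)))\<^sup>2"
          using sS[of z] by (simp add: b_def upd)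
        then show "?f (Suc N) (x(Suc N := z)) = ?f N x * ennreal (exp (- \<alpha> * (cmod (b * z - S / (2 * g)))\<^sup>2))"
          by (simp only: e fun_upd_other[of 0 "Suc N"] nat.distinct mult.assoc)
             (simp add: ennreal_mult)
      qed
      also have "\<dots> = ?f N x * (\<integral>\<^sup>+z. ennreal (exp (- \<alpha> * (cmod (b * z - S / (2 * g)))\<^sup>2)) \<partial>gauss)"
        by (rule nn_integral_cmult[OF mg])
      also have "\<dots> \<le> ?f N x * ennreal ?K"
        by (intro mult_left_mono order_trans[OF nn_integral_gauss_translate_le[OF \<alpha> b0]] ennreal_leI bK) simp
      finally show ?thesis .
    qed
  qed
  also have "\<dots> = (\<integral>\<^sup>+x. ?f N x \<partial>?P) * ennreal ?K"
    by (rule nn_integral_multc[OF fm])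
  also have "\<dots> \<le> ennreal (?K ^ N) * ennreal ?K"
    by (intro mult_right_mono Suc.IH) simp
  also have "\<dots> = ennreal (?K ^ Suc N)"
    using K0 by (simp add: mult.commute flip: ennreal_mult')
  finally show ?case .
qed

section \<open>Gaussian power series\<close>

lemma emeasure_gauss_cbox_ge:
  assumes "Re l \<le> Re u" "Im l \<le> Im u" and R: "\<And>z. z \<in> cbox l u \<Longrightarrow> cmod z \<le> R"
  shows "ennreal (exp (- R\<^sup>2) / pi * ((Re u - Re l) * (Im u - Im l))) \<le> emeasure gauss (cbox l u)"
proof -
  have vol: "emeasure lborel (cbox l u) = ennreal ((Re u - Re l) * (Im u - Im l))"
    using assms(1,2) by (subst emeasure_lborel_cbox) (auto simp: Basis_complex_def)
  have "ennreal (exp (- R\<^sup>2) / pi * ((Re u - Re l) * (Im u - Im l)))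
      = (\<integral>\<^sup>+z. ennreal (exp (- R\<^sup>2) / pi) * indicator (cbox l u) z \<partial>lborel)"
    using assms(1,2)
    by (subst nn_integral_cmult_indicator) (auto simp only: vol ennreal_mult'[symmetric] exp_ge_zero divide_nonneg_nonneg pi_ge_zero mult.assoc sets_lborel borel_closed closed_cbox)
  also have "\<dots> \<le> (\<integral>\<^sup>+z. ennreal (exp (- (cmod z)\<^sup>2) / pi) * indicator (cbox l u) z \<partial>lborel)"
  proof (intro nn_integral_mono)
    fix z
    show "ennreal (exp (- R\<^sup>2) / pi) * indicator (cbox l u) z \<le> ennreal (exp (- (cmod z)\<^sup>2) / pi) * indicator (cbox l u) z"
      using R[of z] by (cases "z \<in> cbox l u") (auto intro!: ennreal_leI divide_right_mono power_mono)
  qed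
  also have "\<dots> = emeasure gauss (cbox l u)"
    unfolding gauss_def by (subst emeasure_density) auto
  finally show ?thesis .
qed

lemma measure_gauss_ball_pos:
  assumes "0 < e"
  shows "0 < measure gauss {z. cmod z \<le> e}"
proof -
  let ?Q = "cbox 0 (Complex (e/2) (e/2))"
  have Q: "cmod z \<le> e" if "z \<in> ?Q" for z
    using that cmod_le[of z] by (auto simp: in_cbox_complex_iff)
  have "ennreal (exp (- e\<^sup>2) / pi * ((e/2) * (e/2))) \<le> emeasure gauss ?Q"
    using emeasure_gauss_cbox_ge[of 0 "Complex (e/2) (e/2)" e] Q assms by simp
  also have "\<dots> \<le> emeasure gauss {z. cmod z \<le> e}"
    using Q by (intro emeasure_mono) auto
  finally have "exp (- e\<^sup>2) / pi * ((e/2) * (e/2)) \<le> measure gauss {z. cmod z \<le> e}"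
    by (simp add: gauss.emeasure_eq_measure)
  moreover have "0 < exp (- e\<^sup>2) / pi * ((e/2) * (e/2))" using assms by simp
  ultimately show ?thesis by linarith
qed

text \<open>A unit square inside the annulus between radii T and T + 2 is enough, since only the
  order of the exponent matters.\<close>

lemma measure_gauss_tail_ge:
  assumes "0 \<le> T"
  shows "exp (- (T + 2)\<^sup>2) / pi \<le> measure gauss {z. T \<le> cmod z}"
proof -
  let ?Q = "cbox (Complex T 0) (Complex (T + 1) 1)"
  have Q: "T \<le> cmod z" "cmod z \<le> T + 2" if "z \<in> ?Q" for z
    using that assms cmod_le[of z] complex_Re_le_cmod[of z] by (auto simp: in_cbox_complex_iff)
  have "ennreal (exp (- (T + 2)\<^sup>2) / pi) \<le> emeasure gauss ?Q"
    using emeasure_gauss_cbox_ge[of "Complex T 0" "Complex (T + 1) 1" "T + 2"] Q by simp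
  also have "\<dots> \<le> emeasure gauss {z. T \<le> cmod z}"
    using Q by (intro emeasure_mono) auto
  finally show ?thesis by (simp add: gauss.emeasure_eq_measure)
qed

text \<open>Exponential Markov inequality at half the critical exponent, where the exponential
  moment is 2.\<close>

lemma measure_gauss_tail_le: "measure gauss {z. T < cmod z} \<le> 2 * exp (- T\<^sup>2 / 2)" if "0 \<le> T"
proof -
  have "ennreal (exp (T\<^sup>2 / 2)) * emeasure gauss {z. T < cmod z}
      = (\<integral>\<^sup>+z. ennreal (exp (T\<^sup>2 / 2)) * indicator {z. T < cmod z} z \<partial>gauss)"
    by (subst nn_integral_cmult_indicator) auto
  also have "\<dots> \<le> (\<integral>\<^sup>+z. ennreal (exp (1/2 * (cmod z)\<^sup>2)) \<partial>gauss)"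
    using that by (intro nn_integral_mono) (auto simp: indicator_def intro!: ennreal_leI power_mono)
  also have "\<dots> = ennreal 2" by (subst nn_integral_gauss_exp) auto
  finally have "exp (T\<^sup>2 / 2) * measure gauss {z. T < cmod z} \<le> 2"
    by (simp add: gauss.emeasure_eq_measure del: ennreal_numeral flip: ennreal_mult')
  then have "measure gauss {z. T < cmod z} \<le> 2 / exp (T\<^sup>2 / 2)"
    by (subst pos_le_divide_eq) (auto simp: mult.commute)
  moreover have "exp (- T\<^sup>2 / 2) = inverse (exp (T\<^sup>2 / 2))"
    unfolding exp_minus[symmetric] by simp
  ultimately show ?thesis by (simp only: divide_inverse)
qed

lemma nn_integral_gauss_norm: "(\<integral>\<^sup>+z. ennreal (cmod z) \<partial>gauss) \<le> 5"
proof -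
  have "(\<integral>\<^sup>+z. ennreal (cmod z) \<partial>gauss) \<le> (\<integral>\<^sup>+z. 1 + ennreal ((cmod z)\<^sup>2) \<partial>gauss)"
  proof (intro nn_integral_mono)
    fix z :: complex
    have "cmod z \<le> 1 + (cmod z)\<^sup>2"
      using zero_le_power2[of "cmod z - 1 / 2"] by (simp add: power2_eq_square algebra_simps)
    then show "ennreal (cmod z) \<le> 1 + ennreal ((cmod z)\<^sup>2)"
      by (metis ennreal_1 ennreal_leI ennreal_plus zero_le_one zero_le_power2)
  qed
  also have "\<dots> = 1 + (\<integral>\<^sup>+z. ennreal ((cmod z)\<^sup>2) \<partial>gauss)"
    using gauss.emeasure_space_1 by (subst nn_integral_add) auto
  also have "\<dots> \<le> 1 + 4" by (intro add_left_mono nn_integral_gauss_second_moment)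
  finally show ?thesis by simp
qed

section \<open>Joint law and independence of the coefficients\<close>

locale gaussian_coefficients = prob_space M
  for M :: "'a measure" +
  fixes \<zeta> :: "nat \<Rightarrow> 'a \<Rightarrow> complex" and a :: "nat \<Rightarrow> real" and c C :: real
  assumes indep: "indep_vars (\<lambda>_. borel) \<zeta> UNIV"
    and gaussian: "std_complex_gaussian M (\<zeta> n)"
    and c_pos: "0 < c" and a_ge: "c \<le> a n" and a_le: "a n \<le> C"
begin

lemma C_pos: "0 < C"
  using c_pos a_ge[of 0] a_le[of 0] by linarith

lemma a_pos: "0 < a n"
  using c_pos a_ge[of n] by linarith

lemma rv_\<zeta> [measurable]: "\<zeta> n \<in> borel_measurable M"
  using indep by (simp add: indep_vars_def)

lemma distr_\<zeta>: "distr M borel (\<zeta> n) = gauss"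
proof -
  have "distr M borel (\<zeta> n) = distr M lborel (\<zeta> n)"
    by (rule distr_cong) auto
  then show ?thesis
    using gaussian[of n] by (simp add: std_complex_gaussian_def distributed_def gauss_def)
qed

lemma distr_\<zeta>_restrict:
  assumes "I \<noteq> {}"
  shows "distr M (gauss_PiM I) (\<lambda>\<omega>. \<lambda>i\<in>I. \<zeta> i \<omega>) = gauss_PiM I"
proof -
  have "indep_vars (\<lambda>_. borel) \<zeta> I"
    using indep by (rule indep_vars_subset) simp
  then have "distr M (PiM I (\<lambda>_. borel)) (\<lambda>\<omega>. \<lambda>i\<in>I. \<zeta> i \<omega>) = gauss_PiM I"
    using assms by (subst (asm) indep_vars_iff_distr_eq_PiM') (auto simp: distr_\<zeta>)
  moreover have "sets (gauss_PiM I) = sets (PiM I (\<lambda>_. borel))"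
    by (intro sets_PiM_cong) auto
  ultimately show ?thesis by (metis distr_cong)
qed

lemma measurable_\<zeta>_restrict [measurable]: "(\<lambda>\<omega>. \<lambda>i\<in>I. \<zeta> i \<omega>) \<in> M \<rightarrow>\<^sub>M gauss_PiM I"
  by (intro measurable_restrict) (simp cong: measurable_cong_sets)

lemma nn_integral_\<zeta>:
  assumes [measurable]: "f \<in> borel_measurable borel"
  shows "(\<integral>\<^sup>+\<omega>. f (\<zeta> n \<omega>) \<partial>M) = (\<integral>\<^sup>+z. f z \<partial>gauss)"
  by (subst distr_\<zeta>[of n, symmetric], subst nn_integral_distr) auto

lemma nn_integral_\<zeta>_restrict:
  assumes "f \<in> borel_measurable (gauss_PiM I)" "I \<noteq> {}"
  shows "(\<integral>\<^sup>+\<omega>. f (\<lambda>i\<in>I. \<zeta> i \<omega>) \<partial>M) = (\<integral>\<^sup>+x. f x \<partial>gauss_PiM I)"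
  by (subst distr_\<zeta>_restrict[OF assms(2), symmetric], subst nn_integral_distr) (use assms in auto)

lemma prob_\<zeta>:
  assumes "Z \<in> sets borel"
  shows "prob {\<omega> \<in> space M. \<zeta> n \<omega> \<in> Z} = measure gauss Z"
proof -
  have "measure gauss Z = measure (distr M borel (\<zeta> n)) Z" by (simp add: distr_\<zeta>)
  also have "\<dots> = prob (\<zeta> n -` Z \<inter> space M)"
    using assms by (subst measure_distr) auto
  also have "\<zeta> n -` Z \<inter> space M = {\<omega> \<in> space M. \<zeta> n \<omega> \<in> Z}" by auto
  finally show ?thesis by simp
qed

lemma prob_\<zeta>_restrict:
  assumes "E \<in> sets (gauss_PiM I)" "I \<noteq> {}"
  shows "prob {\<omega> \<in> space M. (\<lambda>i\<in>I. \<zeta> i \<omega>) \<in> E} = measure (gauss_PiM I) E"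
proof -
  have "measure (gauss_PiM I) E = measure (distr M (gauss_PiM I) (\<lambda>\<omega>. \<lambda>i\<in>I. \<zeta> i \<omega>)) E"
    by (simp add: distr_\<zeta>_restrict assms(2))
  also have "\<dots> = prob ((\<lambda>\<omega>. \<lambda>i\<in>I. \<zeta> i \<omega>) -` E \<inter> space M)"
    using assms by (subst measure_distr) auto
  also have "(\<lambda>\<omega>. \<lambda>i\<in>I. \<zeta> i \<omega>) -` E \<inter> space M = {\<omega> \<in> space M. (\<lambda>i\<in>I. \<zeta> i \<omega>) \<in> E}" by auto
  finally show ?thesis by simp
qed

text \<open>Grouping disjoint sets of independent variables keeps them independent; \<open>I\<close>
  may be infinite, so \<open>E\<close> can involve all the variables with index at least 1.\<close>

lemma prob_\<zeta>0_independent: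
  assumes Z: "Z \<in> sets borel" and E: "E \<in> sets (gauss_PiM I)" and I: "0 \<notin> I"
  shows "prob {\<omega> \<in> space M. \<zeta> 0 \<omega> \<in> Z \<and> (\<lambda>i\<in>I. \<zeta> i \<omega>) \<in> E}
    = prob {\<omega> \<in> space M. \<zeta> 0 \<omega> \<in> Z} * prob {\<omega> \<in> space M. (\<lambda>i\<in>I. \<zeta> i \<omega>) \<in> E}"
proof -
  let ?P = "\<lambda>I. PiM I (\<lambda>_. borel :: complex measure)"
  have iv: "indep_var (?P {0}) (\<lambda>\<omega>. \<lambda>i\<in>{0}. \<zeta> i \<omega>) (?P I) (\<lambda>\<omega>. \<lambda>i\<in>I. \<zeta> i \<omega>)"
    using I by (intro indep_var_restrict[OF indep]) auto
  have E': "E \<in> sets (?P I)"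
    using E sets_PiM_cong[of I I "\<lambda>_. gauss" "\<lambda>_. borel"] by simp
  define Z0 :: "(nat \<Rightarrow> complex) set" where "Z0 = (\<lambda>x. x 0) -` Z \<inter> space (?P {0})"
  have Z0: "Z0 \<in> sets (?P {0})"
    unfolding Z0_def
    by (rule measurable_sets[OF measurable_component_singleton[where I = "{0}" and M = "\<lambda>_. borel"] Z]) simp
  have mem: "(\<lambda>i\<in>{0}. \<zeta> i \<omega>) \<in> Z0 \<longleftrightarrow> \<zeta> 0 \<omega> \<in> Z" for \<omega>
    by (simp add: Z0_def space_PiM)
  have "{\<omega> \<in> space M. \<zeta> 0 \<omega> \<in> Z \<and> (\<lambda>i\<in>I. \<zeta> i \<omega>) \<in> E}
      = (\<lambda>\<omega>. (\<lambda>i\<in>{0}. \<zeta> i \<omega>, \<lambda>i\<in>I. \<zeta> i \<omega>)) -` (Z0 \<times> E) \<inter> space M"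
    "{\<omega> \<in> space M. \<zeta> 0 \<omega> \<in> Z} = (\<lambda>\<omega>. \<lambda>i\<in>{0}. \<zeta> i \<omega>) -` Z0 \<inter> space M"
    "{\<omega> \<in> space M. (\<lambda>i\<in>I. \<zeta> i \<omega>) \<in> E} = (\<lambda>\<omega>. \<lambda>i\<in>I. \<zeta> i \<omega>) -` E \<inter> space M"
    unfolding vimage_def mem[symmetric] by blast+
  then show ?thesis
    by (simp only: indep_varD[OF iv Z0 E'])
qed

text \<open>The radii 1 - 1/(i+2) increase to 1, so countably many conditions express absolute
  convergence in the whole open disc. Extended nonnegative sums always exist, which makes the set
  visibly measurable.\<close>

definition good :: "'a set" where
  "good = {\<omega> \<in> space M. \<forall>i. (\<Sum>n. ennreal (cmod (\<zeta> n \<omega>) * (1 - 1 / (real i + 2)) ^ n)) < \<top>}"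

lemma sets_good [measurable]: "good \<in> sets M"
  unfolding good_def by measurable

lemma summable_good:
  assumes \<omega>: "\<omega> \<in> good" and \<rho>: "0 < \<rho>" "\<rho> < 1"
  shows "summable (\<lambda>n. cmod (\<zeta> n \<omega>) * \<rho> ^ n)"
proof -
  obtain i :: nat where i: "1 / (1 - \<rho>) \<le> real i" using real_arch_simple by blast
  have "\<rho> \<le> 1 - 1 / (real i + 2)"
  proof -
    have "1 / (1 - \<rho>) \<le> real i + 2" using i by linarith
    then have "1 / (real i + 2) \<le> 1 - \<rho>" using \<rho> by (simp add: field_simps)
    then show ?thesis by linarith
  qed
  moreover have "summable (\<lambda>n. cmod (\<zeta> n \<omega>) * (1 - 1 / (real i + 2)) ^ n)"
    using \<omega> by (intro summable_suminf_not_top) (auto simp: good_def less_top)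
  ultimately show ?thesis
    using \<rho> by (elim summable_comparison_test'[where N = 0]) (auto intro!: mult_left_mono power_mono)
qed

lemma nn_integral_\<zeta>_weighted_sum:
  assumes "\<And>n. 0 \<le> w n"
  shows "(\<integral>\<^sup>+\<omega>. (\<Sum>n. ennreal (cmod (\<zeta> n \<omega>) * w n)) \<partial>M) \<le> 5 * (\<Sum>n. ennreal (w n))"
proof -
  have "(\<integral>\<^sup>+\<omega>. ennreal (cmod (\<zeta> n \<omega>) * w n) \<partial>M) \<le> 5 * ennreal (w n)" for n
  proof -
    have "(\<integral>\<^sup>+\<omega>. ennreal (cmod (\<zeta> n \<omega>) * w n) \<partial>M) = (\<integral>\<^sup>+\<omega>. ennreal (cmod (\<zeta> n \<omega>)) \<partial>M) * ennreal (w n)"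
      using assms by (simp add: ennreal_mult nn_integral_multc)
    also have "\<dots> \<le> 5 * ennreal (w n)"
      using nn_integral_gauss_norm by (intro mult_right_mono) (simp_all add: nn_integral_\<zeta>[of "\<lambda>z. ennreal (cmod z)"])
    finally show ?thesis .
  qed
  then have "(\<Sum>n. \<integral>\<^sup>+\<omega>. ennreal (cmod (\<zeta> n \<omega>) * w n) \<partial>M) \<le> (\<Sum>n. 5 * ennreal (w n))"
    by (intro suminf_le) auto
  then show ?thesis by (simp add: nn_integral_suminf)
qed

lemma AE_good: "AE \<omega> in M. \<omega> \<in> good"
proof -
  have "AE \<omega> in M. (\<Sum>n. ennreal (cmod (\<zeta> n \<omega>) * (1 - 1 / (real i + 2)) ^ n)) \<noteq> \<infinity>" for i
  proof (rule nn_integral_PInf_AE)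
    define \<rho> where "\<rho> = 1 - 1 / (real i + 2)"
    have \<rho>: "0 \<le> \<rho>" "\<rho> < 1" by (auto simp: \<rho>_def field_simps)
    have "(\<integral>\<^sup>+\<omega>. (\<Sum>n. ennreal (cmod (\<zeta> n \<omega>) * \<rho> ^ n)) \<partial>M) \<le> 5 * (\<Sum>n. ennreal (\<rho> ^ n))"
      by (rule nn_integral_\<zeta>_weighted_sum) (use \<rho> in simp)
    also have "(\<Sum>n. ennreal (\<rho> ^ n)) = ennreal (\<Sum>n. \<rho> ^ n)"
      using \<rho> by (intro suminf_ennreal2) (auto intro: summable_geometric)
    also have "5 * ennreal (\<Sum>n. \<rho> ^ n) < \<top>" by (simp add: ennreal_mult_less_top)
    finally show "(\<integral>\<^sup>+\<omega>. (\<Sum>n. ennreal (cmod (\<zeta> n \<omega>) * (1 - 1 / (real i + 2)) ^ n)) \<partial>M) \<noteq> \<infinity>"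
      unfolding \<rho>_def[symmetric] by simp
  qed measurable
  then have "AE \<omega> in M. \<forall>i. (\<Sum>n. ennreal (cmod (\<zeta> n \<omega>) * (1 - 1 / (real i + 2)) ^ n)) \<noteq> \<infinity>"
    by (simp add: AE_all_countable)
  then show ?thesis
    by (rule AE_mp) (intro AE_I2, simp add: good_def less_top)
qed

section \<open>The random series and measurability of the hole event\<close>

abbreviation F :: "'a \<Rightarrow> complex \<Rightarrow> complex" where
  "F \<equiv> gaussian_series a \<zeta>"

definition coeffs :: "'a \<Rightarrow> nat \<Rightarrow> complex" where
  "coeffs \<omega> n = \<zeta> n \<omega> * complex_of_real (a n)"

lemma F_eq: "F \<omega> = (\<lambda>z. \<Sum>n. coeffs \<omega> n * z ^ n)"
  by (simp add: gaussian_series_def coeffs_def fun_eq_iff)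

lemma norm_coeffs_le: "cmod (coeffs \<omega> n) \<le> C * cmod (\<zeta> n \<omega>)"
  using a_le[of n] a_pos[of n] by (simp add: coeffs_def norm_mult mult.commute[of C] mult_left_mono)

lemma summable_coeffs:
  assumes "\<omega> \<in> good" "0 < \<rho>" "\<rho> < 1"
  shows "summable (\<lambda>n. cmod (coeffs \<omega> n) * \<rho> ^ n)"
proof (rule summable_comparison_test'[where N = 0])
  show "summable (\<lambda>n. C * (cmod (\<zeta> n \<omega>) * \<rho> ^ n))"
    by (intro summable_mult summable_good assms)
  show "norm (cmod (coeffs \<omega> n) * \<rho> ^ n) \<le> C * (cmod (\<zeta> n \<omega>) * \<rho> ^ n)" for n
    using norm_coeffs_le[of \<omega> n] assms by (simp add: mult.assoc[symmetric] mult_right_mono)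
qed

lemma measurable_F [measurable]: "(\<lambda>\<omega>. F \<omega> z) \<in> borel_measurable M"
  unfolding gaussian_series_def by measurable

text \<open>Uncountably many points are reduced to countably many: on \<open>good\<close> the series
  is continuous on the compact disc, so having no zero means that |F| is at least some 1/(k+1)
  there, and by continuity this can be tested on a countable dense set.\<close>

lemma sets_Hole_good [measurable]:
  assumes r: "0 \<le> r" "r < 1"
  shows "Hole M a \<zeta> r \<inter> good \<in> sets M"
proof -
  obtain T :: "complex set" where T: "countable T" "T \<subseteq> cball 0 r" "cball 0 r \<subseteq> closure T"
    using separable by blast
  have "Hole M a \<zeta> r \<inter> good = good \<inter> {\<omega> \<in> space M. \<exists>k::nat. \<forall>z\<in>T. 1 / (real k + 1) \<le> cmod (F \<omega> z)}"
  proof (intro set_eqI iffI)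
    fix \<omega> assume \<omega>: "\<omega> \<in> Hole M a \<zeta> r \<inter> good"
    have "continuous_on (ball 0 1) (F \<omega>)"
      using \<omega> unfolding F_eq
      by (intro holomorphic_on_imp_continuous_on unit_disc_series_holomorphic summable_coeffs) auto
    then have "continuous_on (cball 0 r) (F \<omega>)" by (rule continuous_on_subset) (use r in auto)
    then have "\<exists>z0\<in>cball 0 r. \<forall>z\<in>cball 0 r. cmod (F \<omega> z0) \<le> cmod (F \<omega> z)"
      using r by (intro continuous_attains_inf continuous_on_norm) auto
    then obtain z0 where z0: "cmod z0 \<le> r" "\<And>z. cmod z \<le> r \<Longrightarrow> cmod (F \<omega> z0) \<le> cmod (F \<omega> z)" by auto
    have "0 < cmod (F \<omega> z0)" using \<omega> z0(1) by (auto simp: Hole_def)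
    then obtain k :: nat where "inverse (real (Suc k)) < cmod (F \<omega> z0)" using reals_Archimedean by blast
    then have "1 / (real k + 1) \<le> cmod (F \<omega> z)" if "z \<in> T" for z
      using z0(2)[of z] that T(2) by (force simp: inverse_eq_divide add.commute)
    then show "\<omega> \<in> good \<inter> {\<omega> \<in> space M. \<exists>k::nat. \<forall>z\<in>T. 1 / (real k + 1) \<le> cmod (F \<omega> z)}"
      using \<omega> by (auto simp: Hole_def)
  next
    fix \<omega> assume \<omega>: "\<omega> \<in> good \<inter> {\<omega> \<in> space M. \<exists>k::nat. \<forall>z\<in>T. 1 / (real k + 1) \<le> cmod (F \<omega> z)}"
    then obtain k :: nat where k: "\<And>z. z \<in> T \<Longrightarrow> 1 / (real k + 1) \<le> cmod (F \<omega> z)" by auto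
    have "continuous_on (ball 0 1) (F \<omega>)"
      using \<omega> unfolding F_eq
      by (intro holomorphic_on_imp_continuous_on unit_disc_series_holomorphic summable_coeffs) auto
    moreover have "closure T \<subseteq> cball 0 r" using T(2) by (intro closure_minimal) auto
    ultimately have cont: "continuous_on (closure T) (F \<omega>)"
      by (elim continuous_on_subset) (use r in auto)
    have "F \<omega> z \<noteq> 0" if "cmod z \<le> r" for z
    proof -
      have "z \<in> closure T" using that T(3) by auto
      then have "1 / (real k + 1) \<le> cmod (F \<omega> z)"
        using continuous_ge_on_closure[OF continuous_on_norm[OF cont]] k by blast
      moreover have "0 < 1 / (real k + 1)" by simp
      ultimately show ?thesis by auto
    qed
    then show "\<omega> \<in> Hole M a \<zeta> r \<inter> good" using \<omega> by (auto simp: Hole_def)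
  qed
  also have "\<dots> \<in> sets M"
    using T(1) by measurable
  finally show ?thesis .
qed

text \<open>The part of the event outside \<open>good\<close> lies in a null set, so in the
  completion it is measurable and weighs nothing.\<close>

lemma hole_prob_eq:
  assumes r: "0 \<le> r" "r < 1"
  shows "hole_prob M a \<zeta> r = prob (Hole M a \<zeta> r \<inter> good)"
proof -
  let ?H = "Hole M a \<zeta> r"
  have N: "space M - good \<in> null_sets M"
  proof -
    have "{\<omega> \<in> space M. \<not> \<omega> \<in> good} \<in> null_sets M"
      using AE_good by (subst (asm) AE_iff_null) auto
    then show ?thesis by (simp add: set_diff_eq)
  qed
  have H: "?H \<in> sets (completion M)"
    by (rule sets_completionI[of ?H "?H \<inter> good" "?H - good" "space M - good"])
       (use sets_Hole_good[OF r] N in \<open>auto simp: Hole_def\<close>)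
  have "emeasure (completion M) ?H = emeasure (completion M) (?H \<inter> good)"
  proof (rule emeasure_eq_AE)
    show "AE \<omega> in completion M. \<omega> \<in> ?H \<longleftrightarrow> \<omega> \<in> ?H \<inter> good"
      using AE_completion[OF AE_good] by (rule AE_mp) auto
  qed (use H sets_Hole_good[OF r] in auto)
  also have "\<dots> = emeasure M (?H \<inter> good)"
    using sets_Hole_good[OF r] by (simp add: emeasure_completion)
  finally show ?thesis by (simp add: hole_prob_def measure_def)
qed

end

section \<open>Hole events are rare\<close>

lemma inverse_one_minus_le_exp:
  fixes u :: real
  assumes "0 \<le> u" "u \<le> 1/2"
  shows "1 / (1 - u) \<le> exp (2 * u)"
proof -
  have "- (2 * u) \<le> - u - 2 * u\<^sup>2"
    using mult_left_mono[OF assms(2,1)] by (simp add: power2_eq_square)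
  also have "\<dots> \<le> ln (1 - u)" using ln_one_minus_pos_lower_bound[OF assms] .
  finally have "exp (- (2 * u)) \<le> 1 - u" using assms by (simp add: ln_ge_iff)
  then show ?thesis using assms by (simp add: exp_minus field_simps)
qed

section \<open>Exponential bounds for the exceptional events\<close>

context gaussian_coefficients
begin

text \<open>Chernoff's method: on the event, exp(N) exp(- \<alpha> sum) is at least 1 for \<alpha> =
  N/t, the value that minimises exp(\<alpha> t) / \<alpha>^N. For \<tau> and t of order sqrt(N) the
  base of the power does not depend on N.\<close>

lemma prob_sqrt_coeff_small:
  assumes \<tau>: "0 < \<tau>" and t: "0 < t" and N: "0 < N"
  shows "prob {\<omega> \<in> space M. \<zeta> 0 \<omega> \<noteq> 0 \<and> cmod (\<zeta> 0 \<omega>) \<le> \<tau> \<and> (\<Sum>k=1..N. (cmod (sqrt_coeff (coeffs \<omega>) k))\<^sup>2) \<le> t}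
    \<le> (exp 1 * (4 * C * \<tau> * t / (real N * c\<^sup>2))) ^ N"
proof -
  define \<alpha> where "\<alpha> = real N / t"
  have \<alpha>: "0 < \<alpha>" using t N by (simp add: \<alpha>_def)
  define A where "A = {z :: complex. z \<noteq> 0 \<and> cmod z \<le> \<tau>}"
  have A [measurable]: "A \<in> sets borel" unfolding A_def by measurable
  define s where "s x = sqrt_coeff (\<lambda>n. x n * complex_of_real (a n))" for x
  define f where "f x = indicator A (x 0) * ennreal (exp (- \<alpha> * (\<Sum>k=1..N. (cmod (s x k))\<^sup>2)))" for x
  have [measurable]: "(\<lambda>x. s x k) \<in> borel_measurable (gauss_PiM {..N})" if "k \<le> N" for k
    unfolding s_def using that by (rule borel_measurable_gauss_sqrt_coeff)
  have [measurable]: "(\<lambda>x. x 0) \<in> borel_measurable (gauss_PiM {..N})"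
    using measurable_component_singleton[of 0 "{..N}" "\<lambda>_. gauss"] by (simp cong: measurable_cong_sets)
  have fm: "f \<in> borel_measurable (gauss_PiM {..N})"
    unfolding f_def by measurable
  have sc: "s (\<lambda>i\<in>{..N}. \<zeta> i \<omega>) k = sqrt_coeff (coeffs \<omega>) k" if "k \<le> N" for \<omega> k
    unfolding s_def using that by (intro sqrt_coeff_cong) (auto simp: coeffs_def)
  have [measurable]: "(\<lambda>\<omega>. sqrt_coeff (coeffs \<omega>) k) \<in> borel_measurable M" for k
    unfolding coeffs_def by (rule borel_measurable_sqrt_coeff) measurable
  let ?E = "{\<omega> \<in> space M. \<zeta> 0 \<omega> \<noteq> 0 \<and> cmod (\<zeta> 0 \<omega>) \<le> \<tau> \<and> (\<Sum>k=1..N. (cmod (sqrt_coeff (coeffs \<omega>) k))\<^sup>2) \<le> t}"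
  have "ennreal (prob ?E) = (\<integral>\<^sup>+\<omega>. indicator ?E \<omega> \<partial>M)"
    by (subst nn_integral_indicator) (auto simp: emeasure_eq_measure)
  also have "\<dots> \<le> (\<integral>\<^sup>+\<omega>. ennreal (exp (real N)) * f (\<lambda>i\<in>{..N}. \<zeta> i \<omega>) \<partial>M)"
  proof (intro nn_integral_mono)
    fix \<omega>
    show "indicator ?E \<omega> \<le> ennreal (exp (real N)) * f (\<lambda>i\<in>{..N}. \<zeta> i \<omega>)"
    proof (cases "\<omega> \<in> ?E")
      case True
      have "(\<Sum>k=1..N. (cmod (s (\<lambda>i\<in>{..N}. \<zeta> i \<omega>) k))\<^sup>2) = (\<Sum>k=1..N. (cmod (sqrt_coeff (coeffs \<omega>) k))\<^sup>2)"
        by (intro sum.cong refl) (simp add: sc)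
      also have "\<dots> \<le> t" using True by simp
      finally have "\<alpha> * (\<Sum>k=1..N. (cmod (s (\<lambda>i\<in>{..N}. \<zeta> i \<omega>) k))\<^sup>2) \<le> \<alpha> * t"
        using \<alpha> by (intro mult_left_mono) auto
      also have "\<alpha> * t = real N" using t by (simp add: \<alpha>_def)
      finally have "1 \<le> exp (real N) * exp (- \<alpha> * (\<Sum>k=1..N. (cmod (s (\<lambda>i\<in>{..N}. \<zeta> i \<omega>) k))\<^sup>2))"
        by (simp flip: exp_add)
      then have "1 \<le> ennreal (exp (real N) * exp (- \<alpha> * (\<Sum>k=1..N. (cmod (s (\<lambda>i\<in>{..N}. \<zeta> i \<omega>) k))\<^sup>2)))"
        by simp
      moreover have "\<zeta> 0 \<omega> \<in> A" using True by (simp add: A_def)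
      ultimately show ?thesis using True by (simp add: f_def ennreal_mult)
    qed simp
  qed
  also have "\<dots> = ennreal (exp (real N)) * (\<integral>\<^sup>+\<omega>. f (\<lambda>i\<in>{..N}. \<zeta> i \<omega>) \<partial>M)"
    by (intro nn_integral_cmult measurable_compose[OF measurable_\<zeta>_restrict fm])
  also have "\<dots> = ennreal (exp (real N)) * (\<integral>\<^sup>+x. f x \<partial>gauss_PiM {..N})"
    by (subst nn_integral_\<zeta>_restrict[OF fm]) auto
  also have "\<dots> \<le> ennreal (exp (real N)) * ennreal ((4 * C * \<tau> / (\<alpha> * c\<^sup>2)) ^ N)"
    unfolding f_def s_def A_def
    using nn_integral_gauss_sqrt_coeff[OF c_pos a_ge a_le \<alpha> \<tau>, of N] by (intro mult_left_mono) auto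
  also have "\<dots> = ennreal ((exp 1 * (4 * C * \<tau> * t / (real N * c\<^sup>2))) ^ N)"
  proof -
    have "4 * C * \<tau> / (\<alpha> * c\<^sup>2) = 4 * C * \<tau> * t / (real N * c\<^sup>2)" using t by (simp add: \<alpha>_def)
    moreover have "exp (real N) = exp 1 ^ N" by (simp flip: exp_of_nat_mult)
    ultimately show ?thesis by (simp only: power_mult_distrib ennreal_mult'[symmetric] exp_ge_zero zero_le_power)
  qed
  finally show ?thesis
    using C_pos \<tau> t by (subst (asm) ennreal_le_iff) auto
qed

text \<open>Exponential Markov inequality with parameter 1/2. By independence the moment is a
  product, and since each weight is at most 1, each factor 1 / (1 - b n / 2) is at most exp(b
  n).\<close>

lemma prob_weighted_squares:
  assumes b: "\<And>n. 0 \<le> b n" "\<And>n. b n \<le> 1"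
  shows "prob {\<omega> \<in> space M. y < (\<Sum>n\<le>N. b n * (cmod (\<zeta> n \<omega>))\<^sup>2)} \<le> exp ((\<Sum>n\<le>N. b n) - y / 2)"
proof -
  let ?S = "\<lambda>\<omega>. \<Sum>n\<le>N. b n * (cmod (\<zeta> n \<omega>))\<^sup>2"
  let ?g = "\<lambda>n z. ennreal (exp (b n / 2 * (cmod z)\<^sup>2))"
  have gm: "(\<lambda>x. \<Prod>n\<le>N. ?g n (x n)) \<in> borel_measurable (gauss_PiM {..N})"
    by measurable
  have "ennreal (exp (y / 2)) * emeasure M {\<omega> \<in> space M. y < ?S \<omega>}
      = (\<integral>\<^sup>+\<omega>. ennreal (exp (y / 2)) * indicator {\<omega> \<in> space M. y < ?S \<omega>} \<omega> \<partial>M)"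
    by (subst nn_integral_cmult_indicator) auto
  also have "\<dots> \<le> (\<integral>\<^sup>+\<omega>. (\<Prod>n\<le>N. ?g n ((\<lambda>i\<in>{..N}. \<zeta> i \<omega>) n)) \<partial>M)"
  proof (intro nn_integral_mono)
    fix \<omega>
    have "(\<Prod>n\<le>N. ?g n ((\<lambda>i\<in>{..N}. \<zeta> i \<omega>) n)) = ennreal (\<Prod>n\<le>N. exp (b n / 2 * (cmod (\<zeta> n \<omega>))\<^sup>2))"
      by (simp add: prod_ennreal)
    also have "(\<Prod>n\<le>N. exp (b n / 2 * (cmod (\<zeta> n \<omega>))\<^sup>2)) = exp (?S \<omega> / 2)"
      by (simp add: sum_divide_distrib flip: exp_sum)
    finally show "ennreal (exp (y / 2)) * indicator {\<omega> \<in> space M. y < ?S \<omega>} \<omega> \<le> (\<Prod>n\<le>N. ?g n ((\<lambda>i\<in>{..N}. \<zeta> i \<omega>) n))"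
      by (auto simp: indicator_def intro!: ennreal_leI)
  qed
  also have "\<dots> = (\<integral>\<^sup>+x. (\<Prod>n\<le>N. ?g n (x n)) \<partial>gauss_PiM {..N})"
    by (rule nn_integral_\<zeta>_restrict[OF gm]) auto
  also have "\<dots> = (\<Prod>n\<le>N. \<integral>\<^sup>+z. ?g n z \<partial>gauss)"
    by (rule gauss_PiM.product_nn_integral_prod) (auto cong: measurable_cong_sets)
  also have "\<dots> = (\<Prod>n\<le>N. ennreal (1 / (1 - b n / 2)))"
    using b(2) by (intro prod.cong refl nn_integral_gauss_exp) (simp add: order_le_less_trans[of _ 1])
  also have "\<dots> = ennreal (\<Prod>n\<le>N. 1 / (1 - b n / 2))"
    using b(2) by (intro prod_ennreal) (simp add: order_trans[of _ 1])
  also have "\<dots> \<le> ennreal (\<Prod>n\<le>N. exp (b n))"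
  proof (intro ennreal_leI prod_mono conjI)
    fix n
    show "0 \<le> 1 / (1 - b n / 2)" using b(2)[of n] by simp
    show "1 / (1 - b n / 2) \<le> exp (b n)"
      using inverse_one_minus_le_exp[of "b n / 2"] b[of n] by simp
  qed
  also have "\<dots> = ennreal (exp (\<Sum>n\<le>N. b n))"
    by (simp add: exp_sum)
  finally have "exp (y / 2) * prob {\<omega> \<in> space M. y < ?S \<omega>} \<le> exp (\<Sum>n\<le>N. b n)"
    by (simp add: emeasure_eq_measure flip: ennreal_mult')
  then have "prob {\<omega> \<in> space M. y < ?S \<omega>} \<le> exp (\<Sum>n\<le>N. b n) / exp (y / 2)"
    by (subst pos_le_divide_eq) (auto simp: mult.commute)
  then show ?thesis by (simp only: exp_diff)
qed

text \<open>The events for the partial sums increase with N and have uniformly bounded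
  probabilities. Quantifying over N avoids assigning a value to a divergent series.\<close>

lemma prob_square_series:
  assumes r: "0 < r" "r < 1"
  shows "prob {\<omega> \<in> space M. \<exists>N. y < (\<Sum>n\<le>N. r ^ (2 * n) * (cmod (\<zeta> n \<omega>))\<^sup>2)} \<le> exp (1 / (1 - r) - y / 2)"
proof -
  define A where "A N = {\<omega> \<in> space M. y < (\<Sum>n\<le>N. r ^ (2 * n) * (cmod (\<zeta> n \<omega>))\<^sup>2)}" for N
  have "prob (A N) \<le> exp (1 / (1 - r) - y / 2)" for N
  proof -
    have "prob (A N) \<le> exp ((\<Sum>n\<le>N. r ^ (2 * n)) - y / 2)"
      unfolding A_def using r by (intro prob_weighted_squares) (auto intro: power_le_one)
    also have "(\<Sum>n\<le>N. r ^ (2 * n)) \<le> (\<Sum>n\<le>N. r ^ n)"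
      using r by (intro sum_mono power_decreasing) auto
    also have "\<dots> \<le> (\<Sum>n. r ^ n)"
      using r by (intro sum_le_suminf summable_geometric) auto
    also have "\<dots> = 1 / (1 - r)" using r by (intro suminf_geometric) auto
    finally show ?thesis by simp
  qed
  moreover have "(\<lambda>N. prob (A N)) \<longlonglongrightarrow> prob (\<Union>N. A N)"
  proof (rule finite_Lim_measure_incseq)
    show "range A \<subseteq> events" unfolding A_def by auto
    have "A N \<subseteq> A (Suc N)" for N
    proof
      fix \<omega> assume "\<omega> \<in> A N"
      moreover have "0 \<le> r ^ (2 * Suc N) * (cmod (\<zeta> (Suc N) \<omega>))\<^sup>2" using r by simp
      ultimately show "\<omega> \<in> A (Suc N)" unfolding A_def sum.atMost_Suc mem_Collect_eq by linarith
    qed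
    then show "incseq A" by (rule incseq_SucI)
  qed
  ultimately have "prob (\<Union>N. A N) \<le> exp (1 / (1 - r) - y / 2)"
    by (intro LIMSEQ_le_const2) auto
  moreover have "(\<Union>N. A N) = {\<omega> \<in> space M. \<exists>N. y < (\<Sum>n\<le>N. r ^ (2 * n) * (cmod (\<zeta> n \<omega>))\<^sup>2)}"
    by (auto simp: A_def)
  ultimately show ?thesis by simp
qed

text \<open>All weights r^(4k) are replaced by the smallest one. The resulting loss r^(-4N) stays
  bounded when N is of order 1 / (1 - r).\<close>

lemma Hole_sqrt_coeff_le:
  assumes r: "0 < r" "r < 1" and \<omega>: "\<omega> \<in> Hole M a \<zeta> r \<inter> good"
    and y: "\<And>N. (\<Sum>n\<le>N. r ^ (2 * n) * (cmod (\<zeta> n \<omega>))\<^sup>2) \<le> y"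
  shows "(\<Sum>k=1..N. (cmod (sqrt_coeff (coeffs \<omega>) k))\<^sup>2) \<le> C * sqrt y / r ^ (4 * N)"
proof -
  have "(\<Sum>k=1..N. (cmod (sqrt_coeff (coeffs \<omega>) k))\<^sup>2) * r ^ (4 * N)
      \<le> (\<Sum>k\<le>N. (cmod (sqrt_coeff (coeffs \<omega>) k))\<^sup>2) * r ^ (4 * N)"
    using r by (intro mult_right_mono sum_mono2) auto
  also have "\<dots> \<le> (\<Sum>k\<le>N. (cmod (sqrt_coeff (coeffs \<omega>) k))\<^sup>2 * r ^ (4 * k))"
    unfolding sum_distrib_right using r by (intro sum_mono mult_left_mono power_decreasing) auto
  also have "\<dots> \<le> sqrt (\<Sum>n. (cmod (coeffs \<omega> n))\<^sup>2 * r ^ (2 * n))"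
  proof (rule sum_sqrt_coeff_le[OF r])
    show "summable (\<lambda>n. cmod (coeffs \<omega> n) * \<rho> ^ n)" if "0 < \<rho>" "\<rho> < 1" for \<rho>
      using \<omega> that by (intro summable_coeffs) auto
    show "(\<Sum>n. coeffs \<omega> n * z ^ n) \<noteq> 0" if "cmod z \<le> r" for z
      using \<omega> that by (auto simp: Hole_def F_eq)
  qed
  also have "\<dots> \<le> sqrt (C\<^sup>2 * y)"
  proof (rule real_sqrt_le_mono)
    have p: "(\<Sum>n\<le>N. (cmod (coeffs \<omega> n))\<^sup>2 * r ^ (2 * n)) \<le> C\<^sup>2 * y" for N
    proof -
      have "(cmod (coeffs \<omega> n))\<^sup>2 * r ^ (2 * n) \<le> C\<^sup>2 * (r ^ (2 * n) * (cmod (\<zeta> n \<omega>))\<^sup>2)" for n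
      proof -
        have "(cmod (coeffs \<omega> n))\<^sup>2 \<le> (C * cmod (\<zeta> n \<omega>))\<^sup>2"
          by (intro power_mono norm_coeffs_le) auto
        then have "(cmod (coeffs \<omega> n))\<^sup>2 * r ^ (2 * n) \<le> (C * cmod (\<zeta> n \<omega>))\<^sup>2 * r ^ (2 * n)"
          using r by (intro mult_right_mono) auto
        then show ?thesis by (simp add: power_mult_distrib mult_ac)
      qed
      then have "(\<Sum>n\<le>N. (cmod (coeffs \<omega> n))\<^sup>2 * r ^ (2 * n)) \<le> (\<Sum>n\<le>N. C\<^sup>2 * (r ^ (2 * n) * (cmod (\<zeta> n \<omega>))\<^sup>2))"
        by (rule sum_mono)
      also have "\<dots> \<le> C\<^sup>2 * y" unfolding sum_distrib_left[symmetric] by (intro mult_left_mono y) auto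
      finally show ?thesis .
    qed
    have "summable (\<lambda>n. (cmod (coeffs \<omega> n))\<^sup>2 * r ^ (2 * n))"
      by (rule bounded_imp_summable[OF _ p]) (use r in auto)
    then show "(\<Sum>n. (cmod (coeffs \<omega> n))\<^sup>2 * r ^ (2 * n)) \<le> C\<^sup>2 * y"
    proof (rule suminf_le_const)
      fix N
      have "(\<Sum>n<N. (cmod (coeffs \<omega> n))\<^sup>2 * r ^ (2 * n)) \<le> (\<Sum>n\<le>N. (cmod (coeffs \<omega> n))\<^sup>2 * r ^ (2 * n))"
        using r by (intro sum_mono2) auto
      then show "(\<Sum>n<N. (cmod (coeffs \<omega> n))\<^sup>2 * r ^ (2 * n)) \<le> C\<^sup>2 * y"
        using p[of N] by linarith
    qed
  qed
  also have "\<dots> = C * sqrt y" using C_pos by (simp add: real_sqrt_mult)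
  finally show ?thesis using r by (simp add: field_simps)
qed


text \<open>A hole forces one of three events: a large \<open>\<zeta> 0\<close>, a large square sum,
  or small root coefficients in spite of a small \<open>\<zeta> 0\<close>. Their bounds carry the
  prefactors 2, 1 and 1.\<close>

lemma Hole_upper_bound:
  obtains \<kappa> where "0 < \<kappa>" "\<And>r. 1 / 2 \<le> r \<Longrightarrow> r < 1 \<Longrightarrow> prob (Hole M a \<zeta> r \<inter> good) \<le> 4 * exp (- \<kappa> / (1 - r))"
proof -
  \<comment> \<open>Chosen so that the base of the N-th power below is at most 16 exp 9 C^2 \<eta> /
    c^2 = exp(-1).\<close>
  define \<eta> where "\<eta> = c\<^sup>2 / (16 * exp 10 * C\<^sup>2)"
  have cC: "c \<le> C" using a_ge[of 0] a_le[of 0] by linarith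
  have \<eta>0: "0 < \<eta>" using c_pos C_pos by (simp add: \<eta>_def)
  have \<eta>1: "\<eta> \<le> 1"
  proof -
    have "c\<^sup>2 \<le> C\<^sup>2" using cC c_pos by (intro power_mono) auto
    also have "\<dots> \<le> (16 * exp 10) * C\<^sup>2"
    proof -
      have "1 \<le> 16 * exp (10::real)" using one_le_exp_iff[of "10::real"] by linarith
      from mult_right_mono[OF this, of "C\<^sup>2"] show ?thesis by simp
    qed
    finally show ?thesis using C_pos by (simp add: \<eta>_def)
  qed
  \<comment> \<open>The tail of \<open>\<zeta> 0\<close> beyond \<eta> / sqrt(\<delta>) decays at
    exactly this rate; the other two events decay at least at rate 1/2.\<close>
  define \<kappa> where "\<kappa> = \<eta>\<^sup>2 / 2"
  have \<kappa>: "\<kappa> \<le> 1/2" using \<eta>0 \<eta>1 by (simp add: \<kappa>_def power_le_one)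
  have "prob (Hole M a \<zeta> r \<inter> good) \<le> 4 * exp (- \<kappa> / (1 - r))" if r: "1 / 2 \<le> r" "r < 1" for r
  proof -
    define \<delta> where "\<delta> = 1 - r"
    have \<delta>: "0 < \<delta>" "\<delta> \<le> 1/2" using r by (auto simp: \<delta>_def)
    define N where "N = nat \<lfloor>1 / \<delta>\<rfloor>"
    have d2: "2 \<le> 1 / \<delta>" using \<delta> by (simp add: field_simps)
    have N1: "real N \<le> 1 / \<delta>" "1 / \<delta> - 1 \<le> real N" using d2 unfolding N_def by linarith+
    have N2: "1 / (2 * \<delta>) \<le> real N"
    proof -
      have "1 / (2 * \<delta>) = 1 / \<delta> / 2" by simp
      then show ?thesis using N1 d2 by linarith
    qed
    have N0: "0 < N" using N1 d2 by linarith
    \<comment> \<open>Twice the value that balances the mean: the exponent 1/\<delta> - y/2 becomes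
      -1/\<delta>.\<close>
    define y where "y = 4 / \<delta>"
    define \<tau> where "\<tau> = \<eta> / sqrt \<delta>"
    define t where "t = 2 * C * exp 8 / sqrt \<delta>"
    \<comment> \<open>From 1/r \<le> exp(2 \<delta>) and N \<delta> \<le> 1; the same factor exp 8
      appears in \<open>t\<close>, which is C sqrt(y) exp 8.\<close>
    have r4N: "1 / r ^ (4 * N) \<le> exp 8"
    proof -
      have "1 / r \<le> exp (2 * \<delta>)"
        using inverse_one_minus_le_exp[of \<delta>] \<delta> by (simp add: \<delta>_def)
      then have "(1 / r) ^ (4 * N) \<le> exp (2 * \<delta>) ^ (4 * N)" using r by (intro power_mono) auto
      also have "\<dots> = exp (8 * (\<delta> * real N))" by (simp add: algebra_simps flip: exp_of_nat_mult)
      also have "\<dots> \<le> exp 8" using N1 \<delta> by (simp add: field_simps)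
      finally show ?thesis by (simp add: power_one_over)
    qed
    have ty: "C * sqrt y / r ^ (4 * N) \<le> t"
    proof -
      have "C * sqrt y / r ^ (4 * N) = C * sqrt y * (1 / r ^ (4 * N))" by simp
      also have "\<dots> \<le> C * sqrt y * exp 8"
        using r4N C_pos \<delta> by (intro mult_left_mono) (auto simp: y_def)
      also have "\<dots> = t" by (simp add: t_def y_def real_sqrt_divide)
      finally show ?thesis .
    qed
    let ?E1 = "{\<omega> \<in> space M. \<zeta> 0 \<omega> \<in> {z. \<tau> < cmod z}}"
    let ?E2 = "{\<omega> \<in> space M. \<exists>N. y < (\<Sum>n\<le>N. r ^ (2 * n) * (cmod (\<zeta> n \<omega>))\<^sup>2)}"
    let ?E3 = "{\<omega> \<in> space M. \<zeta> 0 \<omega> \<noteq> 0 \<and> cmod (\<zeta> 0 \<omega>) \<le> \<tau> \<and> (\<Sum>k=1..N. (cmod (sqrt_coeff (coeffs \<omega>) k))\<^sup>2) \<le> t}"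
    have [measurable]: "(\<lambda>\<omega>. sqrt_coeff (coeffs \<omega>) k) \<in> borel_measurable M" for k
      unfolding coeffs_def by (rule borel_measurable_sqrt_coeff) measurable
    have E: "?E1 \<in> events" "?E2 \<in> events" "?E3 \<in> events" by measurable
    have "Hole M a \<zeta> r \<inter> good \<subseteq> ?E1 \<union> ?E2 \<union> ?E3"
    proof
      fix \<omega> assume \<omega>: "\<omega> \<in> Hole M a \<zeta> r \<inter> good"
      then have sp: "\<omega> \<in> space M" by (simp add: Hole_def)
      have "F \<omega> 0 \<noteq> 0" using \<omega> r by (auto simp: Hole_def)
      then have z0: "\<zeta> 0 \<omega> \<noteq> 0" unfolding F_eq powser_zero by (simp add: coeffs_def)
      show "\<omega> \<in> ?E1 \<union> ?E2 \<union> ?E3"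
      proof (rule ccontr)
        assume n: "\<omega> \<notin> ?E1 \<union> ?E2 \<union> ?E3"
        then have "(\<Sum>n\<le>N. r ^ (2 * n) * (cmod (\<zeta> n \<omega>))\<^sup>2) \<le> y" for N
          using sp by (auto simp: not_less)
        then have "(\<Sum>k=1..N. (cmod (sqrt_coeff (coeffs \<omega>) k))\<^sup>2) \<le> C * sqrt y / r ^ (4 * N)"
          using r by (intro Hole_sqrt_coeff_le[OF _ _ \<omega>]) auto
        then have "(\<Sum>k=1..N. (cmod (sqrt_coeff (coeffs \<omega>) k))\<^sup>2) \<le> t" using ty by linarith
        then show False using n sp z0 by auto
      qed
    qed
    then have "prob (Hole M a \<zeta> r \<inter> good) \<le> prob (?E1 \<union> ?E2 \<union> ?E3)"
      using E by (intro finite_measure_mono) auto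
    also have "\<dots> \<le> prob ?E1 + prob ?E2 + prob ?E3"
      using measure_Un_le[of "?E1 \<union> ?E2" M ?E3] measure_Un_le[of ?E1 M ?E2] E by auto
    also have "prob ?E1 \<le> 2 * exp (- \<kappa> / \<delta>)"
    proof -
      have "prob ?E1 = measure gauss {z. \<tau> < cmod z}" by (rule prob_\<zeta>) measurable
      also have "\<dots> \<le> 2 * exp (- \<tau>\<^sup>2 / 2)"
        using \<eta>0 \<delta> by (intro measure_gauss_tail_le) (simp add: \<tau>_def)
      also have "- \<tau>\<^sup>2 / 2 = - \<kappa> / \<delta>" using \<delta> by (simp add: \<tau>_def \<kappa>_def power_divide)
      finally show ?thesis .
    qed
    also have "prob ?E2 \<le> exp (- \<kappa> / \<delta>)"
    proof -
      have "prob ?E2 \<le> exp (1 / (1 - r) - y / 2)" using r by (intro prob_square_series) auto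
      also have "1 / (1 - r) - y / 2 = - 1 / \<delta>" 
        unfolding \<delta>_def[symmetric] y_def by (simp add: diff_divide_distrib[symmetric])
      also have "exp (- 1 / \<delta>) \<le> exp (- \<kappa> / \<delta>)" using \<delta> \<kappa> by (simp add: divide_right_mono)
      finally show ?thesis .
    qed
    also have "prob ?E3 \<le> exp (- \<kappa> / \<delta>)"
    proof -
      have "0 < \<tau>" "0 < t" using \<eta>0 C_pos \<delta> by (auto simp: \<tau>_def t_def)
      then have "prob ?E3 \<le> (exp 1 * (4 * C * \<tau> * t / (real N * c\<^sup>2))) ^ N"
        using N0 by (intro prob_sqrt_coeff_small)
      also have "exp 1 * (4 * C * \<tau> * t / (real N * c\<^sup>2)) \<le> exp (- 1)"
      proof -
        have e9: "exp 1 * exp 8 = exp (9::real)" "exp 10 = exp 9 * exp (1::real)" by (simp_all flip: exp_add)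
        have "\<tau> * t = 2 * C * exp 8 * \<eta> / \<delta>" using \<delta> by (simp add: \<tau>_def t_def)
        then have "exp 1 * (4 * C * \<tau> * t / (real N * c\<^sup>2)) = exp 1 * (4 * C * (2 * C * exp 8 * \<eta> / \<delta>) / (real N * c\<^sup>2))"
          by (simp add: mult.assoc)
        also have "\<dots> = 8 * (exp 1 * exp 8) * C\<^sup>2 * \<eta> / c\<^sup>2 * (1 / (\<delta> * real N))"
          by (simp add: power2_eq_square field_simps)
        also have "\<dots> \<le> 8 * (exp 1 * exp 8) * C\<^sup>2 * \<eta> / c\<^sup>2 * 2"
        proof (rule mult_left_mono)
          have "1 / 2 \<le> \<delta> * real N" using N2 \<delta> by (simp add: field_simps)
          then show "1 / (\<delta> * real N) \<le> 2" using \<delta> N0 by (simp add: field_simps)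
        qed (use \<eta>0 in simp)
        also have "\<dots> = exp 9 / exp 10"
          unfolding e9(1) using c_pos C_pos by (simp add: \<eta>_def)
        also have "\<dots> = exp (- 1)" by (simp flip: exp_diff)
        finally show ?thesis .
      qed
      then have "(exp 1 * (4 * C * \<tau> * t / (real N * c\<^sup>2))) ^ N \<le> exp (- 1) ^ N"
        using \<open>0 < \<tau>\<close> \<open>0 < t\<close> C_pos by (intro power_mono) auto
      also have "\<dots> = exp (- real N)" by (simp flip: exp_of_nat_mult)
      also have "\<dots> \<le> exp (- \<kappa> / \<delta>)"
      proof -
        have "\<kappa> / \<delta> \<le> (1/2) / \<delta>" using \<kappa> \<delta> by (intro divide_right_mono) auto
        also have "\<dots> \<le> real N" using N2 by simp
        finally show ?thesis by simp
      qed
      finally show ?thesis .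
    qed
    finally show ?thesis by (simp add: \<delta>_def)
  qed
  moreover have "0 < \<kappa>" using \<eta>0 by (simp add: \<kappa>_def)
  ultimately show thesis using that by blast
qed

text \<open>If \<open>|\<zeta> 0|\<close> is small and \<open>|\<zeta> 1| \<ge> 1\<close>, while the series is moderate, the first coefficient of a
  square root would be too large; so the hole event at radius \<open>1/2\<close> is not almost sure.\<close>

lemma Hole_half_less_1: "prob (Hole M a \<zeta> (1/2) \<inter> good) < 1"
proof -
  define p where "p = measure gauss {z. 1 \<le> cmod z}"
  have p: "0 < p" "p \<le> 1"
    using measure_gauss_tail_ge[of 1] gauss.prob_le_1 by (auto simp: p_def intro: less_le_trans[rotated])
  \<comment> \<open>Solves exp(2 - y/2) = p/2, so the square sum exceeds \<open>y\<close> with at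
    most half the probability of |\<open>\<zeta> 1\<close>| \<ge> 1.\<close>
  define y where "y = 2 * (2 - ln (p / 2))"
  have y0: "0 < y"
  proof -
    have "ln (p / 2) < 0" using p by (subst ln_less_zero_iff) auto
    then show ?thesis by (simp add: y_def)
  qed
  \<comment> \<open>The minimum with 1 keeps the contribution of \<open>\<zeta> 0\<close> to the
    square sum below 1, hence y + 1. The other term turns the final inequality into c^2 \<le> c^2 /
    2.\<close>
  define \<epsilon> where "\<epsilon> = min 1 (c\<^sup>2 / (128 * C\<^sup>2 * sqrt (y + 1)))"
  have \<epsilon>: "0 < \<epsilon>" "\<epsilon> \<le> 1" using c_pos C_pos y0 by (auto simp: \<epsilon>_def)
  let ?S = "\<lambda>N x. \<Sum>n\<in>{1..N}. (1/2) ^ (2 * n) * (cmod (x n))\<^sup>2"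
  \<comment> \<open>Only indices from 1 on occur, so this event is independent of
    \<open>\<zeta> 0\<close> although it restricts infinitely many variables.\<close>
  define W where "W = {x \<in> space (gauss_PiM {1..}). 1 \<le> cmod (x 1) \<and> (\<forall>N. ?S N x \<le> y)}"
  have xm [measurable]: "(\<lambda>x. x n) \<in> borel_measurable (gauss_PiM {1..})" if "n \<in> {1..}" for n
    using measurable_component_singleton[of n "{1..}" "\<lambda>_. gauss"] that by (simp cong: measurable_cong_sets)
  have W: "W \<in> sets (gauss_PiM {1..})"
  proof -
    have [measurable]: "?S N \<in> borel_measurable (gauss_PiM {1..})" for N
    proof (rule borel_measurable_sum)
      fix n assume "n \<in> {1..N}"
      then have [measurable]: "(\<lambda>x. x n) \<in> borel_measurable (gauss_PiM {1..})" by (intro xm) auto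
      show "(\<lambda>x. (1/2) ^ (2 * n) * (cmod (x n))\<^sup>2) \<in> borel_measurable (gauss_PiM {1..})" by measurable
    qed
    show ?thesis unfolding W_def by measurable
  qed
  let ?B = "{\<omega> \<in> space M. \<zeta> 0 \<omega> \<in> {z. cmod z \<le> \<epsilon>} \<and> (\<lambda>i\<in>{1..}. \<zeta> i \<omega>) \<in> W}"
  let ?E = "{\<omega> \<in> space M. (\<lambda>i\<in>{1..}. \<zeta> i \<omega>) \<in> W}"
  have memW: "(\<lambda>i\<in>{1..}. \<zeta> i \<omega>) \<in> W \<longleftrightarrow> 1 \<le> cmod (\<zeta> 1 \<omega>) \<and> (\<forall>N. ?S N (\<lambda>n. \<zeta> n \<omega>) \<le> y)" for \<omega>
    by (simp add: W_def space_PiM)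
  have "p - p / 2 \<le> prob ?E"
  proof -
    let ?U = "{\<omega> \<in> space M. \<zeta> 1 \<omega> \<in> {z. 1 \<le> cmod z}}"
    let ?V = "{\<omega> \<in> space M. \<exists>N. y < (\<Sum>n\<le>N. (1/2) ^ (2 * n) * (cmod (\<zeta> n \<omega>))\<^sup>2)}"
    have ev: "?U \<in> events" "?V \<in> events" by measurable
    have "prob ?V \<le> exp (1 / (1 - 1/2) - y / 2)" by (rule prob_square_series) auto
    also have "1 / (1 - 1/2) - y / 2 = ln (p / 2)" by (simp add: y_def diff_divide_distrib)
    also have "exp (ln (p / 2)) = p / 2" using p by simp
    finally have V: "prob ?V \<le> p / 2" .
    have U: "prob ?U = p" unfolding p_def by (rule prob_\<zeta>) measurable
    have "?U - ?V \<subseteq> ?E"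
    proof
      fix \<omega> assume \<omega>: "\<omega> \<in> ?U - ?V"
      have "?S N (\<lambda>n. \<zeta> n \<omega>) \<le> y" for N
      proof -
        have "?S N (\<lambda>n. \<zeta> n \<omega>) \<le> (\<Sum>n\<le>N. (1/2) ^ (2 * n) * (cmod (\<zeta> n \<omega>))\<^sup>2)"
          by (intro sum_mono2) auto
        then show ?thesis using \<omega> by (auto simp: not_less intro: order_trans)
      qed
      then show "\<omega> \<in> ?E" using \<omega> unfolding mem_Collect_eq memW by auto
    qed
    moreover have "?E \<in> events"
      using measurable_sets[OF measurable_\<zeta>_restrict W] by (simp add: vimage_def Int_def conj_commute)
    ultimately have "prob (?U - ?V) \<le> prob ?E" by (intro finite_measure_mono) auto
    moreover have "prob ?U - prob ?V \<le> prob (?U - ?V)"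
      using finite_measure_Diff'[OF ev] finite_measure_mono[of "?U \<inter> ?V" ?V] ev by auto
    ultimately show ?thesis using U V by linarith
  qed
  then have E0: "0 < prob ?E" using p by linarith
  have "prob ?B = prob {\<omega> \<in> space M. \<zeta> 0 \<omega> \<in> {z. cmod z \<le> \<epsilon>}} * prob ?E"
    using W by (intro prob_\<zeta>0_independent) auto
  also have "prob {\<omega> \<in> space M. \<zeta> 0 \<omega> \<in> {z. cmod z \<le> \<epsilon>}} = measure gauss {z. cmod z \<le> \<epsilon>}"
    by (rule prob_\<zeta>) measurable
  finally have PB: "prob ?B = measure gauss {z. cmod z \<le> \<epsilon>} * prob ?E" .
  have B0: "0 < prob ?B"
    unfolding PB by (rule mult_pos_pos[OF measure_gauss_ball_pos[OF \<epsilon>(1)] E0])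
  have Bm: "?B \<in> events"
  proof -
    have "?E \<in> events"
      using measurable_sets[OF measurable_\<zeta>_restrict W] by (simp add: vimage_def Int_def conj_commute)
    moreover have "?B = {\<omega> \<in> space M. \<zeta> 0 \<omega> \<in> {z. cmod z \<le> \<epsilon>}} \<inter> ?E" by auto
    ultimately show ?thesis by simp
  qed
  have "Hole M a \<zeta> (1/2) \<inter> good \<subseteq> space M - ?B"
  proof
    fix \<omega> assume \<omega>: "\<omega> \<in> Hole M a \<zeta> (1/2) \<inter> good"
    show "\<omega> \<in> space M - ?B"
    proof (rule ccontr)
      assume "\<omega> \<notin> space M - ?B"
      then have z0: "cmod (\<zeta> 0 \<omega>) \<le> \<epsilon>" and z1: "1 \<le> cmod (\<zeta> 1 \<omega>)" and S: "\<And>N. ?S N (\<lambda>n. \<zeta> n \<omega>) \<le> y"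
        using \<omega> unfolding Diff_iff mem_Collect_eq memW by (auto simp: Hole_def)
      have "F \<omega> 0 \<noteq> 0" using \<omega> by (auto simp: Hole_def)
      then have z0n: "\<zeta> 0 \<omega> \<noteq> 0" unfolding F_eq powser_zero by (simp add: coeffs_def)
      have "(\<Sum>n\<le>N. (1/2) ^ (2 * n) * (cmod (\<zeta> n \<omega>))\<^sup>2) \<le> y + 1" for N
      proof -
        have "{..N} = insert 0 {1..N}" by auto
        then have "(\<Sum>n\<le>N. (1/2) ^ (2 * n) * (cmod (\<zeta> n \<omega>))\<^sup>2) = (cmod (\<zeta> 0 \<omega>))\<^sup>2 + ?S N (\<lambda>n. \<zeta> n \<omega>)"
          by simp
        moreover have "(cmod (\<zeta> 0 \<omega>))\<^sup>2 \<le> 1" using z0 \<epsilon> by (intro power_le_one) auto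
        ultimately show ?thesis using S[of N] by linarith
      qed
      then have "(\<Sum>k=1..1. (cmod (sqrt_coeff (coeffs \<omega>) k))\<^sup>2) \<le> C * sqrt (y + 1) / (1/2) ^ (4 * 1)"
        by (intro Hole_sqrt_coeff_le[OF _ _ \<omega>]) auto
      then have s1: "(cmod (sqrt_coeff (coeffs \<omega>) (Suc 0)))\<^sup>2 \<le> 16 * C * sqrt (y + 1)"
        by (simp add: power_one_over eval_nat_numeral)
      have cs: "(cmod (csqrt (coeffs \<omega> 0)))\<^sup>2 = cmod (coeffs \<omega> 0)"
        by (simp flip: norm_power)
      have "(cmod (sqrt_coeff (coeffs \<omega>) (Suc 0)))\<^sup>2 = (cmod (coeffs \<omega> 1))\<^sup>2 / (4 * cmod (coeffs \<omega> 0))"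
        by (simp add: sqrt_coeff.simps norm_divide norm_mult power_divide power_mult_distrib cs)
      moreover have "c\<^sup>2 / (4 * (C * \<epsilon>)) \<le> (cmod (coeffs \<omega> 1))\<^sup>2 / (4 * cmod (coeffs \<omega> 0))"
      proof (intro frac_le mult_left_mono power_mono)
        have "c * 1 \<le> a 1 * cmod (\<zeta> 1 \<omega>)" using a_ge[of 1] a_pos[of 1] z1 by (intro mult_mono) auto
        then show "c \<le> cmod (coeffs \<omega> 1)" using a_pos[of 1] by (simp add: coeffs_def norm_mult mult.commute)
        have "C * cmod (\<zeta> 0 \<omega>) \<le> C * \<epsilon>" using z0 C_pos by (intro mult_left_mono) auto
        then show "cmod (coeffs \<omega> 0) \<le> C * \<epsilon>" using norm_coeffs_le[of \<omega> 0] by linarith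
        show "0 < 4 * cmod (coeffs \<omega> 0)" using z0n a_pos[of 0] by (simp add: coeffs_def)
      qed (use c_pos in auto)
      ultimately have "c\<^sup>2 / (4 * (C * \<epsilon>)) \<le> 16 * C * sqrt (y + 1)" using s1 by linarith
      then have "c\<^sup>2 \<le> 64 * C\<^sup>2 * sqrt (y + 1) * \<epsilon>"
        using C_pos \<epsilon> by (simp add: field_simps power2_eq_square)
      also have "\<dots> \<le> 64 * C\<^sup>2 * sqrt (y + 1) * (c\<^sup>2 / (128 * C\<^sup>2 * sqrt (y + 1)))"
        using y0 by (intro mult_left_mono) (auto simp: \<epsilon>_def)
      also have "\<dots> = c\<^sup>2 / 2" using C_pos y0 by simp
      finally show False using c_pos by simp
    qed
  qed
  then have "prob (Hole M a \<zeta> (1/2) \<inter> good) \<le> prob (space M - ?B)"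
    using Bm by (intro finite_measure_mono) auto
  also have "\<dots> = 1 - prob ?B" using Bm by (rule prob_compl)
  finally show ?thesis using B0 by linarith
qed

end

section \<open>Hole events are not too rare\<close>

lemma summable_suminf_le_1:
  fixes g :: "nat \<Rightarrow> real"
  assumes "\<And>n. 0 \<le> g n" "(\<Sum>n. ennreal (g n)) \<le> 1"
  shows "summable g" "suminf g \<le> 1"
proof -
  have "(\<Sum>n. ennreal (g n)) \<noteq> \<top>" using assms(2) by (auto simp: top_unique)
  then show s: "summable g" using assms(1) by (intro summable_suminf_not_top) auto
  have "ennreal (suminf g) = (\<Sum>n. ennreal (g n))"
    using assms(1) s by (intro suminf_ennreal2[symmetric]) auto
  then have "ennreal (suminf g) \<le> 1" using assms(2) by simp
  then show "suminf g \<le> 1" by (simp add: ennreal_le_1)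
qed

section \<open>Truncation of the series and the lower bound\<close>

context gaussian_coefficients
begin

text \<open>The expected tail is at most 5 C r^(L+1) / (1 - r), which tends to 0. Validity for all
  larger cut-offs allows rounding up to a multiple of the block length.\<close>

lemma prob_tail_le:
  assumes "0 < e" "0 < r" "r < 1"
  obtains L where "\<And>L'. L \<le> L' \<Longrightarrow>
    prob {\<omega> \<in> space M. 1 < (\<Sum>n. ennreal (cmod (\<zeta> n \<omega>) * (if n \<le> L' then 0 else C * r ^ n)))} \<le> e"
proof -
  define w where "w L n = (if n \<le> L then 0 else C * r ^ n)" for L n :: nat
  have w0: "0 \<le> w L n" for L n using C_pos assms by (simp add: w_def)
  have sw: "(\<Sum>n. ennreal (w L n)) = ennreal (C * r ^ Suc L / (1 - r))" for L
  proof -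
    have "(\<lambda>n. C * r ^ Suc L * r ^ n) sums (C * r ^ Suc L * (1 / (1 - r)))"
      using assms by (intro sums_mult geometric_sums) auto
    then have "(\<lambda>n. w L (n + Suc L)) sums (C * r ^ Suc L / (1 - r))"
      by (simp add: w_def power_add mult_ac)
    then have "w L sums (C * r ^ Suc L / (1 - r) + (\<Sum>n<Suc L. w L n))"
      by (subst (asm) sums_iff_shift)
    moreover have "(\<Sum>n<Suc L. w L n) = 0" by (intro sum.neutral) (auto simp: w_def)
    ultimately have "w L sums (C * r ^ Suc L / (1 - r))" by simp
    then show ?thesis using w0 by (metis suminf_ennreal_eq)
  qed
  have "(\<lambda>L. 5 * (C * r ^ Suc L / (1 - r))) \<longlonglongrightarrow> 5 * (C * 0 / (1 - r))"
    using assms by (intro tendsto_intros LIMSEQ_Suc LIMSEQ_realpow_zero) auto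
  then have "eventually (\<lambda>L. 5 * (C * r ^ Suc L / (1 - r)) < e) sequentially"
    using assms(1) by (intro order_tendstoD) auto
  then obtain L where L: "\<And>L'. L \<le> L' \<Longrightarrow> 5 * (C * r ^ Suc L' / (1 - r)) < e"
    by (auto simp: eventually_sequentially)
  show thesis
  proof (rule that[of L])
    fix L' assume "L \<le> L'"
    let ?u = "\<lambda>\<omega>. \<Sum>n. ennreal (cmod (\<zeta> n \<omega>) * w L' n)"
    have "emeasure M {\<omega> \<in> space M. 1 < ?u \<omega>} \<le> emeasure M ({\<omega> \<in> space M. 1 \<le> 1 * ?u \<omega>} \<inter> space M)"
      by (intro emeasure_mono) auto
    also have "\<dots> \<le> 1 * (\<integral>\<^sup>+\<omega>. ?u \<omega> * indicator (space M) \<omega> \<partial>M)"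
      using nn_integral_Markov_inequality[where A = "space M" and M = M and u = ?u and c = 1]
      by (simp add: Int_def conj_commute)
    also have "\<dots> = (\<integral>\<^sup>+\<omega>. ?u \<omega> \<partial>M)"
      unfolding mult_1 by (intro nn_integral_cong) auto
    also have "\<dots> \<le> 5 * (\<Sum>n. ennreal (w L' n))"
      by (rule nn_integral_\<zeta>_weighted_sum[OF w0])
    also have "\<dots> = ennreal (5 * (C * r ^ Suc L' / (1 - r)))"
      unfolding sw by (simp only: ennreal_mult' ennreal_numeral zero_le_numeral)
    also have "\<dots> \<le> ennreal e" using L[OF \<open>L \<le> L'\<close>] by (intro ennreal_leI) auto
    finally have "prob {\<omega> \<in> space M. 1 < ?u \<omega>} \<le> e"
      using assms(1) by (simp add: emeasure_eq_measure)
    then show "prob {\<omega> \<in> space M. 1 < (\<Sum>n. ennreal (cmod (\<zeta> n \<omega>) * (if n \<le> L' then 0 else C * r ^ n)))} \<le> e"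
      by (simp add: w_def)
  qed
qed

lemma F_tail_le:
  assumes \<omega>: "\<omega> \<in> good" and r: "0 < r" "r < 1" and z: "cmod z \<le> r"
    and tail: "(\<Sum>n. ennreal (cmod (\<zeta> n \<omega>) * (if n \<le> L then 0 else C * r ^ n))) \<le> 1"
  shows "cmod (F \<omega> z - (\<Sum>n\<le>L. coeffs \<omega> n * z ^ n)) \<le> 1"
proof -
  let ?g = "\<lambda>n. cmod (\<zeta> n \<omega>) * (if n \<le> L then 0 else C * r ^ n)"
  let ?f = "\<lambda>n. coeffs \<omega> n * z ^ n - (if n \<in> {..L} then coeffs \<omega> n * z ^ n else 0)"
  have g0: "0 \<le> ?g n" for n using C_pos r by simp
  note g = summable_suminf_le_1[of ?g, OF g0 tail]
  have "?f sums (F \<omega> z - (\<Sum>n\<in>{..L}. coeffs \<omega> n * z ^ n))"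
    unfolding F_eq using \<omega> z r
    by (intro sums_diff unit_disc_series_sums summable_coeffs sums_If_finite_set) auto
  then have "F \<omega> z - (\<Sum>n\<le>L. coeffs \<omega> n * z ^ n) = suminf ?f" by (simp add: sums_iff)
  also have "cmod (suminf ?f) \<le> suminf ?g"
  proof (rule norm_suminf_le[OF _ g(1)])
    fix n
    show "cmod (?f n) \<le> ?g n"
    proof (cases "n \<le> L")
      case False
      have "cmod (coeffs \<omega> n * z ^ n) \<le> C * cmod (\<zeta> n \<omega>) * r ^ n"
        unfolding norm_mult norm_power using norm_coeffs_le[of \<omega> n] C_pos z
        by (intro mult_mono power_mono) auto
      then show ?thesis using False by (simp add: mult_ac)
    qed simp
  qed
  finally show ?thesis using g(2) by linarith
qed

text \<open>The tail must fail with probability below half that of the main event, so the number of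
  blocks is chosen after \<open>p\<close>. This is not circular because the small ball cost does not
  depend on the number of blocks.\<close>

lemma Hole_lower_bound:
  obtains K where "0 < K" "\<And>r. 1 / 2 \<le> r \<Longrightarrow> r < 1 \<Longrightarrow> exp (- K / (1 - r)) \<le> prob (Hole M a \<zeta> r \<inter> good)"
proof -
  \<comment> \<open>With T below this gives (T + 2)^2 \<le> B m, the exponent in the lower tail
    bound for \<open>\<zeta> 0\<close>.\<close>
  define B where "B = ((6 * C + 2) / c + 2)\<^sup>2"
  have B0: "0 \<le> B" by (simp add: B_def)
  \<comment> \<open>The 3 comes from m \<le> 3 / \<delta>; the step from 6917 to 6918 is a spare
    exp(- m) \<le> 1/2 that pays for the tail.\<close>
  define K where "K = 3 * (B + 6918)"
  have "exp (- K / (1 - r)) \<le> prob (Hole M a \<zeta> r \<inter> good)" if r: "1 / 2 \<le> r" "r < 1" for r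
  proof -
    define \<delta> where "\<delta> = 1 - r"
    have \<delta>: "0 < \<delta>" "\<delta> \<le> 1/2" using r by (auto simp: \<delta>_def)
    \<comment> \<open>The 2 makes r^m \<le> exp(-2) \<le> 1/4, the decay between consecutive blocks
      that the small ball estimate demands.\<close>
    define m where "m = nat \<lceil>2 / \<delta>\<rceil>"
    have d4: "4 \<le> 2 / \<delta>" using \<delta> by (simp add: field_simps)
    have m: "2 / \<delta> \<le> real m" "real m \<le> 2 / \<delta> + 1" using d4 unfolding m_def by linarith+
    have m3: "real m \<le> 3 / \<delta>"
    proof -
      have "1 \<le> 1 / \<delta>" using \<delta> by simp
      then have "2 / \<delta> + 1 \<le> 2 / \<delta> + 1 / \<delta>" by linarith
      also have "\<dots> = 3 / \<delta>" by (simp add: add_divide_distrib[symmetric])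
      finally show ?thesis using m by linarith
    qed
    have m0: "0 < m" "1 \<le> real m" using m d4 by linarith+
    \<comment> \<open>Then the constant coefficient is at least 6 C sqrt(m) + 2: it beats the
      polynomial part, leaves 1 for the tail, and 1 more for strict positivity.\<close>
    define T where "T = (6 * C * sqrt (real m) + 2) / c"
    have T0: "0 \<le> T" using C_pos c_pos by (simp add: T_def)
    have rm: "r ^ m \<le> 1 / 4"
    proof -
      have "r ^ m \<le> exp (- \<delta>) ^ m"
        using r exp_ge_add_one_self[of "- \<delta>"] by (intro power_mono) (auto simp: \<delta>_def)
      also have "\<dots> = exp (- (\<delta> * real m))" by (simp add: mult.commute flip: exp_of_nat_mult)
      also have "\<dots> \<le> exp (- 2)" using m \<delta> by (simp add: field_simps)
      also have "\<dots> \<le> 1 / 4"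
      proof -
        have "(2::real)\<^sup>2 \<le> (exp 1)\<^sup>2" using exp_ge_add_one_self[of 1] by (intro power_mono) auto
        then have "(4::real) \<le> exp 2" by (simp flip: exp_double)
        then have "1 / exp 2 \<le> 1 / (4::real)" by (intro divide_left_mono) auto
        then show ?thesis by (simp add: exp_minus inverse_eq_divide)
      qed
      finally show ?thesis .
    qed
    \<comment> \<open>Since m \<ge> 1, the constants 3 (small ball) and 2 (from 1/pi \<ge> exp(-2))
      are absorbed as 5 m into 6912 m.\<close>
    define p where "p = exp (- (B + 6917) * real m)"
    have p0: "0 < p" by (simp add: p_def)
    obtain L0 where L0: "\<And>L'. L0 \<le> L' \<Longrightarrow>
        prob {\<omega> \<in> space M. 1 < (\<Sum>n. ennreal (cmod (\<zeta> n \<omega>) * (if n \<le> L' then 0 else C * r ^ n)))} \<le> p / 2"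
      using prob_tail_le[of "p / 2" r] p0 r by auto
    define L where "L = Suc L0 * m"
    have "L0 \<le> L" using m0 by (simp add: L_def trans_le_add1[OF le_trans[of L0 "L0 * m"]] trans_le_add2)
    then have PT: "prob {\<omega> \<in> space M. 1 < (\<Sum>n. ennreal (cmod (\<zeta> n \<omega>) * (if n \<le> L then 0 else C * r ^ n)))} \<le> p / 2"
      (is "prob ?T \<le> _") by (rule L0)
    have "\<bar>a n\<bar> \<le> C" for n using a_pos[of n] a_le[of n] by simp
    then obtain E where E: "E \<in> sets (gauss_PiM {1..L})"
      "exp (- 3 - 6912 * real m) \<le> measure (gauss_PiM {1..L}) E"
      "\<And>x z. x \<in> E \<Longrightarrow> cmod z \<le> r \<Longrightarrow> cmod (\<Sum>n=1..L. x n * complex_of_real (a n) * z ^ n) \<le> 6 * C * sqrt (real m)"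
      using gauss_polynomial_small_ball[OF m0(1) C_pos, of a r "Suc L0"] r rm unfolding L_def by auto
    have L1: "{1..L} \<noteq> {}" using m0 by (simp add: L_def)
    let ?D = "{\<omega> \<in> space M. \<zeta> 0 \<omega> \<in> {z. T \<le> cmod z} \<and> (\<lambda>i\<in>{1..L}. \<zeta> i \<omega>) \<in> E}"
    have Dm: "?D \<in> events"
    proof -
      have "{\<omega> \<in> space M. (\<lambda>i\<in>{1..L}. \<zeta> i \<omega>) \<in> E} \<in> events"
        using measurable_sets[OF measurable_\<zeta>_restrict E(1)] by (simp add: vimage_def Int_def conj_commute)
      moreover have "?D = {\<omega> \<in> space M. \<zeta> 0 \<omega> \<in> {z. T \<le> cmod z}} \<inter> {\<omega> \<in> space M. (\<lambda>i\<in>{1..L}. \<zeta> i \<omega>) \<in> E}" by auto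
      ultimately show ?thesis by simp
    qed
    have "p \<le> prob ?D"
    proof -
      have "prob ?D = prob {\<omega> \<in> space M. \<zeta> 0 \<omega> \<in> {z. T \<le> cmod z}} * prob {\<omega> \<in> space M. (\<lambda>i\<in>{1..L}. \<zeta> i \<omega>) \<in> E}"
        using E(1) by (intro prob_\<zeta>0_independent) auto
      also have "prob {\<omega> \<in> space M. \<zeta> 0 \<omega> \<in> {z. T \<le> cmod z}} = measure gauss {z. T \<le> cmod z}"
        by (rule prob_\<zeta>) measurable
      also have "prob {\<omega> \<in> space M. (\<lambda>i\<in>{1..L}. \<zeta> i \<omega>) \<in> E} = measure (gauss_PiM {1..L}) E"
        by (rule prob_\<zeta>_restrict[OF E(1) L1])
      finally have PD: "prob ?D = measure gauss {z. T \<le> cmod z} * measure (gauss_PiM {1..L}) E" .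
      have Tm: "(T + 2)\<^sup>2 \<le> B * real m"
      proof -
        have s1: "1 \<le> sqrt (real m)" using m0 by simp
        have "6 * C * sqrt (real m) + 2 \<le> (6 * C + 2) * sqrt (real m)" using s1 by (simp add: algebra_simps)
        then have "T \<le> (6 * C + 2) * sqrt (real m) / c"
          unfolding T_def using c_pos by (intro divide_right_mono) auto
        moreover have "((6 * C + 2) / c + 2) * sqrt (real m) = (6 * C + 2) * sqrt (real m) / c + 2 * sqrt (real m)"
          by (simp only: distrib_right times_divide_eq_left)
        ultimately have "T + 2 \<le> ((6 * C + 2) / c + 2) * sqrt (real m)" using s1 by linarith
        then have "(T + 2)\<^sup>2 \<le> (((6 * C + 2) / c + 2) * sqrt (real m))\<^sup>2" using T0 by (intro power_mono) auto
        then show ?thesis by (simp add: B_def power_mult_distrib)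
      qed
      have "exp (- 2) \<le> 1 / pi"
      proof -
        have "pi \<le> 2\<^sup>2" using pi_less_4 by simp
        also have "(2::real)\<^sup>2 \<le> (exp 1)\<^sup>2" using exp_ge_add_one_self[of 1] by (intro power_mono) auto
        finally have "pi \<le> exp 2" by (simp flip: exp_double)
        then have "1 / exp 2 \<le> 1 / pi" by (intro divide_left_mono) auto
        then show ?thesis by (simp add: exp_minus inverse_eq_divide)
      qed
      then have "exp (- B * real m) * exp (- 2) \<le> exp (- (T + 2)\<^sup>2) * (1 / pi)"
        using Tm by (intro mult_mono) auto
      also have "\<dots> \<le> measure gauss {z. T \<le> cmod z}"
        using measure_gauss_tail_ge[OF T0] by simp
      finally have "(exp (- B * real m) * exp (- 2)) * exp (- 3 - 6912 * real m) \<le> prob ?D"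
        unfolding PD using E(2) by (intro mult_mono) auto
      moreover have "p \<le> (exp (- B * real m) * exp (- 2)) * exp (- 3 - 6912 * real m)"
        unfolding p_def exp_add[symmetric] using m0 by (simp add: algebra_simps)
      ultimately show ?thesis by linarith
    qed
    have Tm: "?T \<in> events" by measurable
    have "good \<inter> (?D - ?T) \<subseteq> Hole M a \<zeta> r \<inter> good"
    proof
      fix \<omega> assume \<omega>: "\<omega> \<in> good \<inter> (?D - ?T)"
      have "F \<omega> z \<noteq> 0" if z: "cmod z \<le> r" for z
      proof
        assume "F \<omega> z = 0"
        moreover have "cmod (F \<omega> z - (\<Sum>n\<le>L. coeffs \<omega> n * z ^ n)) \<le> 1"
          using \<omega> r by (intro F_tail_le[OF _ _ _ z]) (auto simp: not_less)
        ultimately have "cmod (\<Sum>n\<le>L. coeffs \<omega> n * z ^ n) \<le> 1" by simp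
        moreover have "(\<Sum>n\<le>L. coeffs \<omega> n * z ^ n) = coeffs \<omega> 0 + (\<Sum>n=1..L. coeffs \<omega> n * z ^ n)"
        proof -
          have "{..L} = insert 0 {1..L}" by auto
          then show ?thesis by simp
        qed
        moreover have "cmod (\<Sum>n=1..L. coeffs \<omega> n * z ^ n) \<le> 6 * C * sqrt (real m)"
        proof -
          have "(\<Sum>n=1..L. coeffs \<omega> n * z ^ n)
              = (\<Sum>n=1..L. (\<lambda>i\<in>{1..L}. \<zeta> i \<omega>) n * complex_of_real (a n) * z ^ n)"
            by (intro sum.cong refl) (simp add: coeffs_def)
          then show ?thesis using E(3)[of "\<lambda>i\<in>{1..L}. \<zeta> i \<omega>" z] \<omega> z by simp
        qed
        moreover have "6 * C * sqrt (real m) + 2 \<le> cmod (coeffs \<omega> 0)"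
        proof -
          have "6 * C * sqrt (real m) + 2 = c * T" using c_pos by (simp add: T_def)
          also have "\<dots> \<le> a 0 * cmod (\<zeta> 0 \<omega>)"
            using \<omega> a_ge[of 0] a_pos[of 0] T0 by (intro mult_mono) auto
          also have "\<dots> = cmod (coeffs \<omega> 0)"
            using a_pos[of 0] by (simp add: coeffs_def norm_mult)
          finally show ?thesis .
        qed
        ultimately show False
          using norm_diff_ineq[of "coeffs \<omega> 0" "\<Sum>n=1..L. coeffs \<omega> n * z ^ n"] by simp
      qed
      then show "\<omega> \<in> Hole M a \<zeta> r \<inter> good" using \<omega> by (auto simp: Hole_def)
    qed
    moreover have "Hole M a \<zeta> r \<inter> good \<in> events" using r by (intro sets_Hole_good) auto
    ultimately have "prob (good \<inter> (?D - ?T)) \<le> prob (Hole M a \<zeta> r \<inter> good)"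
      by (intro finite_measure_mono)
    moreover have "prob (good \<inter> (?D - ?T)) = prob (?D - ?T)"
      using AE_good Dm Tm by (intro measure_eq_AE) (auto elim: AE_mp)
    moreover have "prob ?D - prob ?T \<le> prob (?D - ?T)"
      using finite_measure_Diff'[OF Dm Tm] finite_measure_mono[of "?D \<inter> ?T" ?T] Dm Tm by auto
    moreover have "exp (- K / (1 - r)) \<le> p / 2"
    proof -
      have "exp (- K / (1 - r)) = exp (- (B + 6918) * (3 / \<delta>))" by (simp add: K_def \<delta>_def)
      also have "\<dots> \<le> exp (- (B + 6918) * real m)"
        unfolding exp_le_cancel_iff mult_minus_left neg_le_iff_le
        using m3 B0 by (intro mult_left_mono) auto
      also have "\<dots> = p * exp (- real m)" unfolding p_def exp_add[symmetric] by (simp add: algebra_simps)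
      also have "\<dots> \<le> p * (1/2)"
      proof (intro mult_left_mono)
        have "2 \<le> exp (real m)" using exp_ge_add_one_self[of "real m"] m0 by linarith
        then show "exp (- real m) \<le> 1/2" by (simp add: exp_minus field_simps)
      qed (use p0 in simp)
      finally show ?thesis by simp
    qed
    ultimately show ?thesis using \<open>p \<le> prob ?D\<close> PT by linarith
  qed
  moreover have "0 < K" using B0 by (simp add: K_def)
  ultimately show thesis using that by blast
qed

section \<open>Combination of the two bounds\<close>

lemma Hole_mono: "r \<le> s \<Longrightarrow> Hole M a \<zeta> s \<subseteq> Hole M a \<zeta> r"
  by (auto simp: Hole_def)

text \<open>The factor 4 in the upper bound for the probability is harmless once \<kappa> / (1 - r)
  is large. For the remaining radii 1 - r is bounded below, and monotonicity reduces to radius 1/2,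
  where the probability is less than 1.\<close>

theorem hole_prob_bounds:
  "\<exists>c\<^sub>2 C\<^sub>2 :: real. 0 < c\<^sub>2 \<and> c\<^sub>2 \<le> C\<^sub>2 \<and>
    (\<forall>r. 1 / 2 \<le> r \<and> r < 1 \<longrightarrow>
       c\<^sub>2 / (1 - r) \<le> - ln (hole_prob M a \<zeta> r) \<and>
       - ln (hole_prob M a \<zeta> r) \<le> C\<^sub>2 / (1 - r))"
proof -
  obtain \<kappa> where \<kappa>: "0 < \<kappa>" "\<And>r. 1 / 2 \<le> r \<Longrightarrow> r < 1 \<Longrightarrow> prob (Hole M a \<zeta> r \<inter> good) \<le> 4 * exp (- \<kappa> / (1 - r))"
    using Hole_upper_bound by blast
  obtain K where K: "0 < K" "\<And>r. 1 / 2 \<le> r \<Longrightarrow> r < 1 \<Longrightarrow> exp (- K / (1 - r)) \<le> prob (Hole M a \<zeta> r \<inter> good)"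
    using Hole_lower_bound by blast
  define P where "P r = prob (Hole M a \<zeta> r \<inter> good)" for r
  have Ppos: "0 < P r" if "1 / 2 \<le> r" "r < 1" for r
    using K(2)[OF that] unfolding P_def by (rule less_le_trans[OF exp_gt_zero])
  define \<mu> where "\<mu> = - ln (P (1/2))"
  have \<mu>: "0 < \<mu>" using Hole_half_less_1 Ppos[of "1/2"] by (simp add: \<mu>_def P_def)
  have l4: "0 < ln (4 :: real)" by simp
  \<comment> \<open>The first term uses half of \<kappa> / (1 - r) to absorb ln 4 when \<kappa> / (1
    - r) is at least 2 ln 4; otherwise the second term makes the bound at most \<mu>.\<close>
  define c\<^sub>2 where "c\<^sub>2 = min (\<kappa> / 2) (\<mu> * \<kappa> / (2 * ln 4))"
  define C\<^sub>2 where "C\<^sub>2 = max c\<^sub>2 K"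
  have "c\<^sub>2 / (1 - r) \<le> - ln (P r) \<and> - ln (P r) \<le> C\<^sub>2 / (1 - r)" if r: "1 / 2 \<le> r" "r < 1" for r
  proof
    have d: "0 < 1 - r" using r by simp
    have "- ln (P r) \<le> K / (1 - r)"
      using K(2)[OF r] Ppos[OF r] ln_ge_iff[of "P r" "- K / (1 - r)"] by (simp add: P_def)
    also have "\<dots> \<le> C\<^sub>2 / (1 - r)" using d by (intro divide_right_mono) (auto simp: C\<^sub>2_def)
    finally show "- ln (P r) \<le> C\<^sub>2 / (1 - r)" .
    show "c\<^sub>2 / (1 - r) \<le> - ln (P r)"
    proof (cases "2 * ln 4 \<le> \<kappa> / (1 - r)")
      case True
      have "ln (P r) \<le> ln (4 * exp (- \<kappa> / (1 - r)))"
        using \<kappa>(2)[OF r] Ppos[OF r] by (simp add: P_def)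
      also have "\<dots> = ln 4 - \<kappa> / (1 - r)" by (simp add: ln_mult)
      finally have "\<kappa> / (1 - r) - ln 4 \<le> - ln (P r)" by linarith
      moreover have "c\<^sub>2 / (1 - r) \<le> (\<kappa> / 2) / (1 - r)" using d by (intro divide_right_mono) (auto simp: c\<^sub>2_def)
      moreover have "(\<kappa> / 2) / (1 - r) = \<kappa> / (1 - r) / 2" by simp
      ultimately show ?thesis using True by linarith
    next
      case False
      have "P r \<le> P (1/2)"
        unfolding P_def using Hole_mono[OF r(1)] by (intro finite_measure_mono) (auto intro!: sets_Hole_good)
      then have "\<mu> \<le> - ln (P r)" using Ppos[OF r] by (simp add: \<mu>_def)
      moreover have "c\<^sub>2 / (1 - r) \<le> (\<mu> * \<kappa> / (2 * ln 4)) / (1 - r)" using d by (intro divide_right_mono) (auto simp: c\<^sub>2_def)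
      moreover have "(\<mu> * \<kappa> / (2 * ln 4)) / (1 - r) = \<mu> / (2 * ln 4) * (\<kappa> / (1 - r))" by simp
      moreover have "\<mu> / (2 * ln 4) * (\<kappa> / (1 - r)) \<le> \<mu> / (2 * ln 4) * (2 * ln 4)"
        using False \<mu> l4 by (intro mult_left_mono) auto
      moreover have "\<mu> / (2 * ln 4) * (2 * ln 4) = \<mu>" using l4 by simp
      ultimately show ?thesis by linarith
    qed
  qed
  then have "\<forall>r. 1 / 2 \<le> r \<and> r < 1 \<longrightarrow>
       c\<^sub>2 / (1 - r) \<le> - ln (hole_prob M a \<zeta> r) \<and> - ln (hole_prob M a \<zeta> r) \<le> C\<^sub>2 / (1 - r)"
    by (simp add: P_def hole_prob_eq)
  moreover have "0 < c\<^sub>2" using \<kappa>(1) \<mu> l4 by (simp add: c\<^sub>2_def)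
  moreover have "c\<^sub>2 \<le> C\<^sub>2" by (simp add: C\<^sub>2_def)
  ultimately show ?thesis by blast
qed

end

theorem theorem2:
  fixes M :: "'a measure"
    and \<zeta> :: "nat \<Rightarrow> 'a \<Rightarrow> complex"
    and a :: "nat \<Rightarrow> real"
    and c\<^sub>1 C\<^sub>1 :: real
  assumes "prob_space M"
    and "prob_space.indep_vars M (\<lambda>_. borel) \<zeta> UNIV"
    and "\<And>n. std_complex_gaussian M (\<zeta> n)"
    and "0 < c\<^sub>1" and "c\<^sub>1 \<le> C\<^sub>1"
    and "\<And>n. c\<^sub>1 \<le> a n \<and> a n \<le> C\<^sub>1"
  shows "\<exists>c\<^sub>2 C\<^sub>2 :: real. 0 < c\<^sub>2 \<and> c\<^sub>2 \<le> C\<^sub>2 \<and>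
    (\<forall>r. 1 / 2 \<le> r \<and> r < 1 \<longrightarrow>
       c\<^sub>2 / (1 - r) \<le> - ln (hole_prob M a \<zeta> r) \<and>
       - ln (hole_prob M a \<zeta> r) \<le> C\<^sub>2 / (1 - r))"
proof -
  interpret prob_space M by (rule assms(1))
  interpret gaussian_coefficients M \<zeta> a c\<^sub>1 C\<^sub>1
    by unfold_locales (use assms in auto)
  show ?thesis by (rule hole_prob_bounds)
qed

end
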